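(* Up to Lie algebra isomorphism, there exists exactly one complex Anosov Lie algebra of type $(3,3,3)$.
   Context: Anosov: a rational Lie algebra $\mathfrak{n}^{\mathbb{Q}}$ of dimension $n$ is Anosov if it admits an automorphism $\tau$ which is hyperbolic (no complex eigenvalue of absolute value $1$) and unimodular, i.e. $[\tau]_\beta\in \mathrm{GL}_n(\mathbb{Z})$ for some basis $\beta$ of $\mathfrak{n}^{\mathbb{Q}}$. A real or complex Lie algebra is Anosov if it has a rational form which is Anosov. Type: with $C^0(\mathfrak{n})=\mathfrak{n}$ and $C^i(\mathfrak{n})=[\mathfrak{n},C^{i-1}(\mathfrak{n})]$, an $r$-step nilpotent Lie algebra $\mathfrak n$ (i.e. $C^{r-1}(\mathfrak n)\neq0$, $C^r(\mathfrak n)=0$) has type $(n_1,\dots,n_r)$, where $n_i=\dim C^{i-1}(\mathfrak{n})/C^i(\mathfrak{n})$. *)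

theory Defs
  imports "HOL-Analysis.Finite_Cartesian_Product" "Jordan_Normal_Form.Char_Poly"
begin

locale lie_algebra = vector_space scale
  for scale :: "'k::field \<Rightarrow> 'v::ab_group_add \<Rightarrow> 'v" +
  fixes bracket :: "'v \<Rightarrow> 'v \<Rightarrow> 'v"
  assumes bracket_linear_left: "Vector_Spaces.linear scale scale (\<lambda>x. bracket x y)"
    and bracket_linear_right: "Vector_Spaces.linear scale scale (\<lambda>y. bracket x y)"
    and bracket_alternating: "bracket x x = 0"
    and jacobi: "bracket x (bracket y z) + bracket y (bracket z x) + bracket z (bracket x y) = 0"
begin

definition subalgebra :: "'v set \<Rightarrow> bool" where
  "subalgebra F \<longleftrightarrow> subspace F \<and> (\<forall>x\<in>F. \<forall>y\<in>F. bracket x y \<in> F)"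

definition automorphism_on :: "'v set \<Rightarrow> ('v \<Rightarrow> 'v) \<Rightarrow> bool" where
  "automorphism_on F \<tau> \<longleftrightarrow> bij_betw \<tau> F F
     \<and> (\<forall>x\<in>F. \<forall>y\<in>F. \<tau> (x + y) = \<tau> x + \<tau> y)
     \<and> (\<forall>c. \<forall>x\<in>F. \<tau> (scale c x) = scale c (\<tau> x))
     \<and> (\<forall>x\<in>F. \<forall>y\<in>F. \<tau> (bracket x y) = bracket (\<tau> x) (\<tau> y))"

definition basis_of :: "'v set \<Rightarrow> 'v set \<Rightarrow> bool" where
  "basis_of F B \<longleftrightarrow> independent B \<and> span B = F"

definition ordered_basis_of :: "'v set \<Rightarrow> 'v list \<Rightarrow> bool" where
  "ordered_basis_of F \<beta> \<longleftrightarrow> distinct \<beta> \<and> basis_of F (set \<beta>)"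

text \<open>Column \<open>j\<close> holds the coordinates of the image of the \<open>j\<close>-th basis vector.\<close>

definition matrix_wrt :: "'v list \<Rightarrow> ('v \<Rightarrow> 'v) \<Rightarrow> 'k mat" where
  "matrix_wrt \<beta> \<tau> =
     mat (length \<beta>) (length \<beta>) (\<lambda>(i, j). representation (set \<beta>) (\<tau> (\<beta> ! j)) (\<beta> ! i))"

fun lower_central :: "nat \<Rightarrow> 'v set" where
  "lower_central 0 = UNIV"
| "lower_central (Suc i) = span {bracket x y | x y. y \<in> lower_central i}"

text \<open>For subspaces \<open>W \<subseteq> V\<close>: the quotient \<open>V / W\<close> has dimension \<open>n\<close>, i.e. there are \<open>n\<close>
  elements of \<open>V\<close> whose classes are linearly independent in \<open>V / W\<close> and span it.
  Infinite-dimensional quotients have no dimension in this sense.\<close>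

definition quotient_has_dim :: "'v set \<Rightarrow> 'v set \<Rightarrow> nat \<Rightarrow> bool" where
  "quotient_has_dim V W n \<longleftrightarrow> (\<exists>B\<subseteq>V. finite B \<and> card B = n
     \<and> (\<forall>c. (\<Sum>b\<in>B. scale (c b) b) \<in> W \<longrightarrow> (\<forall>b\<in>B. c b = 0))
     \<and> (\<forall>v\<in>V. \<exists>c. v - (\<Sum>b\<in>B. scale (c b) b) \<in> W))"

text \<open>With \<open>r = length ns\<close>, the Lie algebra is \<open>r\<close>-step nilpotent of type \<open>ns\<close>; the list is
  indexed from \<open>0\<close>, so \<open>ns ! i\<close> is the customary \<open>n\<^sub>i\<^sub>+\<^sub>1\<close>.\<close>

definition has_type :: "nat list \<Rightarrow> bool" where
  "has_type ns \<longleftrightarrow> ns \<noteq> []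
     \<and> lower_central (length ns - 1) \<noteq> {0} \<and> lower_central (length ns) = {0}
     \<and> (\<forall>i<length ns. quotient_has_dim (lower_central i) (lower_central (Suc i)) (ns ! i))"

end

definition lie_isomorphic ::
  "('k::field \<Rightarrow> 'v::ab_group_add \<Rightarrow> 'v) \<Rightarrow> ('v \<Rightarrow> 'v \<Rightarrow> 'v) \<Rightarrow>
   ('k \<Rightarrow> 'w::ab_group_add \<Rightarrow> 'w) \<Rightarrow> ('w \<Rightarrow> 'w \<Rightarrow> 'w) \<Rightarrow> bool" where
  "lie_isomorphic s b s' b' \<longleftrightarrow>
     (\<exists>f. Vector_Spaces.linear s s' f \<and> bij f \<and> (\<forall>x y. f (b x y) = b' (f x) (f y)))"

text \<open>A rational Lie algebra is treated as a subalgebra \<open>F\<close> of an ambient one over the rationals,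
  so that the definitions below apply directly to rational forms.\<close>

locale rational_lie_algebra = lie_algebra scale bracket
  for scale :: "rat \<Rightarrow> 'v::ab_group_add \<Rightarrow> 'v" and bracket :: "'v \<Rightarrow> 'v \<Rightarrow> 'v"
begin

definition complex_eigenvalue_on :: "'v set \<Rightarrow> ('v \<Rightarrow> 'v) \<Rightarrow> complex \<Rightarrow> bool" where
  "complex_eigenvalue_on F \<tau> z \<longleftrightarrow>
     (\<exists>\<beta>. ordered_basis_of F \<beta> \<and> eigenvalue (map_mat of_rat (matrix_wrt \<beta> \<tau>)) z)"

definition hyperbolic_on :: "'v set \<Rightarrow> ('v \<Rightarrow> 'v) \<Rightarrow> bool" where
  "hyperbolic_on F \<tau> \<longleftrightarrow> \<not> (\<exists>z. complex_eigenvalue_on F \<tau> z \<and> cmod z = 1)"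

text \<open>The matrix \<open>A\<close> is over the integers, so \<^const>\<open>invertible_mat\<close> requires an integral inverse.\<close>

definition unimodular_on :: "'v set \<Rightarrow> ('v \<Rightarrow> 'v) \<Rightarrow> bool" where
  "unimodular_on F \<tau> \<longleftrightarrow> (\<exists>\<beta> A. ordered_basis_of F \<beta> \<and>
     invertible_mat (A :: int mat) \<and> matrix_wrt \<beta> \<tau> = map_mat of_int A)"

definition anosov_on :: "'v set \<Rightarrow> bool" where
  "anosov_on F \<longleftrightarrow> (\<exists>\<tau>. automorphism_on F \<tau> \<and> hyperbolic_on F \<tau> \<and> unimodular_on F \<tau>)"

end

locale char_0_lie_algebra = lie_algebra scale bracket
  for scale :: "'k::field_char_0 \<Rightarrow> 'v::ab_group_add \<Rightarrow> 'v" and bracket :: "'v \<Rightarrow> 'v \<Rightarrow> 'v"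
begin

definition rational_scale :: "rat \<Rightarrow> 'v \<Rightarrow> 'v" where
  "rational_scale q v = scale (of_rat q) v"

sublocale rational: rational_lie_algebra rational_scale bracket
proof -
  have vs: "vector_space rational_scale"
    by unfold_locales
      (simp_all add: rational_scale_def scale_right_distrib scale_left_distrib of_rat_add of_rat_mult)
  have lin: "Vector_Spaces.linear rational_scale rational_scale f"
    if "Vector_Spaces.linear scale scale f" for f
    using that vs unfolding Vector_Spaces.linear_iff by (simp add: rational_scale_def)
  show "rational_lie_algebra rational_scale bracket"
    unfolding rational_lie_algebra_def lie_algebra_def lie_algebra_axioms_def
    using vs lin bracket_linear_left bracket_linear_right bracket_alternating jacobi by blast
qed

text \<open>The canonical map from the scalar extension of \<open>F\<close> to the whole algebra is an isomorphism
  iff some (equivalently, every) basis of \<open>F\<close> over the rationals is a basis over \<open>'k\<close>.\<close>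

definition rational_form :: "'v set \<Rightarrow> bool" where
  "rational_form F \<longleftrightarrow> rational.subalgebra F \<and> (\<exists>B. rational.basis_of F B \<and> basis_of UNIV B)"

definition anosov :: bool where
  "anosov \<longleftrightarrow> (\<exists>F. rational_form F \<and> rational.anosov_on F)"

end

definition complex_anosov_of_type ::
  "nat list \<Rightarrow> (complex \<Rightarrow> 'v::ab_group_add \<Rightarrow> 'v) \<Rightarrow> ('v \<Rightarrow> 'v \<Rightarrow> 'v) \<Rightarrow> bool" where
  "complex_anosov_of_type ns s b \<longleftrightarrow>
     lie_algebra s b \<and> char_0_lie_algebra.anosov s b \<and> lie_algebra.has_type s b ns"

end

theory Submission
  imports Defs
begin

text \<open>
  In type \<open>(3, 3, 3)\<close> the algebra is generated by three elements and \<open>[C\<^sup>1, C\<^sup>1] = 0\<close>, so the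
  triple brackets depend only on the classes of the generators modulo \<open>C\<^sup>1\<close>. The automorphism acts
  on \<open>\<nn> / C\<^sup>1\<close> by a rational matrix with bounded denominators in all of its powers, so its eigenvalues
  \<open>a, b, c\<close> satisfy \<open>|abc| = 1\<close>; a coincidence \<open>a = \<plusminus>b\<close> would produce a rational eigenvalue, which is
  \<open>\<plusminus>1\<close>. Choose eigenvectors \<open>x\<^sub>1, x\<^sub>2, x\<^sub>3\<close> modulo \<open>C\<^sup>1\<close>. Brackets of three different \<open>x\<^sub>i\<close> have the
  eigenvalue \<open>abc\<close> and vanish by hyperbolicity, so \<open>C\<^sup>2\<close> is spanned by the six eigenvectors
  \<open>[x\<^sub>i, [x\<^sub>i, x\<^sub>j]]\<close>, whose eigenvalues are distinct. Exactly three of them are nonzero, and the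
  product of their eigenvalues again has absolute value 1. Identifying the six eigenvalues with the
  roots of \<open>A\<^sub>2\<close>, three consecutive roots, or two opposite roots and a third one, would force
  one eigenvalue to have absolute value 1; what remains are the two triangles in the hexagon, which are exchanged by
  renumbering the generators. Hence the structure constants are determined.

  Conversely, the triangle algebra has a rational form made of three copies of a cyclic cubic field
  \<open>K\<close> with Galois generator \<open>\<sigma>\<close>, with brackets \<open>x \<sigma>(y) - \<sigma>(x) y\<close> and \<open>x w\<close>. A unit \<open>r\<close> of \<open>K\<close> acts on
  it by multiplication with \<open>r\<close>, \<open>r \<sigma>(r)\<close> and \<open>r\<^sup>2 \<sigma>(r)\<close>.
\<close>

section \<open>Rational blocks of unimodular matrices\<close>

text \<open>The basis that exhibits unimodularity is unrelated to the lower central series, so no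
  integral matrix for a subquotient is at hand. Instead, a subquotient map \<open>P\<close> is tied
  to the integral matrix \<open>A\<close> by rational rectangular matrices with
  \<open>R * A = P * R\<close> and \<open>R * S = 1\<close>. This yields integrality of
  \<open>det P\<close>, though not of the entries of \<open>P\<close>, and the same argument for the
  inverse of \<open>A\<close> makes the determinant a unit.

  The roots of A_2 enter through logarithms: if \<alpha>_i is the logarithm of the absolute value of
  the eigenvalue of x_i, the \<alpha>_i have sum 0, and the weight 2\<alpha>_i + \<alpha>_j of [x_i,
  [x_i, x_j]] equals \<alpha>_i - \<alpha>_k for the third index k. Three consecutive roots add up
  to twice the middle one, two opposite roots and a third to that third one, whereas a triangle has
  sum 0 without any condition. The case a = -b has to be excluded because a^2 c and b^2 c must
  differ.

  For existence, the unit is 2 cos(2 pi / 7): its norm is 1, and doubling the angle is the Galois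
  generator.\<close>

lemma Ints_if_bounded_denominators:
  fixes d :: "'a::field_char_0"
  assumes "d \<in> \<rat>" "D \<noteq> 0" and pw: "\<And>k. of_int D * d ^ k \<in> \<int>"
  shows "d \<in> \<int>"
proof -
  obtain a b where b: "b > 0" "coprime a b" "d = of_int a / of_int b"
    using Rats_cases'[OF assms(1)] by metis
  \<comment> \<open>Clearing denominators gives \<open>D * a^k = z * b^k\<close> with
    \<open>b^k\<close> coprime to \<open>a^k\<close>. Hence all powers of \<open>b\<close> divide
    the fixed nonzero \<open>D\<close>.\<close>
  have dv: "b ^ k dvd D" for k
  proof -
    obtain z where z: "of_int D * d ^ k = (of_int z :: 'a)" using pw[of k] by (auto elim: Ints_cases)
    have "of_int (D * a ^ k) = (of_int (z * b ^ k) :: 'a)"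
      using z b by (simp add: power_divide field_simps)
    then have "D * a ^ k = z * b ^ k" by (simp only: of_int_eq_iff)
    then have "b ^ k dvd D * a ^ k" by simp
    moreover have "coprime (b ^ k) (a ^ k)" using b(2) by (simp add: coprime_commute)
    ultimately show ?thesis by (simp add: coprime_dvd_mult_left_iff)
  qed
  have "b = 1"
  proof (rule ccontr)
    assume "b \<noteq> 1"
    then have b2: "b \<ge> 2" using b by simp
    \<comment> \<open>Any exponent with \<open>2^k > |D|\<close> gives the contradiction;
      \<open>k = |D|\<close> is large enough.\<close>
    let ?k = "nat \<bar>D\<bar>"
    have "int ?k < 2 ^ ?k" by (rule of_nat_less_two_power)
    also have "\<dots> \<le> b ^ ?k" using b2 by (intro power_mono) auto
    finally have "\<bar>D\<bar> < b ^ ?k" by simp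
    moreover have "b ^ ?k \<le> \<bar>D\<bar>" using dv[of ?k] assms(2) by (simp add: zdvd_imp_le)
    ultimately show False by simp
  qed
  then show ?thesis using b by simp
qed

lemma common_denominator:
  assumes "finite X" "X \<subseteq> (\<rat> :: 'a::field_char_0 set)"
  obtains D where "D \<noteq> 0" "\<And>x. x \<in> X \<Longrightarrow> of_int D * x \<in> \<int>"
proof -
  have "\<exists>D. D \<noteq> 0 \<and> (\<forall>x\<in>X. of_int D * x \<in> \<int>)"
    using assms
  proof (induction X rule: finite_induct)
    case empty
    then show ?case by (intro exI[of _ 1]) auto
  next
    case (insert x X)
    then obtain D where D: "D \<noteq> 0" "\<forall>x\<in>X. of_int D * x \<in> \<int>" by auto
    obtain a b where b: "b > 0" "coprime a b" "x = of_int a / of_int b"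
      using insert.prems Rats_cases'[of x] by (metis insert_subset)
    have "of_int (b * D) * y \<in> \<int>" if "y \<in> insert x X" for y
    proof (cases "y = x")
      case True
      then have "of_int (b * D) * y = of_int (D * a)" using b by simp
      then show ?thesis by (metis Ints_of_int)
    next
      case False
      then have "of_int D * y \<in> \<int>" using that D by blast
      then have "of_int b * (of_int D * y) \<in> \<int>" by (rule Ints_mult[OF Ints_of_int])
      then show ?thesis by (metis mult.assoc of_int_mult)
    qed
    then show ?case using b D by (intro exI[of _ "b * D"]) auto
  qed
  then show ?thesis using that by blast
qed

text \<open>Separate sets for the two factors and for the product allow an integral matrix to be
  multiplied by a rational one.\<close>

lemma mult_mat_entries_in:
  assumes "A \<in> carrier_mat m n" "B \<in> carrier_mat n p"
    and "\<And>i j. i < m \<Longrightarrow> j < n \<Longrightarrow> A $$ (i, j) \<in> X" "\<And>i j. i < n \<Longrightarrow> j < p \<Longrightarrow> B $$ (i, j) \<in> Y"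
    and "i < m" "j < p"
    and "\<And>x y. x \<in> X \<Longrightarrow> y \<in> Y \<Longrightarrow> x * y \<in> Z" "\<And>x y. x \<in> Z \<Longrightarrow> y \<in> Z \<Longrightarrow> x + y \<in> Z" "0 \<in> Z"
  shows "(A * B) $$ (i, j) \<in> Z"
proof -
  have s: "(\<Sum>k\<in>K. g k) \<in> Z" if "\<And>k. k \<in> K \<Longrightarrow> g k \<in> Z" "finite K" for g and K :: "nat set"
    using that(2,1) by (induction K rule: finite_induct) (auto intro: assms)
  have "(A * B) $$ (i, j) = (\<Sum>k = 0..<n. A $$ (i, k) * B $$ (k, j))"
    using assms(1,2,5,6) by (simp add: scalar_prod_def)
  also have "\<dots> \<in> Z" using assms(3-7) by (intro s) auto
  finally show ?thesis .
qed

text \<open>The Leibniz formula is a polynomial in the entries with coefficients 1 and -1.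
  Integrality and rationality of a determinant are both instances.\<close>

lemma det_in_subring:
  assumes "A \<in> carrier_mat n n" "\<And>i j. i < n \<Longrightarrow> j < n \<Longrightarrow> A $$ (i, j) \<in> X"
    and "\<And>x y. x \<in> X \<Longrightarrow> y \<in> X \<Longrightarrow> x * y \<in> X" "\<And>x y. x \<in> X \<Longrightarrow> y \<in> X \<Longrightarrow> x + y \<in> X"
    and "0 \<in> X" "1 \<in> X" "-1 \<in> X"
  shows "det A \<in> X"
proof -
  have s: "(\<Sum>k\<in>K. g k) \<in> X" if "\<And>k. k \<in> K \<Longrightarrow> g k \<in> X" for g and K :: "(nat \<Rightarrow> nat) set"
    using that by (induction K rule: infinite_finite_induct) (auto intro: assms)
  have p: "(\<Prod>k\<in>K. g k) \<in> X" if "\<And>k. k \<in> K \<Longrightarrow> g k \<in> X" for g and K :: "nat set"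
    using that by (induction K rule: infinite_finite_induct) (auto intro: assms)
  show ?thesis
    unfolding det_def'[OF assms(1)]
  proof (rule s)
    fix q assume "q \<in> {q. q permutes {0..<n}}"
    then have "(\<Prod>i = 0..<n. A $$ (i, q i)) \<in> X" by (intro p assms(2)) auto
    moreover have "(signof q :: 'a) \<in> X" using assms(6,7) by (cases q rule: sign_cases) auto
    ultimately show "signof q * (\<Prod>i = 0..<n. A $$ (i, q i)) \<in> X" by (rule assms(3)[rotated])
  qed
qed

text \<open>The powers \<open>P ^ k = R * A ^ k * S\<close> have bounded denominators.\<close>

lemma det_block_in_Ints:
  fixes A :: "'a::field_char_0 mat"
  assumes A: "A \<in> carrier_mat n n" and R: "R \<in> carrier_mat m n" and S: "S \<in> carrier_mat n m"
    and P: "P \<in> carrier_mat m m"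
    and Ai: "\<And>i j. i < n \<Longrightarrow> j < n \<Longrightarrow> A $$ (i, j) \<in> \<int>"
    and Rr: "\<And>i j. i < m \<Longrightarrow> j < n \<Longrightarrow> R $$ (i, j) \<in> \<rat>"
    and Sr: "\<And>i j. i < n \<Longrightarrow> j < m \<Longrightarrow> S $$ (i, j) \<in> \<rat>"
    and RA: "R * A = P * R" and RS: "R * S = 1\<^sub>m m"
  shows "det P \<in> \<int>"
proof -
  let ?X = "(\<lambda>(i, j). R $$ (i, j)) ` ({..<m} \<times> {..<n})"
  let ?Y = "(\<lambda>(i, j). S $$ (i, j)) ` ({..<n} \<times> {..<m})"
  obtain D where D: "D \<noteq> 0" "\<And>x. x \<in> ?X \<union> ?Y \<Longrightarrow> of_int D * x \<in> \<int>"
    using Rr Sr by (rule_tac common_denominator[of "?X \<union> ?Y"]) auto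
  let ?d = "of_int D :: 'a"
  have dR: "?d * R $$ (i, j) \<in> \<int>" if "i < m" "j < n" for i j
    by (rule D(2)) (use that in force)
  have dS: "?d * S $$ (i, j) \<in> \<int>" if "i < n" "j < m" for i j
    by (rule D(2)) (use that in force)
  have A_pow: "A ^\<^sub>m k \<in> carrier_mat n n" for k using A by simp
  have P_pow: "P ^\<^sub>m k \<in> carrier_mat m m" for k using P by simp
  have Ak: "(A ^\<^sub>m k) $$ (i, j) \<in> \<int>" if "i < n" "j < n" for i j k
    using that
  proof (induction k arbitrary: i j)
    case (Suc k)
    show ?case unfolding pow_mat.simps
      by (rule mult_mat_entries_in[OF A_pow A Suc.IH Ai Suc.prems]) auto
  qed (use A in auto)
  have RAk: "R * A ^\<^sub>m k = P ^\<^sub>m k * R" for k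
  proof (induction k)
    case (Suc k)
    have "R * A ^\<^sub>m Suc k = (R * A ^\<^sub>m k) * A" using assoc_mult_mat[OF R A_pow A] by simp
    also have "\<dots> = P ^\<^sub>m k * (R * A)" using Suc assoc_mult_mat[OF P_pow R A] by simp
    also have "\<dots> = P ^\<^sub>m Suc k * R" using RA assoc_mult_mat[OF P_pow P R] by simp
    finally show ?case .
  qed (use A P R in auto)
  have Pk: "P ^\<^sub>m k = R * (A ^\<^sub>m k * S)" for k
  proof -
    have "R * (A ^\<^sub>m k * S) = (R * A ^\<^sub>m k) * S" using assoc_mult_mat[OF R A_pow S] by simp
    also have "\<dots> = P ^\<^sub>m k * (R * S)" unfolding RAk by (rule assoc_mult_mat[OF P_pow R S])
    finally show ?thesis unfolding RS right_mult_one_mat[OF P_pow] by (rule sym)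
  qed
  \<comment> \<open>\<open>D\<close> clears the denominators of both \<open>R\<close> and
    \<open>S\<close>, and \<open>A^k\<close> is integral, so one constant serves for every
    \<open>k\<close>.\<close>
  have ent: "(?d \<cdot>\<^sub>m R * (A ^\<^sub>m k * (?d \<cdot>\<^sub>m S))) $$ (i, j) \<in> \<int>" if "i < m" "j < m" for i j k
  proof (rule mult_mat_entries_in[where X = \<int> and Y = \<int>, OF _ _ _ _ that])
    show "(A ^\<^sub>m k * (?d \<cdot>\<^sub>m S)) $$ (i, j) \<in> \<int>" if "i < n" "j < m" for i j
    proof (rule mult_mat_entries_in[where X = \<int> and Y = \<int>, OF A_pow _ Ak _ that])
      show "(?d \<cdot>\<^sub>m S) $$ (i, j) \<in> \<int>" if "i < n" "j < m" for i j
        using that S dS[OF that] by simp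
    qed (use S in simp_all)
    show "(?d \<cdot>\<^sub>m R) $$ (i, j) \<in> \<int>" if "i < m" "j < n" for i j
      using that R dR[OF that] by simp
    show "A ^\<^sub>m k * (?d \<cdot>\<^sub>m S) \<in> carrier_mat n m" using A_pow[of k] S by simp
  qed (use R in simp_all)
  \<comment> \<open>Scaling by \<open>D\<close> on both sides multiplies an \<open>m\<close> by
    \<open>m\<close> determinant by \<open>D^(2m)\<close>, which is therefore a common denominator
    of all powers of \<open>det P\<close>.\<close>
  have "of_int (D ^ (2 * m)) * det P ^ k \<in> \<int>" for k
  proof -
    have pw: "det (P ^\<^sub>m k) = det P ^ k"
      by (induction k) (use P in \<open>auto simp: det_mult[OF P_pow P]\<close>)
    have e: "?d \<cdot>\<^sub>m R * (A ^\<^sub>m k * (?d \<cdot>\<^sub>m S)) = (?d * ?d) \<cdot>\<^sub>m P ^\<^sub>m k"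
    proof -
      have AS: "A ^\<^sub>m k * S \<in> carrier_mat n m" using A_pow[of k] S by simp
      have "?d \<cdot>\<^sub>m R * (A ^\<^sub>m k * (?d \<cdot>\<^sub>m S)) = ?d \<cdot>\<^sub>m (?d \<cdot>\<^sub>m (R * (A ^\<^sub>m k * S)))"
        using mult_smult_distrib[OF A_pow S] mult_smult_distrib[OF R AS]
          mult_smult_assoc_mat[OF R, of "?d \<cdot>\<^sub>m (A ^\<^sub>m k * S)" m ?d] AS by simp
      moreover have "?d \<cdot>\<^sub>m (?d \<cdot>\<^sub>m M) = (?d * ?d) \<cdot>\<^sub>m M" for M :: "'a mat"
        by (rule eq_matI) (auto simp: mult.assoc)
      ultimately show ?thesis unfolding Pk by (rule trans)
    qed
    have "det (?d \<cdot>\<^sub>m R * (A ^\<^sub>m k * (?d \<cdot>\<^sub>m S))) \<in> \<int>"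
      by (rule det_in_subring[of _ m, OF _ ent]) (use R S in auto)
    then have "(?d * ?d) ^ m * det (P ^\<^sub>m k) \<in> \<int>"
      unfolding e det_smult carrier_matD(2)[OF P_pow] .
    then show ?thesis unfolding pw power_mult power2_eq_square of_int_power of_int_mult .
  qed
  moreover have "det P \<in> \<rat>"
  proof (rule det_in_subring[OF P])
    show "P $$ (i, j) \<in> \<rat>" if "i < m" "j < m" for i j
    proof -
      have "P ^\<^sub>m 1 = P" "A ^\<^sub>m 1 = A" using P A by simp_all
      then have "P = R * (A * S)" using Pk[of 1] by argo
      also have "(R * (A * S)) $$ (i, j) \<in> \<rat>"
      proof (rule mult_mat_entries_in[OF R _ Rr _ that])
        show "(A * S) $$ (i, j) \<in> \<rat>" if "i < n" "j < m" for i j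
          by (rule mult_mat_entries_in[OF A S Ai Sr that]) (use Ints_subset_Rats in auto)
      qed (use A S in auto)
      finally show ?thesis .
    qed
  qed auto
  ultimately show ?thesis using D(1) by (meson Ints_if_bounded_denominators power_not_zero)
qed

lemma cmod_Ints_unit:
  assumes "x \<in> \<int>" "y \<in> \<int>" "x * y = (1 :: complex)"
  shows "cmod x = 1"
proof -
  obtain a b where ab: "x = of_int a" "y = of_int b" using assms by (auto elim!: Ints_cases)
  have "of_int (a * b) = (of_int 1 :: complex)" using assms ab by simp
  then have "a * b = 1" by (simp only: of_int_eq_iff)
  then have "\<bar>a\<bar> = 1" using zmult_eq_1_iff by auto
  then show ?thesis using ab by (auto simp: abs_if split: if_splits)
qed

text \<open>\<open>R\<close> is a rational projection to a quotient on which \<open>A\<close>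
  induces \<open>P\<close>, and \<open>S\<close> is a section of it. The integral inverse
  \<open>B\<close> induces \<open>P' = R * B * S\<close>, which is inverse to \<open>P\<close>; so
  both determinants are integers, with product 1.\<close>

lemma cmod_det_block:
  fixes A B :: "complex mat"
  assumes A: "A \<in> carrier_mat n n" and B: "B \<in> carrier_mat n n"
    and R: "R \<in> carrier_mat m n" and S: "S \<in> carrier_mat n m"
    and P: "P \<in> carrier_mat m m"
    and Ai: "\<And>i j. i < n \<Longrightarrow> j < n \<Longrightarrow> A $$ (i, j) \<in> \<int>"
    and Bi: "\<And>i j. i < n \<Longrightarrow> j < n \<Longrightarrow> B $$ (i, j) \<in> \<int>"
    and Rr: "\<And>i j. i < m \<Longrightarrow> j < n \<Longrightarrow> R $$ (i, j) \<in> \<rat>"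
    and Sr: "\<And>i j. i < n \<Longrightarrow> j < m \<Longrightarrow> S $$ (i, j) \<in> \<rat>"
    and AB: "A * B = 1\<^sub>m n" and RA: "R * A = P * R" and RS: "R * S = 1\<^sub>m m"
  shows "cmod (det P) = 1"
proof -
  define P' where "P' = R * B * S"
  have P': "P' \<in> carrier_mat m m" using R B S by (simp add: P'_def)
  have RB: "R * B \<in> carrier_mat m n" using R B by simp
  have PRB: "P * (R * B) = R"
    using assoc_mult_mat[OF P R B] assoc_mult_mat[OF R A B] AB R by (simp flip: RA)
  have "P * P' = P * (R * B) * S"
    unfolding P'_def using assoc_mult_mat[OF P RB S] by simp
  then have PP': "P * P' = 1\<^sub>m m" using PRB RS by simp
  then have P'P: "P' * P = 1\<^sub>m m" by (rule mat_mult_left_right_inverse[OF P P'])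
  have RB': "R * B = P' * R"
    using assoc_mult_mat[OF P' P RB] unfolding P'P PRB left_mult_one_mat[OF RB] .
  have "det P \<in> \<int>" by (rule det_block_in_Ints[OF A R S P Ai Rr Sr RA RS])
  moreover have "det P' \<in> \<int>" by (rule det_block_in_Ints[OF B R S P' Bi Rr Sr RB' RS])
  moreover have "det P * det P' = 1" using PP' det_mult[OF P P'] by simp
  ultimately show ?thesis by (rule cmod_Ints_unit)
qed

text \<open>An eigenvector of the quotient map need not lift to one of \<open>A\<close>, but a left
  eigenvector pulls back along \<open>R\<close>. The transpose of \<open>R\<close> is injective
  because \<open>S\<close> is a right inverse of \<open>R\<close>.\<close>

lemma eigenvalue_block:
  fixes A :: "'a::field mat"
  assumes A: "A \<in> carrier_mat n n" and R: "R \<in> carrier_mat m n" and S: "S \<in> carrier_mat n m"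
    and P: "P \<in> carrier_mat m m" and RA: "R * A = P * R" and RS: "R * S = 1\<^sub>m m"
    and z: "eigenvalue P z"
  shows "eigenvalue A z"
proof -
  have tr: "eigenvalue M z = eigenvalue (transpose_mat M) z" if "M \<in> carrier_mat k k" for M :: "'a mat" and k
  proof -
    have "det (char_matrix (transpose_mat M) z) = det (char_matrix M z)"
    proof -
      have "char_matrix (transpose_mat M) z = transpose_mat (char_matrix M z)"
        using that by (intro eq_matI) (auto simp: char_matrix_def)
      then show ?thesis using det_transpose[of "char_matrix M z" k] that by simp
    qed
    then show ?thesis using eigenvalue_det[of M k z] eigenvalue_det[of "transpose_mat M" k z] that by simp
  qed
  have "eigenvalue (transpose_mat P) z" using z tr[OF P] by simp
  then obtain u where u: "u \<in> carrier_vec m" "u \<noteq> 0\<^sub>v m" "transpose_mat P *\<^sub>v u = z \<cdot>\<^sub>v u"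
    using P by (auto simp: eigenvalue_def eigenvector_def)
  let ?w = "transpose_mat R *\<^sub>v u"
  have "transpose_mat A *\<^sub>v ?w = transpose_mat (R * A) *\<^sub>v u"
    using A R u by (simp add: transpose_mult assoc_mult_mat_vec[of _ n n _ m])
  also have "\<dots> = transpose_mat R *\<^sub>v (transpose_mat P *\<^sub>v u)"
    unfolding RA using R P u by (simp add: transpose_mult assoc_mult_mat_vec[of _ n m _ m])
  also have "\<dots> = z \<cdot>\<^sub>v ?w" using u R by (simp add: mult_mat_vec[of _ n m])
  finally have e: "transpose_mat A *\<^sub>v ?w = z \<cdot>\<^sub>v ?w" .
  have "transpose_mat S *\<^sub>v ?w = transpose_mat (R * S) *\<^sub>v u"
    using S R u by (simp add: transpose_mult assoc_mult_mat_vec[of _ m n _ m])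
  also have "\<dots> = u" using u by (simp add: RS)
  finally have Sw: "transpose_mat S *\<^sub>v ?w = u" .
  have "?w \<noteq> 0\<^sub>v n"
  proof
    assume "?w = 0\<^sub>v n"
    then have "u = transpose_mat S *\<^sub>v 0\<^sub>v n" using Sw by simp
    also have "\<dots> = 0\<^sub>v m" using S by (intro eq_vecI) auto
    finally show False using u by simp
  qed
  then have "eigenvalue (transpose_mat A) z"
    unfolding eigenvalue_def eigenvector_def
    using e A R u mult_mat_vec_carrier[of "transpose_mat R" n m u]
    by (intro exI[of _ ?w]) simp
  then show ?thesis using tr[OF A] by simp
qed

text \<open>An eigenvalue of an integral matrix is an algebraic integer, hence an integer if it is
  rational. The inverse of \<open>z\<close> is an eigenvalue of \<open>B\<close>, so
  \<open>z\<close> is an integer with an integral inverse.\<close>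

lemma rational_eigenvalue_unimodular:
  fixes A B :: "int mat"
  assumes A: "A \<in> carrier_mat n n" and B: "B \<in> carrier_mat n n" and BA: "B * A = 1\<^sub>m n"
    and z: "eigenvalue (map_mat of_int A) (z :: complex)" and "z \<in> \<rat>"
  shows "cmod z = 1"
proof -
  have ai: "algebraic_int z" if "eigenvalue (map_mat of_int A) z" "A \<in> carrier_mat n n" for A and z :: complex
  proof -
    have "poly (char_poly (map_mat of_int A)) z = 0"
      using that eigenvalue_root_char_poly[of "map_mat of_int A" n z] by simp
    then have "poly (map_poly of_int (char_poly A)) z = 0"
      unfolding of_int_hom.char_poly_hom[OF that(2)] .
    then show ?thesis
      unfolding algebraic_int_altdef_ipoly using degree_monic_char_poly[OF that(2)]
      by (intro exI[of _ "char_poly A"]) auto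
  qed
  obtain v where v: "v \<in> carrier_vec n" "v \<noteq> 0\<^sub>v n" "map_mat of_int A *\<^sub>v v = z \<cdot>\<^sub>v v"
    using z A by (auto simp: eigenvalue_def eigenvector_def)
  have "map_mat of_int B * map_mat of_int A = (1\<^sub>m n :: complex mat)"
    using BA of_int_hom.mat_hom_mult[OF B A, where ?'a = complex] by (simp add: of_int_hom.mat_hom_one)
  then have "map_mat of_int B * map_mat of_int A *\<^sub>v v = v" using v(1) by simp
  moreover have "map_mat of_int B * map_mat of_int A *\<^sub>v v = map_mat of_int B *\<^sub>v (map_mat of_int A *\<^sub>v v)"
    by (rule assoc_mult_mat_vec[of _ n n]) (use A B v(1) in auto)
  moreover have "map_mat of_int B *\<^sub>v (z \<cdot>\<^sub>v v) = z \<cdot>\<^sub>v (map_mat of_int B *\<^sub>v v)"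
    by (rule mult_mat_vec[of _ n n]) (use B v(1) in auto)
  ultimately have zv: "z \<cdot>\<^sub>v (map_mat of_int B *\<^sub>v v) = v"
    unfolding v(3) by argo
  have z0: "z \<noteq> 0"
  proof
    assume "z = 0"
    then have "0 \<cdot>\<^sub>v (map_mat of_int B *\<^sub>v v) = v" using zv by simp
    moreover have "0 \<cdot>\<^sub>v (map_mat of_int B *\<^sub>v v) = 0\<^sub>v n" using B by (intro eq_vecI) auto
    ultimately show False using v(2) by simp
  qed
  have "map_mat of_int B *\<^sub>v v = inverse z \<cdot>\<^sub>v (z \<cdot>\<^sub>v (map_mat of_int B *\<^sub>v v))"
    using z0 by (simp add: smult_smult_assoc)
  also have "\<dots> = inverse z \<cdot>\<^sub>v v" unfolding zv ..
  finally have "map_mat of_int B *\<^sub>v v = inverse z \<cdot>\<^sub>v v" .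
  then have "eigenvalue (map_mat of_int B) (inverse z)"
    unfolding eigenvalue_def eigenvector_def using v(1,2) B by (intro exI[of _ v]) simp
  then have "inverse z \<in> \<int>"
    by (intro rational_algebraic_int_is_int ai[OF _ B]) (use assms(5) in auto)
  moreover have "z \<in> \<int>" by (intro rational_algebraic_int_is_int ai[OF z A] assms(5))
  moreover have "z * inverse z = 1" using z0 by simp
  ultimately show ?thesis by (intro cmod_Ints_unit)
qed

section \<open>Eigenvalues of 3 by 3 matrices\<close>

lemma char_poly_3:
  fixes P :: "complex mat"
  assumes P: "P \<in> carrier_mat 3 3"
  obtains a b c where "char_poly P = [:- (a * b * c), a * b + a * c + b * c, - (a + b + c), 1:]"
    "\<And>z. eigenvalue P z \<longleftrightarrow> z = a \<or> z = b \<or> z = c" "det P = a * b * c"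
proof -
  obtain as where as: "char_poly P = (\<Prod>a\<leftarrow>as. [:- a, 1:])" "length as = 3"
    using char_poly_factorized[OF P] by auto
  then obtain a b c where abc: "as = [a, b, c]" by (auto simp: numeral_3_eq_3 length_Suc_conv)
  have cp: "char_poly P = [:- a, 1:] * ([:- b, 1:] * [:- c, 1:])" using as abc by simp
  have "poly (char_poly P) z = (z - a) * ((z - b) * (z - c))" for z
    unfolding cp poly_mult by simp
  then have ev: "eigenvalue P z \<longleftrightarrow> z = a \<or> z = b \<or> z = c" for z
    unfolding eigenvalue_root_char_poly[OF P] by simp
  \<comment> \<open>The value of the characteristic polynomial at 0 is \<open>det (- P)\<close>,
    which accounts for the sign \<open>(-1)^3\<close>.\<close>
  have "- (char_matrix P 0) = (-1) \<cdot>\<^sub>m P" using P by (auto intro!: eq_matI simp: char_matrix_def)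
  then have "poly (char_poly P) 0 = (-1) ^ 3 * det P"
    using char_poly_matrix[OF P, of 0] P by simp
  moreover have "poly (char_poly P) 0 = - (a * b * c)" unfolding cp by simp
  ultimately have "det P = a * b * c" by simp
  moreover have "char_poly P = [:- (a * b * c), a * b + a * c + b * c, - (a + b + c), 1:]"
    unfolding cp by (simp add: algebra_simps)
  ultimately show ?thesis using that ev by blast
qed

lemma det_3_distinct_eigenvalues:
  fixes P :: "complex mat"
  assumes P: "P \<in> carrier_mat 3 3" and "eigenvalue P a" "eigenvalue P b" "eigenvalue P c"
    and "a \<noteq> b" "b \<noteq> c" "a \<noteq> c"
  shows "det P = a * b * c"
proof -
  obtain x y z where xyz: "\<And>t. eigenvalue P t \<longleftrightarrow> t = x \<or> t = y \<or> t = z" "det P = x * y * z"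
    by (rule char_poly_3[OF P]) (rule that)
  have "a = x \<or> a = y \<or> a = z" "b = x \<or> b = y \<or> b = z" "c = x \<or> c = y \<or> c = z"
    using assms(2-4) unfolding xyz(1) .
  then show ?thesis unfolding xyz(2) using assms(5-) by (elim disjE) (simp_all add: mult_ac)
qed

text \<open>A rational cubic with roots a, a, c shares the factor x - a with its derivative, so one
  step of the Euclidean algorithm exhibits a as the root of a linear rational polynomial. That
  remainder is the origin of the quotient \<open>(s t - 9 p) / (2 (s^2 - 3 t))\<close> in the
  elementary symmetric functions; its denominator is \<open>2 (a - c)^2\<close>. A triple root is a
  third of the trace.\<close>

lemma rational_double_root:
  fixes a c :: "'a::field_char_0"
  assumes e1: "a + a + c \<in> \<rat>" and e2: "a * a + a * c + a * c \<in> \<rat>" and e3: "a * a * c \<in> \<rat>"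
  shows "a \<in> \<rat>"
proof (cases "a = c")
  case True
  then have "a = (a + a + c) / 3" by simp
  also have "\<dots> \<in> \<rat>" by (rule Rats_divide[OF e1]) simp
  finally show ?thesis .
next
  case False
  let ?s = "a + a + c" and ?t = "a * a + a * c + a * c" and ?p = "a * a * c"
  have n: "?s * ?t - 9 * ?p = a * (2 * (?s * ?s - 3 * ?t))" by (simp add: algebra_simps)
  have "?s * ?s - 3 * ?t = (a - c) * (a - c)" by (simp add: algebra_simps)
  then have "2 * (?s * ?s - 3 * ?t) \<noteq> 0" using False by simp
  then have "a = (?s * ?t - 9 * ?p) / (2 * (?s * ?s - 3 * ?t))"
    unfolding n by (rule nonzero_mult_div_cancel_right[symmetric])
  also have "\<dots> \<in> \<rat>" by (intro Rats_divide Rats_diff Rats_mult e1 e2 e3 Rats_number_of)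
  finally show ?thesis .
qed

text \<open>The elementary symmetric functions of the eigenvalues are coefficients of a rational
  polynomial. A repeated eigenvalue would then be rational, and if two eigenvalues were opposite,
  the trace would equal the third one and make it rational.\<close>

lemma rational_mat_3_eigenvalues:
  fixes P :: "complex mat"
  assumes P: "P \<in> carrier_mat 3 3" and rat: "\<And>i j. i < 3 \<Longrightarrow> j < 3 \<Longrightarrow> P $$ (i, j) \<in> \<rat>"
    and nr: "\<And>z. eigenvalue P z \<Longrightarrow> z \<notin> \<rat>"
  obtains a b c where "eigenvalue P a" "eigenvalue P b" "eigenvalue P c" "det P = a * b * c"
    "a \<noteq> b" "b \<noteq> c" "a \<noteq> c" "a \<noteq> - b" "b \<noteq> - c" "a \<noteq> - c"
proof -
  obtain a b c where abc: "char_poly P = [:- (a * b * c), a * b + a * c + b * c, - (a + b + c), 1:]"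
    "\<And>z. eigenvalue P z \<longleftrightarrow> z = a \<or> z = b \<or> z = c" "det P = a * b * c"
    by (rule char_poly_3[OF P]) (rule that)
  define P0 where "P0 = mat 3 3 (\<lambda>ij. SOME q. P $$ ij = of_rat q)"
  have "P = map_mat of_rat P0"
  proof (rule eq_matI)
    fix i j assume "i < dim_row (map_mat of_rat P0 :: complex mat)" "j < dim_col (map_mat of_rat P0 :: complex mat)"
    then have ij: "i < 3" "j < 3" by (simp_all add: P0_def)
    then have "\<exists>q. P $$ (i, j) = of_rat q" using rat[OF ij] by (auto simp: Rats_def)
    then have "P $$ (i, j) = of_rat (SOME q. P $$ (i, j) = of_rat q)" by (rule someI_ex)
    then show "P $$ (i, j) = map_mat of_rat P0 $$ (i, j)" using ij by (simp add: P0_def)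
  qed (use P in \<open>auto simp: P0_def\<close>)
  moreover have "P0 \<in> carrier_mat 3 3" by (simp add: P0_def)
  ultimately have "char_poly P = map_poly of_rat (char_poly P0)"
    using of_rat_hom.char_poly_hom[of P0 3] by simp
  then have cf: "coeff (char_poly P) k \<in> \<rat>" for k by (simp add: coeff_map_poly)
  have e3: "a * b * c \<in> \<rat>" using cf[of 0] unfolding abc(1) by simp
  have e2: "a * b + a * c + b * c \<in> \<rat>" using cf[of 1] unfolding abc(1) by simp
  have "coeff (char_poly P) 2 = - (a + b + c)" unfolding abc(1) by (simp add: numeral_2_eq_2)
  then have e1: "a + b + c \<in> \<rat>" using cf[of 2] by (simp only: Rats_minus_iff)
  have nQ: "a \<notin> \<rat>" "b \<notin> \<rat>" "c \<notin> \<rat>" using nr abc(2) by auto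
  have "a \<noteq> b" using rational_double_root[of a c] e1 e2 e3 nQ by (auto simp: algebra_simps)
  moreover have "a \<noteq> c" using rational_double_root[of a b] e1 e2 e3 nQ by (auto simp: algebra_simps)
  moreover have "b \<noteq> c" using rational_double_root[of b a] e1 e2 e3 nQ by (auto simp: algebra_simps)
  moreover have "a \<noteq> - b" "b \<noteq> - c" "a \<noteq> - c" using e1 nQ by auto
  ultimately show ?thesis using that abc by blast
qed

section \<open>Independence modulo a subspace\<close>

text \<open>A locale of its own: \<open>vector_space\<close> is globally interpreted by \<open>scaleR\<close> with an optional
  qualifier, so that names introduced there would be ambiguous.\<close>

locale vec_space_mod = vector_space
begin

text \<open>Families rather than sets, so that no injectivity has to be tracked.\<close>

definition indep_mod :: "'b set \<Rightarrow> 'i set \<Rightarrow> ('i \<Rightarrow> 'b) \<Rightarrow> bool" where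
  "indep_mod W I f \<longleftrightarrow> (\<forall>c. (\<Sum>i\<in>I. scale (c i) (f i)) \<in> W \<longrightarrow> (\<forall>i\<in>I. c i = 0))"

lemma indep_modD:
  fixes f :: "'i \<Rightarrow> 'b" and c :: "'i \<Rightarrow> 'a"
  shows "indep_mod W I f \<Longrightarrow> (\<Sum>i\<in>I. scale (c i) (f i)) \<in> W \<Longrightarrow> i \<in> I \<Longrightarrow> c i = 0"
  unfolding indep_mod_def by blast

lemma indep_mod_inj_on:
  fixes f :: "'i \<Rightarrow> 'b"
  assumes W: "subspace W" and ind: "indep_mod W I f" and "finite I"
  shows "inj_on f I"
proof
  fix i j assume ij: "i \<in> I" "j \<in> I" "f i = f j"
  show "i = j"
  proof (rule ccontr)
    assume ne: "i \<noteq> j"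
    let ?c = "\<lambda>k. if k = i then 1 else if k = j then -1 else 0 :: 'a"
    have "(\<Sum>k\<in>I. scale (?c k) (f k)) = (\<Sum>k\<in>{i, j}. scale (?c k) (f k))"
      using assms(3) ij by (intro sum.mono_neutral_right) auto
    also have "\<dots> = 0" using ne ij by simp
    finally have "(\<Sum>k\<in>I. scale (?c k) (f k)) \<in> W" using subspace_0[OF W] by simp
    then have "?c i = 0" using ij(1) by (rule indep_modD[where c = ?c, OF ind])
    then show False by simp
  qed
qed

lemma indep_mod_not_in:
  fixes f :: "'i \<Rightarrow> 'b"
  assumes ind: "indep_mod W I f" and "finite I" "i \<in> I"
  shows "f i \<notin> W"
proof
  assume W: "f i \<in> W"
  let ?c = "\<lambda>k. if k = i then 1 else 0 :: 'a"
  have "(\<Sum>k\<in>I. scale (?c k) (f k)) = (\<Sum>k\<in>I. if k = i then f k else 0)"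
    by (intro sum.cong) auto
  then have "(\<Sum>k\<in>I. scale (?c k) (f k)) \<in> W" using W assms by simp
  then have "?c i = 0" using assms(3) by (rule indep_modD[where c = ?c, OF ind])
  then show False by simp
qed

lemma indep_mod_union_basis:
  fixes f :: "'i \<Rightarrow> 'b"
  assumes W: "subspace W" and I: "finite I" and ind: "indep_mod W I f"
    and D: "independent D" "span D = W" "finite D"
  shows "independent (f ` I \<union> D)" "f ` I \<inter> D = {}" "card (f ` I \<union> D) = card I + card D"
proof -
  have inj: "inj_on f I" by (rule indep_mod_inj_on[OF W ind I])
  show disj: "f ` I \<inter> D = {}"
    using indep_mod_not_in[OF ind I] D(2) span_superset[of D] by blast
  show "card (f ` I \<union> D) = card I + card D"
    using card_Un_disjoint[OF _ D(3) disj] I card_image[OF inj] by simp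
  show "independent (f ` I \<union> D)"
  proof (rule independent_if_scalars_zero)
    show "finite (f ` I \<union> D)" using I D by simp
    fix g x assume s: "(\<Sum>x\<in>f ` I \<union> D. scale (g x) x) = 0" and x: "x \<in> f ` I \<union> D"
    have fI: "(\<Sum>x\<in>f ` I. scale (g x) x) = (\<Sum>i\<in>I. scale (g (f i)) (f i))"
      by (simp add: sum.reindex[OF inj])
    have split: "(\<Sum>i\<in>I. scale (g (f i)) (f i)) + (\<Sum>x\<in>D. scale (g x) x) = 0"
      using s sum.union_disjoint[OF _ D(3) disj, of "\<lambda>x. scale (g x) x"] I by (simp add: fI)
    have "(\<Sum>x\<in>D. scale (g x) x) \<in> W"
      unfolding D(2)[symmetric] by (intro span_sum span_scale span_base)
    then have "(\<Sum>i\<in>I. scale (g (f i)) (f i)) \<in> W"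
      using split subspace_neg[OF W] by (metis add_eq_0_iff minus_minus)
    then have z: "g (f i) = 0" if "i \<in> I" for i
      using indep_modD[OF ind, of "\<lambda>i. g (f i)"] that by simp
    then have "(\<Sum>x\<in>D. scale (g x) x) = 0" using split by simp
    then have "g y = 0" if "y \<in> D" for y using independentD[OF D(1) D(3) subset_refl] that by blast
    then show "g x = 0" using x z by auto
  qed
qed

text \<open>Applying \<open>T - m k\<close> to a relation modulo \<open>W\<close> removes the term
  of \<open>k\<close> and multiplies each other coefficient by the nonzero \<open>m i - m k\<close>,
  so the induction hypothesis applies. It serves for generators modulo the derived algebra and, with
  \<open>W = {0}\<close>, for triple brackets.\<close>

lemma indep_mod_eigenvectors:
  fixes f :: "'i \<Rightarrow> 'b"
  assumes W: "subspace W" and T: "Vector_Spaces.linear scale scale T" and inv: "\<And>w. w \<in> W \<Longrightarrow> T w \<in> W"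
    and ev: "\<And>i. i \<in> I \<Longrightarrow> T (f i) - scale (m i) (f i) \<in> W"
    and nz: "\<And>i. i \<in> I \<Longrightarrow> f i \<notin> W" and inj: "inj_on m I" and "finite I"
  shows "indep_mod W I f"
  using \<open>finite I\<close> ev nz inj
proof (induction I rule: finite_induct)
  case empty
  then show ?case by (simp add: indep_mod_def)
next
  case (insert k I)
  interpret T: Vector_Spaces.linear scale scale T by (rule T)
  have IH: "indep_mod W I f" using insert.IH insert.prems by (auto simp: inj_on_def)
  show ?case
    unfolding indep_mod_def
  proof (intro allI impI)
    fix c assume c: "(\<Sum>i\<in>insert k I. scale (c i) (f i)) \<in> W"
    let ?v = "\<Sum>i\<in>insert k I. scale (c i) (f i)"
    have "T ?v - scale (m k) ?v = (\<Sum>i\<in>insert k I. scale (c i) (T (f i) - scale (m k) (f i)))"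
      by (simp only: T.sum T.scale scale_sum_right scale_right_diff_distrib sum_subtractf
          scale_scale mult.commute)
    also have "\<dots> = (\<Sum>i\<in>insert k I. scale (c i) (T (f i) - scale (m i) (f i)))
        + (\<Sum>i\<in>insert k I. scale (c i * (m i - m k)) (f i))"
      by (simp only: sum.distrib[symmetric])
        (intro sum.cong refl, simp add: scale_right_diff_distrib scale_left_diff_distrib right_diff_distrib)
    finally have eq: "T ?v - scale (m k) ?v = (\<Sum>i\<in>insert k I. scale (c i) (T (f i) - scale (m i) (f i)))
        + (\<Sum>i\<in>insert k I. scale (c i * (m i - m k)) (f i))" .
    have "T ?v - scale (m k) ?v \<in> W"
      using inv[OF c] c by (intro subspace_diff[OF W] subspace_scale[OF W])
    moreover have "(\<Sum>i\<in>insert k I. scale (c i) (T (f i) - scale (m i) (f i))) \<in> W"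
      using insert.prems(1) by (intro subspace_sum[OF W] subspace_scale[OF W])
    ultimately have "(\<Sum>i\<in>insert k I. scale (c i * (m i - m k)) (f i)) \<in> W"
      using subspace_diff[OF W, of "T ?v - scale (m k) ?v"] unfolding eq by fastforce
    then have "(\<Sum>i\<in>I. scale (c i * (m i - m k)) (f i)) \<in> W" using insert.hyps by simp
    then have "c i * (m i - m k) = 0" if "i \<in> I" for i by (rule indep_modD[OF IH _ that])
    then have cI: "c i = 0" if "i \<in> I" for i
      using that insert.prems(3) insert.hyps by (auto simp: inj_on_def)
    then have "scale (c k) (f k) \<in> W" using c insert.hyps by simp
    then have "c k = 0" using insert.prems(2)[of k] subspace_scale[OF W, of "scale (c k) (f k)" "inverse (c k)"]
      by (cases "c k = 0") auto
    then show "\<forall>i\<in>insert k I. c i = 0" using cI by simp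
  qed
qed

end

locale fd_vec_space_mod = finite_dimensional_vector_space + vec_space_mod
begin

lemma dim_span_indep_mod:
  fixes f :: "'i \<Rightarrow> 'b"
  assumes W: "subspace W" and I: "finite I" and ind: "indep_mod W I f"
  shows "dim (f ` I \<union> W) = card I + dim W"
proof -
  obtain D where D: "D \<subseteq> W" "independent D" "W \<subseteq> span D" "card D = dim W" using basis_exists by blast
  have sD: "span D = W" using D(1,3) span_minimal[OF D(1) W] by blast
  have fD: "finite D" using D(2) finiteI_independent by blast
  note u = indep_mod_union_basis[OF W I ind D(2) sD fD]
  have "span (f ` I \<union> W) = span (f ` I \<union> D)"
    unfolding sD[symmetric] by (simp only: span_Un span_span)
  then have "dim (f ` I \<union> W) = dim (f ` I \<union> D)" by (rule span_eq_dim)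
  then show ?thesis using u dim_eq_card_independent D(4) by metis
qed

end

section \<open>Bracket identities and the lower central series\<close>

sublocale lie_algebra \<subseteq> vec_space_mod ..

context lie_algebra
begin

lemma bracket_add_left: "bracket (x + y) z = bracket x z + bracket y z"
  and bracket_scale_left: "bracket (scale c x) z = scale c (bracket x z)"
  using bracket_linear_left[of z] unfolding Vector_Spaces.linear_iff by simp_all

lemma bracket_add_right: "bracket z (x + y) = bracket z x + bracket z y"
  and bracket_scale_right: "bracket z (scale c x) = scale c (bracket z x)"
  using bracket_linear_right[of z] unfolding Vector_Spaces.linear_iff by simp_all

lemma bracket_0_left [simp]: "bracket 0 z = 0" using bracket_scale_left[of 0 0 z] by simp
lemma bracket_0_right [simp]: "bracket z 0 = 0" using bracket_scale_right[of z 0 0] by simp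

lemma bracket_skew: "bracket y x = - bracket x y"
proof -
  have "bracket (x + y) (x + y) = bracket x y + bracket y x"
    unfolding bracket_add_left bracket_add_right by (simp add: bracket_alternating add.commute)
  then show ?thesis by (simp add: bracket_alternating add_eq_0_iff)
qed

lemma bracket_in_span:
  assumes "\<And>x y. x \<in> S \<Longrightarrow> y \<in> S' \<Longrightarrow> bracket x y \<in> span M" "x \<in> span S" "y \<in> span S'"
  shows "bracket x y \<in> span M"
  using assms(2)
proof (induction x rule: span_induct_alt)
  case (step c x z)
  have "bracket x y \<in> span M"
    using assms(3)
    by (induction y rule: span_induct_alt)
      (auto simp: bracket_add_right bracket_scale_right span_zero intro!: span_add span_scale assms(1) step.hyps)
  then show ?case using step by (auto simp: bracket_add_left bracket_scale_left intro!: span_add span_scale)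
qed (simp add: span_zero)

lemma subspace_lower_central: "subspace (lower_central i)"
  by (cases i) auto

lemma bracket_in_lower_central: "y \<in> lower_central i \<Longrightarrow> bracket x y \<in> lower_central (Suc i)"
  by (auto intro: span_base)

lemma lower_central_Suc_subset: "lower_central (Suc i) \<subseteq> lower_central i"
proof (induction i)
  case (Suc i)
  show ?case unfolding lower_central.simps(2)[of "Suc i"]
    using Suc subspace_lower_central[of "Suc i"]
    by (intro span_minimal) (auto simp del: lower_central.simps(2) intro!: bracket_in_lower_central)
qed simp

lemma quotient_has_dim_iff:
  "quotient_has_dim V W n \<longleftrightarrow> (\<exists>B\<subseteq>V. finite B \<and> card B = n \<and> indep_mod W B (\<lambda>b. b)
     \<and> (\<forall>v\<in>V. \<exists>c. v - (\<Sum>b\<in>B. scale (c b) b) \<in> W))"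
  unfolding quotient_has_dim_def indep_mod_def by blast

lemma quotient_has_dim_basis:
  assumes q: "quotient_has_dim V W n" and V: "subspace V" and W: "subspace W" "W \<subseteq> V"
    and D: "independent D" "span D = W" "finite D"
  obtains B where "independent (B \<union> D)" "finite B" "card (B \<union> D) = n + card D" "span (B \<union> D) = V"
proof -
  obtain B where B: "B \<subseteq> V" "finite B" "card B = n" "indep_mod W B (\<lambda>b. b)"
    "\<And>v. v \<in> V \<Longrightarrow> \<exists>c. v - (\<Sum>b\<in>B. scale (c b) b) \<in> W"
    using q unfolding quotient_has_dim_iff by blast
  note u = indep_mod_union_basis[OF W(1) B(2,4) D, unfolded image_ident]
  have "D \<subseteq> V" using D(2) W(2) span_superset by blast
  then have "span (B \<union> D) \<subseteq> V" using B(1) by (intro span_minimal V) auto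
  moreover have "V \<subseteq> span (B \<union> D)"
  proof
    fix v assume "v \<in> V"
    then obtain c where c: "v - (\<Sum>b\<in>B. scale (c b) b) \<in> W" using B(5) by blast
    have "v - (\<Sum>b\<in>B. scale (c b) b) \<in> span (B \<union> D)" using c D(2) span_mono[of D "B \<union> D"] by blast
    moreover have "(\<Sum>b\<in>B. scale (c b) b) \<in> span (B \<union> D)"
      by (intro span_sum span_scale span_base) simp
    ultimately have "(v - (\<Sum>b\<in>B. scale (c b) b)) + (\<Sum>b\<in>B. scale (c b) b) \<in> span (B \<union> D)"
      by (rule span_add)
    then show "v \<in> span (B \<union> D)" by simp
  qed
  ultimately show ?thesis using that u B(2,3) by auto
qed

text \<open>Finite dimension is not assumed of a Lie algebra but follows from the type: bases of the
  three quotients are lifted upwards from \<open>{0}\<close> and give bases with 3, 6 and 9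
  elements.\<close>

lemma has_type_333_basis:
  assumes "has_type [3, 3, 3]"
  obtains B where "finite_dimensional_vector_space scale B" "dim UNIV = 9"
    "dim (lower_central 1) = 6" "dim (lower_central 2) = 3" "lower_central 3 = {0}"
proof -
  note [simp del] = lower_central.simps and [simp] = eval_nat_numeral
  have L3: "lower_central 3 = {0}" using assms unfolding has_type_def by simp
  have q: "quotient_has_dim (lower_central i) (lower_central (Suc i)) ([3, 3, 3] ! i)" if "i < 3" for i
    using assms that unfolding has_type_def by simp
  have q': "quotient_has_dim (lower_central 0) (lower_central 1) 3"
    "quotient_has_dim (lower_central 1) (lower_central 2) 3"
    "quotient_has_dim (lower_central 2) (lower_central 3) 3"
    using q[of 0] q[of 1] q[of 2] by simp_all
  have sub1: "lower_central 1 \<subseteq> lower_central 0" "lower_central 2 \<subseteq> lower_central 1"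
    "{0} \<subseteq> lower_central 2"
    using lower_central_Suc_subset[of 0] lower_central_Suc_subset[of 1] lower_central_Suc_subset[of 2] L3
    by simp_all
  note sub = subspace_lower_central
  have q3: "quotient_has_dim (lower_central 2) {0} 3" using q'(3) L3 by simp
  obtain X where "independent (X \<union> {})" "finite X" "card (X \<union> {}) = 3 + card ({} :: 'b set)"
    "span (X \<union> {}) = lower_central 2"
    by (rule quotient_has_dim_basis[OF q3 sub _ sub1(3), of "{}"])
      (simp_all add: independent_empty subspace_single_0)
  then obtain B2 where B2: "independent B2" "finite B2" "card B2 = 3" "span B2 = lower_central 2"
    using that by simp
  obtain Y where "independent (Y \<union> B2)" "finite Y" "card (Y \<union> B2) = 3 + card B2"
    "span (Y \<union> B2) = lower_central 1"
    by (rule quotient_has_dim_basis[OF q'(2) sub sub sub1(2) B2(1,4,2)])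
  then obtain B1 where B1: "independent B1" "finite B1" "card B1 = 6" "span B1 = lower_central 1"
    using that[of "Y \<union> B2"] B2(2,3) by simp
  obtain Z where "independent (Z \<union> B1)" "finite Z" "card (Z \<union> B1) = 3 + card B1"
    "span (Z \<union> B1) = lower_central 0"
    by (rule quotient_has_dim_basis[OF q'(1) sub sub sub1(1) B1(1,4,2)])
  then obtain B0 where B0: "independent B0" "finite B0" "card B0 = 9" "span B0 = UNIV"
    using that[of "Z \<union> B1"] B1(2,3) lower_central.simps(1) by simp
  have "finite_dimensional_vector_space scale B0"
    by unfold_locales (use B0 in auto)
  moreover have "dim UNIV = 9" using dim_span_eq_card_independent[OF B0(1)] B0(3,4) by simp
  moreover have "dim (lower_central 1) = 6" using dim_span_eq_card_independent[OF B1(1)] B1(3,4) by simp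
  moreover have "dim (lower_central 2) = 3" using dim_span_eq_card_independent[OF B2(1)] B2(3,4) by simp
  ultimately show ?thesis using that L3 by blast
qed

end

section \<open>Rational forms with a unimodular hyperbolic automorphism\<close>

lemma sum_set_nth:
  "distinct xs \<Longrightarrow> (\<Sum>x\<in>set xs. f x) = (\<Sum>i<length xs. f (xs ! i))"
  using sum.reindex_bij_betw[OF bij_betw_nth[of xs "{..<length xs}" "set xs"], of f] by simp

lemma (in char_0_lie_algebra) rational_span_subset: "rational.span S \<subseteq> span S"
proof
  fix x assume "x \<in> rational.span S"
  then show "x \<in> span S"
    by (induction rule: rational.span_induct_alt)
      (auto simp: rational_scale_def intro!: span_add span_scale span_zero intro: span_base)
qed

locale fd_rational_form = char_0_lie_algebra scale bracket + fd_vec_space_mod scale Basis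
  for scale :: "complex \<Rightarrow> 'v::ab_group_add \<Rightarrow> 'v" and bracket :: "'v \<Rightarrow> 'v \<Rightarrow> 'v" and Basis +
  fixes F :: "'v set"
  assumes form: "rational_form F"
begin

lemma subspace_F: "rational.subspace F" and bracket_F: "x \<in> F \<Longrightarrow> y \<in> F \<Longrightarrow> bracket x y \<in> F"
  using form unfolding rational_form_def rational.subalgebra_def by auto

text \<open>The definition of a rational form provides one basis \<open>B\<close> that works over
  both fields. Any other \<open>G\<close> extends to a rational basis \<open>G'\<close> of
  \<open>F\<close>, which has at most \<open>card B\<close> elements and still spans over the
  complex numbers; a spanning set of that size is independent.\<close>

lemma independent_if_rational:
  assumes G: "G \<subseteq> F" "rational.independent G"
  shows "independent G"
proof -
  obtain B where B: "rational.independent B" "rational.span B = F" "independent B" "span B = UNIV"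
    using form unfolding rational_form_def rational.basis_of_def basis_of_def by blast
  have fB: "finite B" using B(3) by (rule finiteI_independent)
  obtain G' where G': "G \<subseteq> G'" "G' \<subseteq> F" "rational.independent G'" "F \<subseteq> rational.span G'"
    by (rule rational.maximal_independent_subset_extend[OF G])
  have fG': "finite G' \<and> card G' \<le> card B"
    using rational.independent_span_bound[OF fB G'(3)] G'(2) B(2) by simp
  have "B \<subseteq> F" using B(2) rational.span_superset by blast
  then have "B \<subseteq> span G'" using G'(4) rational_span_subset by blast
  then have "span B \<subseteq> span G'" by (rule span_minimal) (rule subspace_span)
  then have "UNIV \<subseteq> span G'" using B(4) by simp
  moreover have "card B = dim UNIV" using dim_span_eq_card_independent[OF B(3)] B(4) by simp
  ultimately have "independent G'"
    using fG' by (intro card_le_dim_spanning[of G' UNIV]) auto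
  then show ?thesis using G'(1) independent_mono by blast
qed

lemma span_UNIV_if_rational:
  assumes "F \<subseteq> rational.span G"
  shows "span G = UNIV"
proof -
  obtain B where B: "rational.span B = F" "span B = UNIV"
    using form unfolding rational_form_def rational.basis_of_def basis_of_def by blast
  have "B \<subseteq> span G" using B(1) assms rational.span_superset rational_span_subset by blast
  then have "span B \<subseteq> span G" by (rule span_minimal) (rule subspace_span)
  then show ?thesis using B(2) by auto
qed

text \<open>Complex coordinates are unique, and the rational ones already represent
  \<open>v\<close>. The rationality of the matrices attached to subquotients rests on this.\<close>

lemma representation_of_rat:
  assumes "G \<subseteq> F" "rational.independent G" "v \<in> rational.span G"
  shows "representation G v g = of_rat (rational.representation G v g)"
proof -
  let ?r = "\<lambda>g. of_rat (rational.representation G v g) :: complex"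
  have ind: "independent G" by (rule independent_if_rational[OF assms(1,2)])
  have fG: "finite G" using ind by (rule finiteI_independent)
  have nz: "?r b \<noteq> 0 \<Longrightarrow> b \<in> G" for b using rational.representation_ne_zero[of G v b] by auto
  have "(\<Sum>b | ?r b \<noteq> 0. scale (?r b) b) = (\<Sum>b\<in>G. scale (?r b) b)"
    by (rule sum.mono_neutral_left[OF fG]) (use nz in auto)
  also have "\<dots> = v"
    using rational.sum_representation_eq[OF assms(2,3) fG subset_refl] by (simp add: rational_scale_def)
  finally have "representation G v = ?r"
    by (intro representation_eqI ind nz) (use assms(3) rational_span_subset finite_subset[OF _ fG] nz in \<open>auto simp: subset_iff\<close>)
  then show ?thesis by simp
qed

end

locale anosov_form = fd_rational_form scale bracket Basis F
  for scale :: "complex \<Rightarrow> 'v::ab_group_add \<Rightarrow> 'v" and bracket :: "'v \<Rightarrow> 'v \<Rightarrow> 'v" and Basis F +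
  fixes \<tau> :: "'v \<Rightarrow> 'v" and \<beta> :: "'v list" and A :: "int mat"
  assumes aut: "rational.automorphism_on F \<tau>"
    and hyp: "rational.hyperbolic_on F \<tau>" and basis: "rational.ordered_basis_of F \<beta>"
    and inv: "invertible_mat A" and mat: "rational.matrix_wrt \<beta> \<tau> = map_mat of_int A"
begin

lemma distinct_\<beta>: "distinct \<beta>" and rational_independent_\<beta>: "rational.independent (set \<beta>)"
  and rational_span_\<beta>: "rational.span (set \<beta>) = F"
  using basis unfolding rational.ordered_basis_of_def rational.basis_of_def by auto

lemma \<beta>_subset: "set \<beta> \<subseteq> F" using rational_span_\<beta> rational.span_superset by blast

lemma independent_\<beta>: "independent (set \<beta>)"
  by (rule independent_if_rational[OF \<beta>_subset rational_independent_\<beta>])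

lemma span_\<beta>: "span (set \<beta>) = UNIV"
  by (rule span_UNIV_if_rational) (simp add: rational_span_\<beta>)

abbreviation "n \<equiv> length \<beta>"
abbreviation "coord v i \<equiv> representation (set \<beta>) v (\<beta> ! i)"
abbreviation "AC \<equiv> map_mat of_int A :: complex mat"

lemma A_carrier: "A \<in> carrier_mat n n"
proof -
  have "rational.matrix_wrt \<beta> \<tau> \<in> carrier_mat n n" unfolding rational.matrix_wrt_def by (rule mat_carrier)
  then show ?thesis unfolding mat by (simp only: map_carrier_mat)
qed

lemma A_inverse:
  obtains B where "B \<in> carrier_mat n n" "A * B = 1\<^sub>m n" "B * A = 1\<^sub>m n"
proof -
  obtain B where B: "A * B = 1\<^sub>m n" "B * A = 1\<^sub>m (dim_row B)"
    using inv A_carrier unfolding invertible_mat_def inverts_mat_def by auto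
  have "dim_col B = n" using arg_cong[OF B(1), of dim_col] by simp
  moreover have "dim_row B = n" using arg_cong[OF B(2), of dim_col] A_carrier by simp
  ultimately show ?thesis using B that[of B] by auto
qed

lemma coord_add: "coord (u + v) i = coord u i + coord v i"
  and coord_scale: "coord (scale c v) i = c * coord v i"
  by (simp_all add: representation_add representation_scale independent_\<beta> span_\<beta>)

lemma sum_coord: "(\<Sum>i<n. scale (coord v i) (\<beta> ! i)) = v"
  using sum_representation_eq[OF independent_\<beta>, of v "set \<beta>"] span_\<beta>
  by (simp add: sum_set_nth[OF distinct_\<beta>])

lemma coord_rational: "v \<in> F \<Longrightarrow> coord v i \<in> \<rat>"
  using representation_of_rat[OF \<beta>_subset rational_independent_\<beta>] rational_span_\<beta> by auto

text \<open>The automorphism \<tau> is controlled on \<open>F\<close> only, so it is replaced by the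
  complex linear map that agrees with it on the basis.\<close>

definition T :: "'v \<Rightarrow> 'v" where "T v = (\<Sum>i<n. scale (coord v i) (\<tau> (\<beta> ! i)))"

lemma T_add: "T (u + v) = T u + T v"
  by (simp add: T_def coord_add scale_left_distrib sum.distrib)

lemma T_scale: "T (scale c v) = scale c (T v)"
  by (simp add: T_def coord_scale scale_sum_right)

lemma T_linear: "Vector_Spaces.linear scale scale T"
  unfolding Vector_Spaces.linear_iff using vector_space_axioms T_add T_scale by blast

lemma T_F: assumes "v \<in> F" shows "T v = \<tau> v" "T v \<in> F"
proof -
  have \<tau>_F: "\<tau> x \<in> F" if "x \<in> F" for x
    using aut that unfolding rational.automorphism_on_def by (auto dest: bij_betwE)
  have T_\<beta>: "T b = \<tau> b" if "b \<in> set \<beta>" for b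
  proof -
    have "T b = (\<Sum>x\<in>set \<beta>. scale (representation (set \<beta>) b x) (\<tau> x))"
      unfolding T_def by (simp add: sum_set_nth[OF distinct_\<beta>])
    also have "\<dots> = (\<Sum>x\<in>set \<beta>. if x = b then \<tau> x else 0)"
      by (intro sum.cong) (auto simp: representation_basis[OF independent_\<beta> that])
    also have "\<dots> = \<tau> b" using that by simp
    finally show ?thesis .
  qed
  have \<tau>_add: "\<tau> (x + y) = \<tau> x + \<tau> y" and \<tau>_scale: "\<tau> (rational_scale c x) = rational_scale c (\<tau> x)"
    if "x \<in> F" "y \<in> F" for x y c
    using aut that unfolding rational.automorphism_on_def by auto
  have "v \<in> F \<and> T v = \<tau> v"
    using assms unfolding rational_span_\<beta>[symmetric]
  proof (induction rule: rational.span_induct_alt)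
    case base
    have "\<tau> 0 = 0" using \<tau>_scale[of 0 0 0] rational.subspace_0[OF subspace_F] by simp
    moreover have "T 0 = 0" using T_scale[of 0 0] by simp
    ultimately show ?case by (simp add: rational.span_zero)
  next
    case (step c x y)
    have x: "x \<in> F" using step \<beta>_subset by auto
    have y: "y \<in> F" using step rational_span_\<beta> by simp
    have cx: "rational_scale c x \<in> F" using rational.subspace_scale[OF subspace_F x] .
    have "T (rational_scale c x + y) = rational_scale c (\<tau> x) + \<tau> y"
      using step T_\<beta>[of x] by (simp add: T_add rational_scale_def T_scale)
    also have "\<dots> = \<tau> (rational_scale c x + y)"
      using \<tau>_add[OF cx y] \<tau>_scale[OF x x] by simp
    finally show ?case
      using rational.subspace_add[OF subspace_F cx y] rational_span_\<beta> by simp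
  qed
  then show "T v = \<tau> v" "T v \<in> F" using \<tau>_F[OF assms] by auto
qed

lemma T_bracket: "T (bracket x y) = bracket (T x) (T y)"
proof -
  have T0: "T 0 = 0" using T_scale[of 0 0] by simp
  have bb: "T (bracket x y) = bracket (T x) (T y)" if "x \<in> set \<beta>" "y \<in> set \<beta>" for x y
  proof -
    have xy: "x \<in> F" "y \<in> F" using that \<beta>_subset by auto
    show ?thesis
      using T_F(1)[OF bracket_F[OF xy]] T_F(1)[OF xy(1)] T_F(1)[OF xy(2)] aut xy
      unfolding rational.automorphism_on_def by auto
  qed
  have b1: "T (bracket x y) = bracket (T x) (T y)" if "x \<in> set \<beta>" for x y
  proof -
    have "y \<in> span (set \<beta>)" using span_\<beta> by simp
    then show ?thesis
    proof (induction y rule: span_induct_alt)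
      case (step c u v)
      then show ?case using bb[OF that, of u]
        by (simp add: bracket_add_right bracket_scale_right T_add T_scale)
    qed (simp add: T0)
  qed
  have "x \<in> span (set \<beta>)" using span_\<beta> by simp
  then show ?thesis
  proof (induction x rule: span_induct_alt)
    case (step c u v)
    then show ?case using b1[of u y]
      by (simp add: bracket_add_left bracket_scale_left T_add T_scale)
  qed (simp add: T0)
qed

lemma coord_T_\<beta>:
  assumes "i < n" "j < n"
  shows "coord (T (\<beta> ! j)) i = AC $$ (i, j)"
proof -
  have b: "\<beta> ! j \<in> F" using assms \<beta>_subset by auto
  have "coord (T (\<beta> ! j)) i = of_rat (rational.representation (set \<beta>) (\<tau> (\<beta> ! j)) (\<beta> ! i))"
    using representation_of_rat[OF \<beta>_subset rational_independent_\<beta>] T_F[OF b] rational_span_\<beta> by simp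
  also have "rational.representation (set \<beta>) (\<tau> (\<beta> ! j)) (\<beta> ! i) = rational.matrix_wrt \<beta> \<tau> $$ (i, j)"
    using assms by (simp add: rational.matrix_wrt_def)
  finally show ?thesis using assms A_carrier unfolding mat by simp
qed

lemma linear_functional_expand:
  fixes \<phi> :: "'v \<Rightarrow> complex"
  assumes add: "\<And>u v. \<phi> (u + v) = \<phi> u + \<phi> v" and sc: "\<And>c v. \<phi> (scale c v) = c * \<phi> v"
  shows "\<phi> (\<Sum>i\<in>I. scale (c i) (f i)) = (\<Sum>i\<in>I. c i * \<phi> (f i))"
proof (induction I rule: infinite_finite_induct)
  have "\<phi> 0 = 0" using sc[of 0 0] by simp
  then show "\<phi> (\<Sum>i\<in>{}. scale (c i) (f i)) = (\<Sum>i\<in>{}. c i * \<phi> (f i))" by simp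
  then show "\<phi> (\<Sum>i\<in>I. scale (c i) (f i)) = (\<Sum>i\<in>I. c i * \<phi> (f i))" if "infinite I" for I using that by simp
qed (simp add: add sc)

lemma T_sum: "T (\<Sum>i\<in>I. scale (c i) (f i)) = (\<Sum>i\<in>I. scale (c i) (T (f i)))"
proof -
  interpret T: Vector_Spaces.linear scale scale T by (rule T_linear)
  show ?thesis by (simp add: T.sum T.scale)
qed

lemma coord_T: assumes "i < n" shows "coord (T v) i = (\<Sum>k<n. AC $$ (i, k) * coord v k)"
proof -
  have "coord (T v) i = coord (T (\<Sum>k<n. scale (coord v k) (\<beta> ! k))) i" by (simp only: sum_coord)
  also have "\<dots> = (\<Sum>k<n. coord v k * coord (T (\<beta> ! k)) i)"
    unfolding T_sum by (rule linear_functional_expand) (rule coord_add coord_scale)+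
  also have "\<dots> = (\<Sum>k<n. AC $$ (i, k) * coord v k)"
    by (intro sum.cong) (auto simp: coord_T_\<beta> assms)
  finally show ?thesis .
qed

lemma eigenvalue_A_not_unit: "eigenvalue AC z \<Longrightarrow> cmod z \<noteq> 1"
proof
  assume z: "eigenvalue AC z" "cmod z = 1"
  have "map_mat of_rat (map_mat rat_of_int A) = AC" by (auto intro!: eq_matI)
  then have "rational.complex_eigenvalue_on F \<tau> z"
    unfolding rational.complex_eigenvalue_on_def using basis z(1) by (intro exI[of _ \<beta>]) (simp add: mat)
  then show False using hyp z(2) unfolding rational.hyperbolic_on_def by blast
qed

text \<open>Coordinates of \<open>v\<close> form an eigenvector of the integral matrix. Thus
  hyperbolicity, a condition on the rational form, constrains complex eigenvectors of the whole
  algebra.\<close>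

lemma eigenvector_not_unit:
  assumes "v \<noteq> 0" "T v = scale z v"
  shows "cmod z \<noteq> 1"
proof (rule eigenvalue_A_not_unit)
  let ?c = "vec n (coord v)"
  have "?c \<noteq> 0\<^sub>v n"
  proof
    assume c0: "?c = 0\<^sub>v n"
    have "coord v i = 0" if "i < n" for i using arg_cong[OF c0, of "\<lambda>w. w $ i"] that by simp
    then have "v = 0" using sum_coord[of v] by simp
    then show False using assms by simp
  qed
  moreover have "AC *\<^sub>v ?c = z \<cdot>\<^sub>v ?c"
  proof (rule eq_vecI)
    fix i assume "i < dim_vec (z \<cdot>\<^sub>v ?c)"
    then have i: "i < n" by simp
    have "(AC *\<^sub>v ?c) $ i = (\<Sum>k<n. AC $$ (i, k) * coord v k)"
      using i A_carrier by (auto simp: scalar_prod_def atLeast0LessThan intro!: sum.cong)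
    also have "\<dots> = coord (T v) i" by (rule coord_T[OF i, symmetric])
    finally show "(AC *\<^sub>v ?c) $ i = (z \<cdot>\<^sub>v ?c) $ i" using i by (simp add: assms(2) coord_scale)
  qed (use A_carrier in auto)
  ultimately show "eigenvalue AC z"
    unfolding eigenvalue_def eigenvector_def using A_carrier by (intro exI[of _ ?c]) auto
qed

end

section \<open>Matrices on invariant subspaces and quotients\<close>

context anosov_form
begin

text \<open>The inclusion \<open>W \<subseteq> span (F \<inter> W)\<close> says that
  \<open>W\<close> is defined over the rationals. A rational basis of \<open>F \<inter> W\<close>
  extends to one of \<open>F\<close>, and both remain independent over the complex numbers.\<close>

lemma adapted_basis:
  assumes W: "subspace W" "W \<subseteq> span (F \<inter> W)"
  obtains G\<^sub>1 G where "G\<^sub>1 \<subseteq> G" "span G\<^sub>1 = W" "G \<subseteq> F" "rational.independent G" "rational.span G = F"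
    "independent G" "span G = UNIV"
proof -
  obtain G1 where G1: "G1 \<subseteq> F \<inter> W" "rational.independent G1" "F \<inter> W \<subseteq> rational.span G1"
    by (rule rational.maximal_independent_subset)
  obtain G where G: "G1 \<subseteq> G" "G \<subseteq> F" "rational.independent G" "F \<subseteq> rational.span G"
    by (rule rational.maximal_independent_subset_extend[of G1 F]) (use G1 in auto)
  have "F \<inter> W \<subseteq> span G1" using G1(3) rational_span_subset by blast
  then have "span (F \<inter> W) \<subseteq> span G1" by (rule span_minimal) (rule subspace_span)
  moreover have "span G1 \<subseteq> W" by (rule span_minimal) (use G1 W in auto)
  ultimately have "span G1 = W" using W by auto
  moreover have "rational.span G = F" using G(4) rational.span_minimal[OF G(2) subspace_F] by blast
  ultimately show ?thesis
    using that[OF G(1) _ G(2,3) _ independent_if_rational[OF G(2,3)] span_UNIV_if_rational[OF G(4)]] by blast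
qed

text \<open>One matrix serves two situations: it is the matrix of \<open>T\<close> on the span of
  \<open>xs\<close> if that span is invariant, and the matrix of \<open>T\<close> on the quotient by
  the span of \<open>G - set xs\<close> if that one is invariant.\<close>

definition block :: "'v set \<Rightarrow> 'v list \<Rightarrow> complex mat" where
  "block G xs = mat (length xs) (length xs) (\<lambda>(i, j). representation G (T (xs ! j)) (xs ! i))"

text \<open>\<open>to_xs\<close> is the projection to the coordinates along \<open>xs\<close> and
  \<open>from_xs\<close> the inclusion of \<open>xs\<close>, both written in the basis \<beta>. They
  are the rational rectangular matrices that compare the block with the integral matrix.\<close>

definition to_xs :: "'v set \<Rightarrow> 'v list \<Rightarrow> complex mat" where
  "to_xs G xs = mat (length xs) n (\<lambda>(i, j). representation G (\<beta> ! j) (xs ! i))"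

definition from_xs :: "'v list \<Rightarrow> complex mat" where
  "from_xs xs = mat n (length xs) (\<lambda>(i, j). coord (xs ! j) i)"

context
  fixes G xs
  assumes G: "G \<subseteq> F" "rational.independent G" "rational.span G = F"
    and ind: "independent G" and sp: "span G = UNIV"
    and xs: "distinct xs" "set xs \<subseteq> G"
begin

lemma rep_add: "representation G (u + v) g = representation G u g + representation G v g"
  and rep_scale: "representation G (scale c v) g = c * representation G v g"
  by (simp_all add: representation_add representation_scale ind sp)

lemma rep_rational: "v \<in> F \<Longrightarrow> representation G v g \<in> \<rat>"
  using representation_of_rat[OF G(1,2)] G(3) by auto

lemma rep_expand: "representation G v g = (\<Sum>k<n. coord v k * representation G (\<beta> ! k) g)"
proof -
  have "representation G v g = representation G (\<Sum>k<n. scale (coord v k) (\<beta> ! k)) g"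
    by (simp only: sum_coord)
  also have "\<dots> = (\<Sum>k<n. coord v k * representation G (\<beta> ! k) g)"
    by (rule linear_functional_expand) (rule rep_add rep_scale)+
  finally show ?thesis .
qed

lemma xs_F: "i < length xs \<Longrightarrow> xs ! i \<in> F" using xs G(1) nth_mem by blast

lemma to_from: "to_xs G xs * from_xs xs = 1\<^sub>m (length xs)"
proof (rule eq_matI)
  fix i j assume "i < dim_row (1\<^sub>m (length xs) :: complex mat)" "j < dim_col (1\<^sub>m (length xs) :: complex mat)"
  then have ij: "i < length xs" "j < length xs" by auto
  have "(to_xs G xs * from_xs xs) $$ (i, j) = (\<Sum>k<n. representation G (\<beta> ! k) (xs ! i) * coord (xs ! j) k)"
    using ij by (auto simp: to_xs_def from_xs_def scalar_prod_def atLeast0LessThan intro!: sum.cong)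
  also have "\<dots> = representation G (xs ! j) (xs ! i)" by (simp only: rep_expand[of "xs ! j"] mult.commute)
  also have "\<dots> = (if i = j then 1 else 0)"
    using ij xs nth_mem[OF ij(2)] by (subst representation_basis[OF ind]) (auto simp: nth_eq_iff_index_eq)
  finally show "(to_xs G xs * from_xs xs) $$ (i, j) = 1\<^sub>m (length xs) $$ (i, j)" using ij by simp
qed (auto simp: to_xs_def from_xs_def)

lemma block_carriers: "block G xs \<in> carrier_mat (length xs) (length xs)"
  "to_xs G xs \<in> carrier_mat (length xs) n" "from_xs xs \<in> carrier_mat n (length xs)"
  by (simp_all add: block_def to_xs_def from_xs_def)

lemma block_rational:
  "i < length xs \<Longrightarrow> j < length xs \<Longrightarrow> block G xs $$ (i, j) \<in> \<rat>"
  "i < length xs \<Longrightarrow> j < n \<Longrightarrow> to_xs G xs $$ (i, j) \<in> \<rat>"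
  "i < n \<Longrightarrow> j < length xs \<Longrightarrow> from_xs xs $$ (i, j) \<in> \<rat>"
  using \<beta>_subset nth_mem[of j \<beta>]
  by (auto simp: block_def to_xs_def from_xs_def intro!: rep_rational coord_rational T_F(2) xs_F)

text \<open>The images of the basis vectors outside \<open>xs\<close> have no coordinate along
  \<open>xs\<close>. Hence only the columns of \<open>xs\<close> contribute, which is the statement
  that \<open>T\<close> descends to the quotient.\<close>

lemma to_xs_A:
  assumes W: "T ` span (G - set xs) \<subseteq> span (G - set xs)"
  shows "to_xs G xs * AC = block G xs * to_xs G xs"
proof (rule eq_matI)
  fix i j assume "i < dim_row (block G xs * to_xs G xs)" "j < dim_col (block G xs * to_xs G xs)"
  then have ij: "i < length xs" "j < n" by (simp_all add: block_def to_xs_def)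
  let ?r = "\<lambda>v. representation G v (xs ! i)"
  have z: "?r (T g) = 0" if "g \<in> G - set xs" for g
  proof -
    have "T g \<in> span (G - set xs)" using W that span_base by blast
    then have "?r (T g) = representation (G - set xs) (T g) (xs ! i)"
      using representation_extend[OF ind, of "T g" "G - set xs"] by simp
    then show ?thesis using representation_ne_zero[of "G - set xs" "T g" "xs ! i"] nth_mem[OF ij(1)] by auto
  qed
  have fG: "finite G" using ind by (rule finiteI_independent)
  have "(to_xs G xs * AC) $$ (i, j) = (\<Sum>k<n. ?r (\<beta> ! k) * AC $$ (k, j))"
    using ij A_carrier by (auto simp: to_xs_def scalar_prod_def atLeast0LessThan intro!: sum.cong)
  also have "\<dots> = (\<Sum>k<n. coord (T (\<beta> ! j)) k * ?r (\<beta> ! k))"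
    by (intro sum.cong) (auto simp: coord_T_\<beta> ij mult.commute)
  also have "\<dots> = ?r (T (\<beta> ! j))" by (rule rep_expand[symmetric])
  also have "\<dots> = ?r (T (\<Sum>g\<in>G. scale (representation G (\<beta> ! j) g) g))"
    using sum_representation_eq[OF ind, of "\<beta> ! j" G] fG sp by simp
  also have "\<dots> = (\<Sum>g\<in>G. representation G (\<beta> ! j) g * ?r (T g))"
    unfolding T_sum by (rule linear_functional_expand) (rule rep_add rep_scale)+
  also have "\<dots> = (\<Sum>g\<in>set xs. representation G (\<beta> ! j) g * ?r (T g))"
    by (rule sum.mono_neutral_right[OF fG xs(2)]) (use z in auto)
  also have "\<dots> = (\<Sum>k<length xs. representation G (\<beta> ! j) (xs ! k) * ?r (T (xs ! k)))"
    by (rule sum_set_nth[OF xs(1)])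
  also have "\<dots> = (block G xs * to_xs G xs) $$ (i, j)"
    using ij by (auto simp: block_def to_xs_def scalar_prod_def atLeast0LessThan mult.commute intro!: sum.cong)
  finally show "(to_xs G xs * AC) $$ (i, j) = (block G xs * to_xs G xs) $$ (i, j)" .
qed (use A_carrier in \<open>auto simp: block_def to_xs_def\<close>)

lemma T_xs_invariant:
  assumes W: "T ` span (set xs) \<subseteq> span (set xs)" and j: "j < length xs"
  shows "T (xs ! j) = (\<Sum>k<length xs. scale (block G xs $$ (k, j)) (xs ! k))"
proof -
  let ?v = "T (xs ! j)"
  have v: "?v \<in> span (set xs)" using W nth_mem[OF j] span_base by blast
  have "(\<Sum>k<length xs. scale (block G xs $$ (k, j)) (xs ! k))
      = (\<Sum>k<length xs. scale (representation (set xs) ?v (xs ! k)) (xs ! k))"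
    using j by (intro sum.cong refl) (simp add: block_def representation_extend[OF ind v xs(2)])
  also have "\<dots> = (\<Sum>g\<in>set xs. scale (representation (set xs) ?v g) g)"
    by (rule sum_set_nth[OF xs(1), symmetric])
  also have "\<dots> = ?v"
    by (rule sum_representation_eq[OF independent_mono[OF ind xs(2)] v finite_set subset_refl])
  finally show ?thesis by (rule sym)
qed

text \<open>Dual to the quotient case: the inclusion of an invariant subspace intertwines its block
  with the full matrix.\<close>

lemma A_from_xs:
  assumes W: "T ` span (set xs) \<subseteq> span (set xs)"
  shows "AC * from_xs xs = from_xs xs * block G xs"
proof (rule eq_matI)
  fix i j assume "i < dim_row (from_xs xs * block G xs)" "j < dim_col (from_xs xs * block G xs)"
  then have ij: "i < n" "j < length xs" by (simp_all add: block_def from_xs_def)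
  have "(AC * from_xs xs) $$ (i, j) = (\<Sum>k<n. AC $$ (i, k) * coord (xs ! j) k)"
    using ij A_carrier by (auto simp: from_xs_def scalar_prod_def atLeast0LessThan intro!: sum.cong)
  also have "\<dots> = coord (T (xs ! j)) i" by (rule coord_T[OF ij(1), symmetric])
  also have "\<dots> = (\<Sum>k<length xs. block G xs $$ (k, j) * coord (xs ! k) i)"
    unfolding T_xs_invariant[OF W ij(2)] by (rule linear_functional_expand) (rule coord_add coord_scale)+
  also have "\<dots> = (from_xs xs * block G xs) $$ (i, j)"
    using ij by (auto simp: block_def from_xs_def scalar_prod_def atLeast0LessThan mult.commute intro!: sum.cong)
  finally show "(AC * from_xs xs) $$ (i, j) = (from_xs xs * block G xs) $$ (i, j)" .
qed (use A_carrier in \<open>auto simp: block_def from_xs_def\<close>)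

lemma cmod_det_quotient_block:
  assumes W: "T ` span (G - set xs) \<subseteq> span (G - set xs)"
  shows "cmod (det (block G xs)) = 1"
proof -
  obtain B where B: "B \<in> carrier_mat n n" "A * B = 1\<^sub>m n" by (rule A_inverse)
  have "AC * map_mat of_int B = 1\<^sub>m n"
    using of_int_hom.mat_hom_mult[OF A_carrier B(1), where ?'a = complex] B(2)
    by (simp add: of_int_hom.mat_hom_one)
  then show ?thesis
    using A_carrier B(1) block_rational
    by (intro cmod_det_block[OF _ _ block_carriers(2,3,1) _ _ _ _ _ to_xs_A[OF W] to_from, of "map_mat of_int B"]) auto
qed

lemma eigenvalue_quotient_block:
  assumes W: "T ` span (G - set xs) \<subseteq> span (G - set xs)" and z: "eigenvalue (block G xs) z"
  shows "cmod z \<noteq> 1" "z \<notin> \<rat>"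
proof -
  have A: "eigenvalue AC z"
    using A_carrier by (intro eigenvalue_block[OF _ block_carriers(2,3,1) to_xs_A[OF W] to_from z]) auto
  then show ne: "cmod z \<noteq> 1" by (rule eigenvalue_A_not_unit)
  obtain B where B: "B \<in> carrier_mat n n" "B * A = 1\<^sub>m n" by (rule A_inverse)
  show "z \<notin> \<rat>" using rational_eigenvalue_unimodular[OF A_carrier B A] ne by blast
qed

text \<open>Transposition turns the inclusion of an invariant subspace into a projection to a
  quotient. The quotient argument then applies with \<open>from_xs\<close> and \<open>to_xs\<close>
  exchanged.\<close>

lemma cmod_det_invariant_block:
  assumes W: "T ` span (set xs) \<subseteq> span (set xs)"
  shows "cmod (det (block G xs)) = 1"
proof -
  let ?t = transpose_mat
  obtain B where B: "B \<in> carrier_mat n n" "B * A = 1\<^sub>m n" by (rule A_inverse)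
  have BA: "map_mat of_int B * AC = 1\<^sub>m n"
    using of_int_hom.mat_hom_mult[OF B(1) A_carrier, where ?'a = complex] B(2)
    by (simp add: of_int_hom.mat_hom_one)
  have AC: "AC \<in> carrier_mat n n" and BC: "map_mat of_int B \<in> carrier_mat n n" using A_carrier B(1) by auto
  have c: "?t AC \<in> carrier_mat n n" "?t (map_mat of_int B) \<in> carrier_mat n n"
    "?t (from_xs xs) \<in> carrier_mat (length xs) n" "?t (to_xs G xs) \<in> carrier_mat n (length xs)"
    "?t (block G xs) \<in> carrier_mat (length xs) (length xs)"
    using A_carrier B block_carriers by auto
  have "cmod (det (?t (block G xs))) = 1"
  proof (rule cmod_det_block[OF c])
    show "?t AC * ?t (map_mat of_int B) = 1\<^sub>m n"
      using transpose_mult[OF BC AC] BA by simp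
    show "?t (from_xs xs) * ?t AC = ?t (block G xs) * ?t (from_xs xs)"
      using transpose_mult[OF AC block_carriers(3)] transpose_mult[OF block_carriers(3,1)] A_from_xs[OF W] by simp
    show "?t (from_xs xs) * ?t (to_xs G xs) = 1\<^sub>m (length xs)"
      using transpose_mult[OF block_carriers(2,3)] to_from by simp
  qed (use A_carrier B(1) block_carriers block_rational in auto)
  then show ?thesis using det_transpose[OF block_carriers(1)] by simp
qed

end

text \<open>The eigenvectors need not be rational: only \<open>W\<close> is. Their coordinates are
  eigenvectors of the block on \<open>W\<close>, and three distinct eigenvalues exhaust the roots of
  its characteristic polynomial, so their product is the determinant.\<close>

lemma invariant_subspace_eigenvalues:
  assumes W: "subspace W" "W \<subseteq> span (F \<inter> W)" "\<And>w. w \<in> W \<Longrightarrow> T w \<in> W" and d: "dim W = 3"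
    and e: "u \<in> W" "v \<in> W" "w \<in> W" "u \<noteq> 0" "v \<noteq> 0" "w \<noteq> 0"
    and ev: "T u = scale a u" "T v = scale b v" "T w = scale c w" and ne: "a \<noteq> b" "b \<noteq> c" "a \<noteq> c"
  shows "cmod (a * b * c) = 1"
proof -
  obtain G1 G where G: "G1 \<subseteq> G" "span G1 = W" "G \<subseteq> F" "rational.independent G" "rational.span G = F"
    "independent G" "span G = UNIV"
    by (rule adapted_basis[OF W(1,2)])
  have ind1: "independent G1" using G independent_mono by blast
  obtain xs where xs: "set xs = G1" "distinct xs"
    using finite_distinct_list[OF finiteI_independent[OF ind1]] by blast
  have len: "length xs = 3"
    using dim_span_eq_card_independent[OF ind1] d G(2) xs distinct_card by metis
  have xsG: "set xs \<subseteq> G" using xs G by simp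
  note ctx = G(3-7) xs(2) xsG
  have inv: "T ` span (set xs) \<subseteq> span (set xs)" using W(3) G(2) xs by auto
  let ?P = "block G xs"
  have P: "?P \<in> carrier_mat 3 3" using block_carriers(1)[OF ctx] len by simp
  have eig: "eigenvalue ?P z" if x: "x \<in> W" "x \<noteq> 0" "T x = scale z x" for x z
  proof -
    let ?r = "\<lambda>v i. representation (set xs) v (xs ! i)"
    have indx: "independent (set xs)" using ind1 xs by simp
    have expand: "(\<Sum>i<3. scale (?r x i) (xs ! i)) = x"
      using sum_representation_eq[OF indx _ finite_set subset_refl, of x] x(1) G(2)
      unfolding sum_set_nth[OF xs(2)] len unfolding xs(1) by simp
    have in_span: "xs ! i \<in> span (set xs)" if "i < 3" for i using that len span_base nth_mem by metis
    let ?c = "vec 3 (?r x)"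
    have "?c \<noteq> 0\<^sub>v 3"
    proof
      assume c0: "?c = 0\<^sub>v 3"
      have "?r x i = 0" if "i < 3" for i using arg_cong[OF c0, of "\<lambda>w. w $ i"] that by simp
      then have "x = 0" using expand by simp
      then show False using x by simp
    qed
    moreover have "?P *\<^sub>v ?c = z \<cdot>\<^sub>v ?c"
    proof (rule eq_vecI)
      fix i assume "i < dim_vec (z \<cdot>\<^sub>v ?c)"
      then have i: "i < 3" by simp
      have xin: "x \<in> span (set xs)" using x(1) G(2) xs by simp
      have "(?P *\<^sub>v ?c) $ i = (\<Sum>k<3. ?P $$ (i, k) * ?r x k)"
        using i P by (auto simp: scalar_prod_def atLeast0LessThan intro!: sum.cong)
      also have "\<dots> = (\<Sum>k<3. ?r x k * representation G (T (xs ! k)) (xs ! i))"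
        by (intro sum.cong) (use i len in \<open>auto simp: block_def mult.commute\<close>)
      also have "\<dots> = representation G (\<Sum>k<3. scale (?r x k) (T (xs ! k))) (xs ! i)"
        by (rule linear_functional_expand[symmetric]) (rule rep_add[OF ctx] rep_scale[OF ctx])+
      also have "\<dots> = representation G (T x) (xs ! i)"
        unfolding T_sum[symmetric] expand ..
      also have "\<dots> = z * representation G x (xs ! i)" unfolding x(3) by (rule rep_scale[OF ctx])
      also have "representation G x = representation (set xs) x"
        by (rule representation_extend[OF G(6) xin xsG])
      finally show "(?P *\<^sub>v ?c) $ i = (z \<cdot>\<^sub>v ?c) $ i" using i by simp
    qed (use P in auto)
    ultimately show ?thesis
      unfolding eigenvalue_def eigenvector_def using P by (intro exI[of _ ?c]) auto
  qed
  have "det ?P = a * b * c"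
    by (rule det_3_distinct_eigenvalues[OF P eig[OF e(1,4) ev(1)] eig[OF e(2,5) ev(2)] eig[OF e(3,6) ev(3)] ne])
  then show ?thesis using cmod_det_invariant_block[OF ctx inv] by simp
qed

text \<open>Eigenvectors of the block are lifted to vectors that are eigenvectors up to an error in
  \<open>W\<close>. This weaker property is enough for the triple brackets later on.\<close>

lemma quotient_eigenvectors:
  assumes W: "subspace W" "W \<subseteq> span (F \<inter> W)" "\<And>w. w \<in> W \<Longrightarrow> T w \<in> W" and d: "dim UNIV = 3 + dim W"
  obtains u v w a b c where "u \<notin> W" "v \<notin> W" "w \<notin> W"
    "T u - scale a u \<in> W" "T v - scale b v \<in> W" "T w - scale c w \<in> W"
    "cmod (a * b * c) = 1" "cmod a \<noteq> 1" "cmod b \<noteq> 1" "cmod c \<noteq> 1"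
    "a \<noteq> b" "b \<noteq> c" "a \<noteq> c" "a \<noteq> - b" "b \<noteq> - c" "a \<noteq> - c"
proof -
  obtain G1 G where G: "G1 \<subseteq> G" "span G1 = W" "G \<subseteq> F" "rational.independent G" "rational.span G = F"
    "independent G" "span G = UNIV"
    by (rule adapted_basis[OF W(1,2)])
  have ind1: "independent G1" using G independent_mono by blast
  have fG: "finite G" using G(6) by (rule finiteI_independent)
  obtain xs where xs: "set xs = G - G1" "distinct xs"
    using finite_distinct_list[of "G - G1"] fG by blast
  have "card G = 3 + card G1"
    using dim_span_eq_card_independent[OF ind1] dim_span_eq_card_independent[OF G(6)] d G(2,7) by simp
  then have len: "length xs = 3"
    using distinct_card[OF xs(2)] xs(1) card_Diff_subset[OF finite_subset[OF G(1) fG] G(1)] by simp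
  have xsG: "set xs \<subseteq> G" using xs G by auto
  note ctx = G(3-7) xs(2) xsG
  have Gxs: "G - set xs = G1" using xs G(1) by auto
  have inv: "T ` span (G - set xs) \<subseteq> span (G - set xs)" unfolding Gxs using W(3) G(2) by auto
  let ?P = "block G xs"
  have P: "?P \<in> carrier_mat 3 3" using block_carriers(1)[OF ctx] len by simp
  have mod_W: "v - (\<Sum>i<3. scale (representation G v (xs ! i)) (xs ! i)) \<in> W" for v
  proof -
    have "v = (\<Sum>g\<in>G. scale (representation G v g) g)"
      using sum_representation_eq[OF G(6), of v G] fG G(7) by simp
    also have "\<dots> = (\<Sum>g\<in>set xs. scale (representation G v g) g) + (\<Sum>g\<in>G1. scale (representation G v g) g)"
      using sum.subset_diff[OF G(1) fG] xs(1) by simp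
    also have "(\<Sum>g\<in>set xs. scale (representation G v g) g) = (\<Sum>i<3. scale (representation G v (xs ! i)) (xs ! i))"
      using sum_set_nth[OF xs(2)] len by simp
    finally have "v - (\<Sum>i<3. scale (representation G v (xs ! i)) (xs ! i)) = (\<Sum>g\<in>G1. scale (representation G v g) g)"
      by (simp add: algebra_simps)
    also have "\<dots> \<in> W" unfolding G(2)[symmetric] by (intro span_sum span_scale span_base)
    finally show ?thesis .
  qed
  have rep_W: "representation G x (xs ! i) = 0" if "x \<in> W" "i < 3" for x i
  proof -
    have "xs ! i \<notin> G1" using xs that(2) len nth_mem[of i xs] by auto
    then show ?thesis
      using representation_extend[OF G(6), of x G1] that G(1,2) representation_ne_zero[of G1 x "xs ! i"] by auto
  qed
  \<comment> \<open>A vector is determined modulo \<open>W\<close> by its coordinates along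
    \<open>xs\<close>, so the combination of \<open>xs\<close> with the entries of a block
    eigenvector has the required property.\<close>
  have lift: "\<exists>x. x \<notin> W \<and> T x - scale z x \<in> W" if z: "eigenvalue ?P z" for z
  proof -
    obtain c where c: "c \<in> carrier_vec 3" "c \<noteq> 0\<^sub>v 3" "?P *\<^sub>v c = z \<cdot>\<^sub>v c"
      using z P unfolding eigenvalue_def eigenvector_def by auto
    define x where "x = (\<Sum>k<3. scale (c $ k) (xs ! k))"
    have rep_x: "representation G x (xs ! i) = c $ i" if i: "i < 3" for i
    proof -
      have "representation G x (xs ! i) = (\<Sum>k<3. c $ k * representation G (xs ! k) (xs ! i))"
        unfolding x_def by (rule linear_functional_expand) (rule rep_add[OF ctx] rep_scale[OF ctx])+
      also have "\<dots> = (\<Sum>k<3. if k = i then c $ k else 0)"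
      proof (intro sum.cong refl)
        fix k :: nat assume "k \<in> {..<3}"
        then show "c $ k * representation G (xs ! k) (xs ! i) = (if k = i then c $ k else 0)"
          using i len xs(2) xsG nth_mem[of k xs]
          by (subst representation_basis[OF G(6)]) (auto simp: nth_eq_iff_index_eq)
      qed
      also have "\<dots> = c $ i" using i by simp
      finally show ?thesis .
    qed
    have "x \<notin> W"
    proof
      assume "x \<in> W"
      then have "c $ i = 0" if "i < 3" for i using rep_x rep_W that by metis
      then have "c = 0\<^sub>v 3" using c(1) by (intro eq_vecI) auto
      then show False using c(2) by simp
    qed
    moreover have "T x - scale z x \<in> W"
    proof -
      have "representation G (T x) (xs ! i) = z * c $ i" if i: "i < 3" for i
      proof -
        have "representation G (T x) (xs ! i) = (\<Sum>k<3. c $ k * representation G (T (xs ! k)) (xs ! i))"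
          unfolding x_def T_sum by (rule linear_functional_expand) (rule rep_add[OF ctx] rep_scale[OF ctx])+
        also have "\<dots> = (?P *\<^sub>v c) $ i"
          using i P c(1) len by (auto simp: block_def scalar_prod_def atLeast0LessThan mult.commute intro!: sum.cong)
        finally show ?thesis using c i by simp
      qed
      then have "(\<Sum>i<3. scale (representation G (T x) (xs ! i)) (xs ! i)) = scale z x"
        by (simp add: x_def scale_sum_right)
      then show ?thesis using mod_W[of "T x"] by simp
    qed
    ultimately show ?thesis by blast
  qed
  obtain a b c where abc: "eigenvalue ?P a" "eigenvalue ?P b" "eigenvalue ?P c" "det ?P = a * b * c"
    "a \<noteq> b" "b \<noteq> c" "a \<noteq> c" "a \<noteq> - b" "b \<noteq> - c" "a \<noteq> - c"
  proof (rule rational_mat_3_eigenvalues[OF P])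
    show "?P $$ (i, j) \<in> \<rat>" if "i < 3" "j < 3" for i j using block_rational(1)[OF ctx] that len by simp
    show "z \<notin> \<rat>" if "eigenvalue ?P z" for z by (rule eigenvalue_quotient_block(2)[OF ctx inv that])
  qed
  have "cmod (a * b * c) = 1" using cmod_det_quotient_block[OF ctx inv] abc(4) by simp
  moreover have "cmod a \<noteq> 1" "cmod b \<noteq> 1" "cmod c \<noteq> 1"
    using eigenvalue_quotient_block(1)[OF ctx inv] abc(1-3) by blast+
  ultimately show ?thesis using lift[OF abc(1)] lift[OF abc(2)] lift[OF abc(3)] abc(5-) that by metis
qed

end

section \<open>Structure in type (3, 3, 3)\<close>

text \<open>The pairs \<open>p\<close>/\<open>u\<close>, \<open>q\<close>/\<open>s\<close> and
  \<open>r\<close>/\<open>t\<close> record the choice of the opposite roots with values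
  \<plusminus>(Q + R), \<plusminus>Q and \<plusminus>R. Among the choices of three roots, all but
  the two triangles force a chosen root to take the value 0; a check of all truth values confirms
  this.\<close>

lemma triangle_of_weights_aux:
  fixes Q R :: real
  assumes "of_bool p + of_bool u + of_bool q + of_bool s + of_bool r + of_bool t = (3 :: nat)"
    "(of_bool p - of_bool u) * (Q + R) + (of_bool q - of_bool s) * Q + (of_bool r - of_bool t) * R = 0"
    "p \<or> u \<Longrightarrow> Q + R \<noteq> 0" "q \<or> s \<Longrightarrow> Q \<noteq> 0" "r \<or> t \<Longrightarrow> R \<noteq> 0"
  shows "p \<and> s \<and> t \<and> \<not> r \<and> \<not> u \<and> \<not> q \<or> \<not> p \<and> \<not> s \<and> \<not> t \<and> r \<and> u \<and> q"
proof -
  have "(p \<or> u) \<and> Q + R = 0 \<or> (q \<or> s) \<and> Q = 0 \<or> (r \<or> t) \<and> R = 0 \<or> ?thesis"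
    using assms(1,2) by (cases p; cases u; cases q; cases s; cases r; cases t; simp)
  then show ?thesis using assms(3-5) by blast
qed

text \<open>As the \<alpha>_i have sum 0, \<open>2 * \<alpha> i + \<alpha> j\<close> is the
  difference of \<alpha>_i and the \<alpha> of the third index, that is, the value of a root of
  A_2.\<close>

lemma triangle_of_weights:
  fixes \<alpha> :: "nat \<Rightarrow> real" and N :: "(nat \<times> nat) set"
  assumes "\<alpha> 0 + \<alpha> 1 + \<alpha> 2 = 0" and N: "N \<subseteq> {(0, 1), (0, 2), (1, 0), (1, 2), (2, 0), (2, 1)}" "card N = 3"
    and ne: "\<And>i j. (i, j) \<in> N \<Longrightarrow> 2 * \<alpha> i + \<alpha> j \<noteq> 0"
    and sm: "(\<Sum>(i, j)\<in>N. 2 * \<alpha> i + \<alpha> j) = 0"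
  shows "N = {(0, 1), (1, 2), (2, 0)} \<or> N = {(1, 0), (2, 1), (0, 2)}"
proof -
  let ?I = "{(0, 1), (0, 2), (1, 0), (1, 2), (2, 0), (2, 1)} :: (nat \<times> nat) set"
  \<comment> \<open>Written with indicators, sums over the unknown set \<open>N\<close> become sums
    of six terms. The polymorphic form covers both the cardinality and the sum of the
    weights.\<close>
  have sum_N: "(\<Sum>p\<in>N. g p) = of_bool ((0, 1) \<in> N) * g (0, 1) + of_bool ((0, 2) \<in> N) * g (0, 2)
      + of_bool ((1, 0) \<in> N) * g (1, 0) + of_bool ((1, 2) \<in> N) * g (1, 2)
      + of_bool ((2, 0) \<in> N) * g (2, 0) + of_bool ((2, 1) \<in> N) * g (2, 1)"
    for g :: "nat \<times> nat \<Rightarrow> 'a::comm_semiring_1"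
  proof -
    have "(\<Sum>p\<in>N. g p) = (\<Sum>p\<in>?I. if p \<in> N then g p else 0)"
      using N(1) by (subst sum.inter_restrict[symmetric]) (simp_all add: Int_absorb1)
    also have "\<dots> = (\<Sum>p\<in>?I. of_bool (p \<in> N) * g p)" by (intro sum.cong) auto
    also have "\<dots> = of_bool ((0, 1) \<in> N) * g (0, 1) + of_bool ((0, 2) \<in> N) * g (0, 2)
      + of_bool ((1, 0) \<in> N) * g (1, 0) + of_bool ((1, 2) \<in> N) * g (1, 2)
      + of_bool ((2, 0) \<in> N) * g (2, 0) + of_bool ((2, 1) \<in> N) * g (2, 1)"
      by (simp del: of_bool_eq add: add.assoc)
    finally show ?thesis .
  qed
  \<comment> \<open>\<open>Q\<close> and \<open>R\<close> are the values of the simple roots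
    \<alpha>_0 - \<alpha>_1 and \<alpha>_1 - \<alpha>_2; the six weights are \<plusminus>Q,
    \<plusminus>R and \<plusminus>(Q + R).\<close>
  define Q R where "Q = \<alpha> 0 - \<alpha> 1" and "R = \<alpha> 0 + 2 * \<alpha> 1"
  have QR: "2 * \<alpha> 0 + \<alpha> 1 = Q + R" "2 * \<alpha> 0 + \<alpha> 2 = Q" "2 * \<alpha> 1 + \<alpha> 0 = R"
    "2 * \<alpha> 1 + \<alpha> 2 = - Q" "2 * \<alpha> 2 + \<alpha> 0 = - R" "2 * \<alpha> 2 + \<alpha> 1 = - (Q + R)"
    using assms(1) by (simp_all add: Q_def R_def)
  have "(0, 1) \<in> N \<and> (1, 2) \<in> N \<and> (2, 0) \<in> N \<and> (1, 0) \<notin> N \<and> (2, 1) \<notin> N \<and> (0, 2) \<notin> N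
      \<or> (0, 1) \<notin> N \<and> (1, 2) \<notin> N \<and> (2, 0) \<notin> N \<and> (1, 0) \<in> N \<and> (2, 1) \<in> N \<and> (0, 2) \<in> N"
  proof (rule triangle_of_weights_aux)
    show "of_bool ((0, 1) \<in> N) + of_bool ((2, 1) \<in> N) + of_bool ((0, 2) \<in> N) + of_bool ((1, 2) \<in> N)
        + of_bool ((1, 0) \<in> N) + of_bool ((2, 0) \<in> N) = (3 :: nat)"
      using sum_N[of "\<lambda>_. 1 :: nat"] N(2) unfolding card_eq_sum[symmetric] mult_1_right by linarith
    have "(\<Sum>(i, j)\<in>N. 2 * \<alpha> i + \<alpha> j) = of_bool ((0, 1) \<in> N) * (Q + R) + of_bool ((0, 2) \<in> N) * Q
        + of_bool ((1, 0) \<in> N) * R + of_bool ((1, 2) \<in> N) * - Q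
        + of_bool ((2, 0) \<in> N) * - R + of_bool ((2, 1) \<in> N) * - (Q + R)"
      unfolding sum_N prod.case QR ..
    then show "(of_bool ((0, 1) \<in> N) - of_bool ((2, 1) \<in> N)) * (Q + R)
        + (of_bool ((0, 2) \<in> N) - of_bool ((1, 2) \<in> N)) * Q
        + (of_bool ((1, 0) \<in> N) - of_bool ((2, 0) \<in> N)) * R = 0"
      unfolding sm left_diff_distrib distrib_left mult_minus_right minus_add_distrib by linarith
    show "Q + R \<noteq> 0" if "(0, 1) \<in> N \<or> (2, 1) \<in> N" using that ne[of 0 1] ne[of 2 1] unfolding QR by auto
    show "Q \<noteq> 0" if "(0, 2) \<in> N \<or> (1, 2) \<in> N" using that ne[of 0 2] ne[of 1 2] unfolding QR by auto
    show "R \<noteq> 0" if "(1, 0) \<in> N \<or> (2, 0) \<in> N" using that ne[of 1 0] ne[of 2 0] unfolding QR by auto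
  qed
  then show ?thesis
  proof
    assume "(0, 1) \<in> N \<and> (1, 2) \<in> N \<and> (2, 0) \<in> N \<and> (1, 0) \<notin> N \<and> (2, 1) \<notin> N \<and> (0, 2) \<notin> N"
    then show ?thesis using N(1) by (intro disjI1) blast
  next
    assume "(0, 1) \<notin> N \<and> (1, 2) \<notin> N \<and> (2, 0) \<notin> N \<and> (1, 0) \<in> N \<and> (2, 1) \<in> N \<and> (0, 2) \<in> N"
    then show ?thesis using N(1) by (intro disjI2) blast
  qed
qed

section \<open>The automorphism on the lower central series\<close>

locale anosov_333 = anosov_form +
  assumes type: "has_type [3, 3, 3]"
begin

abbreviation "L\<^sub>1 \<equiv> lower_central 1"
abbreviation "L\<^sub>2 \<equiv> lower_central 2"

declare lower_central.simps [simp del]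

lemma dims: "dim UNIV = 9" "dim L\<^sub>1 = 6" "dim L\<^sub>2 = 3" "lower_central 3 = {0}"
  by (rule has_type_333_basis[OF type]; simp)+

lemma T_lower_central: "v \<in> lower_central i \<Longrightarrow> T v \<in> lower_central i"
proof (induction i arbitrary: v)
  case (Suc i)
  have T0: "T 0 = 0" using T_scale[of 0 0] by simp
  from Suc.prems show ?case
    unfolding lower_central.simps(2)
  proof (induction v rule: span_induct_alt)
    case (step c x y)
    then obtain u w where "x = bracket u w" "w \<in> lower_central i" by auto
    then have "T x \<in> {bracket x y |x y. y \<in> lower_central i}" using Suc.IH T_bracket by auto
    then show ?case using step by (simp add: T_add T_scale span_add span_scale span_base)
  qed (simp add: T0 span_zero)
qed (simp add: lower_central.simps)

lemma span_F: "span F = UNIV" by (rule span_UNIV_if_rational) (rule rational.span_superset)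

text \<open>\<open>F\<close> spans the algebra and is closed under brackets, so each term of the
  series is spanned by brackets of elements of \<open>F\<close>. This qualifies the terms for the
  results on rational subspaces.\<close>

lemma lower_central_rational: "lower_central i \<subseteq> span (F \<inter> lower_central i)"
proof (induction i)
  case 0
  show ?case using span_F by (simp add: lower_central.simps)
next
  case (Suc i)
  have sub: "{bracket x y |x y. y \<in> lower_central i} \<subseteq> span (F \<inter> lower_central (Suc i))"
  proof
    fix v assume "v \<in> {bracket x y |x y. y \<in> lower_central i}"
    then obtain x y where v: "v = bracket x y" "y \<in> span (F \<inter> lower_central i)" using Suc by auto
    have "bracket x y \<in> span (F \<inter> lower_central (Suc i))"
    proof (rule bracket_in_span[of F "F \<inter> lower_central i"])
      show "x \<in> span F" using span_F by simp
      show "bracket a b \<in> span (F \<inter> lower_central (Suc i))" if "a \<in> F" "b \<in> F \<inter> lower_central i" for a b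
        using that bracket_F[of a b] bracket_in_lower_central[of b i a] by (intro span_base) simp
    qed (rule v(2))
    then show "v \<in> span (F \<inter> lower_central (Suc i))" using v by simp
  qed
  have "span {bracket x y |x y. y \<in> lower_central i} \<subseteq> span (F \<inter> lower_central (Suc i))"
    using span_minimal[OF sub subspace_span] .
  then show ?case by (simp add: lower_central.simps(2))
qed

lemma bracket_L1: "bracket x y \<in> L\<^sub>1"
  using bracket_in_lower_central[of y 0 x] by (simp add: lower_central.simps(1))

lemma bracket_L2: "y \<in> L\<^sub>1 \<Longrightarrow> bracket x y \<in> L\<^sub>2" "y \<in> L\<^sub>1 \<Longrightarrow> bracket y x \<in> L\<^sub>2"
proof -
  assume y: "y \<in> L\<^sub>1"
  then show xy: "bracket x y \<in> L\<^sub>2" using bracket_in_lower_central[of y 1 x] by (simp add: numeral_2_eq_2)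
  show "bracket y x \<in> L\<^sub>2" using subspace_neg[OF subspace_lower_central xy] bracket_skew[of y x] by simp
qed

lemma bracket_L3: "y \<in> L\<^sub>2 \<Longrightarrow> bracket x y = 0" "y \<in> L\<^sub>2 \<Longrightarrow> bracket y x = 0"
proof -
  assume y: "y \<in> L\<^sub>2"
  then show xy: "bracket x y = 0"
    using bracket_in_lower_central[of y 2 x] dims(4) by (simp add: eval_nat_numeral)
  show "bracket y x = 0" using xy bracket_skew[of y x] by simp
qed

text \<open>By the Jacobi identity, [y, [u, v]] is a combination of [u, [v, y]] and [v, [y, u]]. For
  \<open>y\<close> in the derived algebra these lie in \<open>lower_central 3\<close>, which is
  zero.\<close>

lemma bracket_L1_L1: assumes "x \<in> L\<^sub>1" "y \<in> L\<^sub>1" shows "bracket x y = 0"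
proof -
  have bb: "bracket y (bracket u v) = 0" for u v
  proof -
    have "bracket u (bracket v y) = 0" "bracket v (bracket y u) = 0"
      using bracket_L3 bracket_L2 assms(2) by blast+
    then show ?thesis using jacobi[of u v y] by simp
  qed
  have "x \<in> span {bracket x y |x y. y \<in> lower_central 0}"
    using assms(1) by (simp add: lower_central.simps(2)[of 0, simplified])
  then have "bracket y x = 0"
  proof (induction x rule: span_induct_alt)
    case (step c u v)
    then show ?case using bb by (auto simp: bracket_add_right bracket_scale_right)
  qed simp
  then show ?thesis using bracket_skew[of x y] by simp
qed

lemma triple_eigenvector:
  assumes "T x - scale a x \<in> L\<^sub>1" "T y - scale b y \<in> L\<^sub>1" "T z - scale c z \<in> L\<^sub>1"
  shows "T (bracket x (bracket y z)) = scale (a * b * c) (bracket x (bracket y z))"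
proof -
  obtain x' y' z' where e: "T x = scale a x + x'" "T y = scale b y + y'" "T z = scale c z + z'"
    and in_L1: "x' \<in> L\<^sub>1" "y' \<in> L\<^sub>1" "z' \<in> L\<^sub>1"
    using assms by (metis add.commute diff_add_cancel)
  define r where "r = scale b (bracket y z') + bracket y' (T z)"
  have "T (bracket y z) = scale (b * c) (bracket y z) + r"
    unfolding T_bracket e(2) r_def by (simp add: e(3) bracket_add_left bracket_add_right bracket_scale_left
        bracket_scale_right scale_right_distrib algebra_simps)
  moreover have r: "r \<in> L\<^sub>2"
    unfolding r_def using in_L1 bracket_L2 subspace_lower_central by (intro subspace_add subspace_scale) auto
  ultimately have "T (bracket x (bracket y z)) = bracket (scale a x + x') (scale (b * c) (bracket y z) + r)"
    by (simp only: T_bracket e(1))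
  also have "\<dots> = scale (a * b * c) (bracket x (bracket y z))"
    using bracket_L3[OF r] bracket_L1_L1[OF in_L1(1) bracket_L1]
    by (simp add: bracket_add_left bracket_add_right bracket_scale_left bracket_scale_right mult.assoc)
  finally show ?thesis .
qed

lemma standard_generators:
  obtains x y z where "span ({x, y, z} \<union> L\<^sub>1) = UNIV"
    "L\<^sub>1 \<subseteq> span ({bracket x y, bracket y z, bracket z x} \<union> L\<^sub>2)"
    "L\<^sub>2 \<subseteq> span {bracket x (bracket x y), bracket y (bracket y z), bracket z (bracket z x)}"
    "bracket x (bracket y z) = 0" "bracket y (bracket z x) = 0" "bracket z (bracket x y) = 0"
    "bracket y (bracket x y) = 0" "bracket z (bracket y z) = 0" "bracket x (bracket z x) = 0"
proof -
  note rat = subspace_lower_central lower_central_rational T_lower_central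
  have "dim UNIV = 3 + dim L\<^sub>1" using dims by simp
  then obtain u v w a b c where uvw: "u \<notin> L\<^sub>1" "v \<notin> L\<^sub>1" "w \<notin> L\<^sub>1"
    "T u - scale a u \<in> L\<^sub>1" "T v - scale b v \<in> L\<^sub>1" "T w - scale c w \<in> L\<^sub>1"
    and abc: "cmod (a * b * c) = 1" "cmod a \<noteq> 1" "cmod b \<noteq> 1" "cmod c \<noteq> 1"
    "a \<noteq> b" "b \<noteq> c" "a \<noteq> c" "a \<noteq> - b" "b \<noteq> - c" "a \<noteq> - c"
    by (rule quotient_eigenvectors[OF rat(1,2), rotated]) (rule that, assumption+, erule T_lower_central)
  \<comment> \<open>Every index from 2 on stands for the third generator, so that the facts about
    \<open>X\<close> and \<open>l\<close> hold for all indices without bounds.\<close>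
  define X where "X i = (if i = 0 then u else if i = 1 then v else w)" for i :: nat
  define l where "l i = (if i = 0 then a else if i = 1 then b else c)" for i :: nat
  have X: "T (X i) - scale (l i) (X i) \<in> L\<^sub>1" "X i \<notin> L\<^sub>1" for i
    using uvw by (auto simp: X_def l_def)
  have X012: "X 0 = u" "X 1 = v" "X 2 = w" "l 0 = a" "l 1 = b" "l 2 = c" by (simp_all add: X_def l_def)
  let ?X = "{u, v, w}"
  have X_im: "X i \<in> ?X" for i by (simp add: X_def)

  \<comment> \<open>Distinct eigenvalues make the three vectors independent modulo the derived
    algebra. Since 3 + 6 = 9, they generate everything together with it.\<close>
  have "inj_on l {..<3}" using abc by (auto simp: inj_on_def l_def eval_nat_numeral less_Suc_eq)
  then have "indep_mod L\<^sub>1 {..<3} X"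
    using X by (intro indep_mod_eigenvectors[OF subspace_lower_central T_linear T_lower_central]) auto
  then have "dim (X ` {..<3} \<union> L\<^sub>1) = 9"
    using dim_span_indep_mod[OF subspace_lower_central, of "{..<3}" 1 X] dims by simp
  moreover have "X ` {..<3} = ?X" by (auto simp: X_def eval_nat_numeral lessThan_Suc)
  ultimately have gen: "span (?X \<union> L\<^sub>1) = UNIV"
    using dim_eq_full[of "?X \<union> L\<^sub>1"] dims(1) dim_UNIV by (simp add: dimension_def)

  let ?W = "{bracket u v, bracket v w, bracket w u}"
  have W: "L\<^sub>1 \<subseteq> span (?W \<union> L\<^sub>2)"
  proof -
    have in_W: "bracket x y \<in> span (?W \<union> L\<^sub>2)" if "x \<in> ?X \<union> L\<^sub>1" "y \<in> ?X \<union> L\<^sub>1" for x y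
    proof (cases "x \<in> L\<^sub>1 \<or> y \<in> L\<^sub>1")
      case True
      then show ?thesis using bracket_L2 by (intro span_base) auto
    next
      case False
      then have "x \<in> ?X" "y \<in> ?X" using that by auto
      then have "bracket x y \<in> ?W \<or> - bracket x y \<in> ?W \<or> bracket x y = 0"
        using bracket_skew[of v u] bracket_skew[of w v] bracket_skew[of u w]
        by (auto simp: bracket_alternating)
      then show ?thesis
        using span_base[of _ "?W \<union> L\<^sub>2"] span_neg[of "- bracket x y" "?W \<union> L\<^sub>2"] span_zero
        by (metis UnCI minus_minus)
    qed
    have "{bracket x y |x y. y \<in> lower_central 0} \<subseteq> span (?W \<union> L\<^sub>2)"
      using bracket_in_span[of "?X \<union> L\<^sub>1" "?X \<union> L\<^sub>1" "?W \<union> L\<^sub>2", OF in_W] unfolding gen by blast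
    then have "span {bracket x y |x y. y \<in> lower_central 0} \<subseteq> span (?W \<union> L\<^sub>2)"
      by (rule span_minimal) (rule subspace_span)
    then show ?thesis by (simp add: lower_central.simps(2)[of 0, simplified])
  qed

  have trip: "T (bracket (X i) (bracket (X j) (X k))) = scale (l i * l j * l k) (bracket (X i) (bracket (X j) (X k)))"
    for i j k by (rule triple_eigenvector[OF X(1) X(1) X(1)])
  have mixed: "bracket u (bracket v w) = 0" "bracket v (bracket w u) = 0" "bracket w (bracket u v) = 0"
  proof -
    have z: "bracket (X i) (bracket (X j) (X k)) = 0" if "l i * l j * l k = a * b * c" for i j k
      using eigenvector_not_unit[OF _ trip[of i j k]] that abc(1) by auto
    show "bracket u (bracket v w) = 0" using z[of 0 1 2] X012 by simp
    show "bracket v (bracket w u) = 0" using z[of 1 2 0] X012 by (simp add: mult_ac)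
    show "bracket w (bracket u v) = 0" using z[of 2 0 1] X012 by (simp add: mult_ac)
  qed

  define E where "E p = bracket (X (fst p)) (bracket (X (fst p)) (X (snd p)))" for p
  define m where "m p = l (fst p) * l (fst p) * l (snd p)" for p
  let ?I = "{(0, 1), (0, 2), (1, 0), (1, 2), (2, 0), (2, 1)} :: (nat \<times> nat) set"
  have T_E: "T (E p) = scale (m p) (E p)" for p unfolding E_def m_def by (rule trip)
  have E_L2: "E p \<in> L\<^sub>2" for p unfolding E_def using bracket_L2(1) bracket_L1 by blast
  have E_eq: "E (0, 1) = bracket u (bracket u v)" "E (0, 2) = bracket u (bracket u w)"
    "E (1, 0) = bracket v (bracket v u)" "E (1, 2) = bracket v (bracket v w)"
    "E (2, 0) = bracket w (bracket w u)" "E (2, 1) = bracket w (bracket w v)"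
    by (simp_all add: E_def X_def)
  have skew: "bracket x (bracket y z) = - bracket x (bracket z y)" for x y z
    using bracket_skew[of y z] bracket_scale_right[of x "-1"] by simp
  have L2: "L\<^sub>2 \<subseteq> span (E ` ?I)"
  proof -
    have in_E: "bracket x y \<in> span (E ` ?I)" if "x \<in> ?X \<union> L\<^sub>1" "y \<in> ?W \<union> L\<^sub>2" for x y
    proof (cases "x \<in> L\<^sub>1 \<or> y \<in> L\<^sub>2")
      case True
      then have "bracket x y = 0" using that bracket_L1_L1 bracket_L1 bracket_L3 by auto
      then show ?thesis by (simp add: span_zero)
    next
      case False
      then have xy: "x \<in> ?X" "y \<in> ?W" using that by auto
      have "bracket x y \<in> E ` ?I \<or> - bracket x y \<in> E ` ?I \<or> bracket x y = 0"
        using xy E_eq mixed skew[of u w u] skew[of v u v] skew[of w v w] by auto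
      then show ?thesis
        using span_base[of _ "E ` ?I"] span_neg[of "- bracket x y" "E ` ?I"] span_zero
        by (metis minus_minus)
    qed
    have "{bracket x y |x y. y \<in> L\<^sub>1} \<subseteq> span (E ` ?I)"
      using bracket_in_span[of "?X \<union> L\<^sub>1" "?W \<union> L\<^sub>2" "E ` ?I", OF in_E] W unfolding gen by blast
    then have "span {bracket x y |x y. y \<in> L\<^sub>1} \<subseteq> span (E ` ?I)"
      by (rule span_minimal) (rule subspace_span)
    then show ?thesis by (simp add: lower_central.simps(2)[of 1, simplified] numeral_2_eq_2)
  qed

  define N where "N = {p \<in> ?I. E p \<noteq> 0}"
  have N: "N \<subseteq> ?I" "finite N" by (auto simp: N_def intro: finite_subset[of _ ?I])
  have nz: "a \<noteq> 0" "b \<noteq> 0" "c \<noteq> 0" using abc(1) by auto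
  have sq: "x * x \<noteq> y * y" if "x \<noteq> y" "x \<noteq> - y" for x y :: complex
    using that by (simp add: square_eq_iff)
  \<comment> \<open>If x^2 = y z, then x y z = x^3, so the absolute value of x would be 1.\<close>
  have cub: "x * x \<noteq> y * z" if "cmod (x * y * z) = 1" "cmod x \<noteq> 1" for x y z
  proof
    assume "x * x = y * z"
    then have "x * y * z = x ^ 3" by (simp add: power3_eq_cube mult.assoc)
    then have "cmod x ^ 3 = 1 ^ 3" using that(1) by (simp add: norm_power)
    then show False using that(2) power_eq_iff_eq_base[of 3 "cmod x" 1] by simp
  qed
  have m_eq: "m (0, 1) = a * a * b" "m (0, 2) = a * a * c" "m (1, 0) = b * b * a"
    "m (1, 2) = b * b * c" "m (2, 0) = c * c * a" "m (2, 1) = c * c * b"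
    by (simp_all add: m_def l_def)
  have cubs: "a * a \<noteq> b * c" "b * b \<noteq> a * c" "c * c \<noteq> a * b"
    using cub[of a b c] cub[of b a c] cub[of c a b] abc(1-4) by (simp_all add: norm_mult mult_ac)
  have sqs: "a * a \<noteq> b * b" "b * b \<noteq> c * c" "a * a \<noteq> c * c" using sq abc by blast+
  \<comment> \<open>After cancelling common factors, a coincidence of two of the six eigenvalues
    equates two of a, b, c, or two of their squares, or one square with the product of the other
    two.\<close>
  have m_ne:
    "a * a * b \<noteq> a * a * c" "a * a * b \<noteq> b * b * a" "a * a * b \<noteq> b * b * c"
    "a * a * b \<noteq> c * c * a" "a * a * b \<noteq> c * c * b" "a * a * c \<noteq> b * b * a"
    "a * a * c \<noteq> b * b * c" "a * a * c \<noteq> c * c * a" "a * a * c \<noteq> c * c * b"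
    "b * b * a \<noteq> b * b * c" "b * b * a \<noteq> c * c * a" "b * b * a \<noteq> c * c * b"
    "b * b * c \<noteq> c * c * a" "b * b * c \<noteq> c * c * b" "c * c * a \<noteq> c * c * b"
    using nz abc(5-7) cubs cubs[symmetric] sqs by (simp_all add: mult_ac)
  have "distinct (map m [(0, 1), (0, 2), (1, 0), (1, 2), (2, 0), (2, 1)])"
    by (simp only: list.map distinct.simps list.set insert_iff empty_iff m_eq m_ne simp_thms)
  then have inj: "inj_on m ?I" by (simp only: distinct_map list.set)
  \<comment> \<open>The nonzero triple brackets are eigenvectors for distinct eigenvalues, hence a
    basis of the 3-dimensional last term. Counting them gives \<open>card N = 3\<close>.\<close>
  have "indep_mod {0} N E"
  proof (rule indep_mod_eigenvectors[where m = m, OF subspace_single_0 T_linear])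
    show "T w \<in> {0}" if "w \<in> {0}" for w using that T_scale[of 0 0] by simp
    show "T (E p) - scale (m p) (E p) \<in> {0}" for p unfolding T_E by simp
    show "E p \<notin> {0}" if "p \<in> N" for p using that unfolding N_def by blast
    show "inj_on m N" by (rule inj_on_subset[OF inj N(1)])
  qed (rule N(2))
  then have "dim (E ` N \<union> {0}) = card N"
    using dim_span_indep_mod[OF subspace_single_0 N(2), of E] by simp
  moreover have "span (E ` N \<union> {0}) = L\<^sub>2"
  proof
    show "span (E ` N \<union> {0}) \<subseteq> L\<^sub>2"
      using E_L2 subspace_0[OF subspace_lower_central] by (intro span_minimal subspace_lower_central) auto
    have "E ` ?I \<subseteq> span (E ` N \<union> {0})"
    proof (rule image_subsetI)
      fix p assume "p \<in> ?I"
      then have "E p \<in> E ` N \<union> {0}" unfolding N_def by blast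
      then show "E p \<in> span (E ` N \<union> {0})" by (rule span_base)
    qed
    then have "span (E ` ?I) \<subseteq> span (E ` N \<union> {0})" by (rule span_minimal) (rule subspace_span)
    then show "L\<^sub>2 \<subseteq> span (E ` N \<union> {0})" using L2 by blast
  qed
  ultimately have card_N: "card N = 3" using dims(3) dim_span by metis

  \<comment> \<open>Logarithms turn conditions on absolute values of products into linear
    relations.\<close>
  define \<alpha> where "\<alpha> i = ln (cmod (l i))" for i
  have l_nz: "cmod (l i) > 0" for i using nz by (simp add: l_def)
  have ln_m: "ln (cmod (m p)) = 2 * \<alpha> (fst p) + \<alpha> (snd p)" for p
    using l_nz[of "fst p"] l_nz[of "snd p"] by (simp add: m_def \<alpha>_def norm_mult ln_mult)
  have m_pos: "cmod (m p) > 0" for p using l_nz by (simp add: m_def norm_mult)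
  have "N = {(0, 1), (1, 2), (2, 0)} \<or> N = {(1, 0), (2, 1), (0, 2)}"
  proof (rule triangle_of_weights[OF _ N(1) card_N])
    have "ln (cmod (l 0) * cmod (l 1) * cmod (l 2)) = \<alpha> 0 + \<alpha> 1 + \<alpha> 2"
      using l_nz[of 0] l_nz[of 1] l_nz[of 2] by (simp add: \<alpha>_def ln_mult)
    then show "\<alpha> 0 + \<alpha> 1 + \<alpha> 2 = 0" using abc(1) X012 by (simp add: norm_mult)
    show "2 * \<alpha> i + \<alpha> j \<noteq> 0" if "(i, j) \<in> N" for i j
    proof
      assume "2 * \<alpha> i + \<alpha> j = 0"
      then have "ln (cmod (m (i, j))) = 0" by (simp add: ln_m)
      then have "cmod (m (i, j)) = 1" using m_pos[of "(i, j)"] by simp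
      then show False using eigenvector_not_unit[OF _ T_E[of "(i, j)"]] that by (auto simp: N_def)
    qed
    \<comment> \<open>The last term is a rational invariant subspace with three distinct
      eigenvalues, so their product has absolute value 1.\<close>
    obtain p q r where pqr: "N = {p, q, r}" "p \<noteq> q" "q \<noteq> r" "p \<noteq> r"
      using card_N by (auto simp: card_3_iff)
    have in_N: "p \<in> N" "q \<in> N" "r \<in> N" unfolding pqr(1) by simp_all
    note inj_N = inj_on_eq_iff[OF inj_on_subset[OF inj N(1)]]
    have "m p \<noteq> m q" "m q \<noteq> m r" "m p \<noteq> m r"
      unfolding inj_N[OF in_N(1,2)] inj_N[OF in_N(2,3)] inj_N[OF in_N(1,3)] by (fact pqr)+
    moreover have "E p \<noteq> 0" "E q \<noteq> 0" "E r \<noteq> 0" using in_N unfolding N_def by blast+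
    ultimately have "cmod (m p * m q * m r) = 1"
      by (intro invariant_subspace_eigenvalues[OF rat(1,2) _ dims(3) E_L2 E_L2 E_L2 _ _ _ T_E T_E T_E]
          T_lower_central)
    then have "ln (cmod (m p) * cmod (m q) * cmod (m r)) = 0" by (simp add: norm_mult)
    then have "ln (cmod (m p)) + ln (cmod (m q)) + ln (cmod (m r)) = 0"
      using m_pos[of p] m_pos[of q] m_pos[of r] by (simp add: ln_mult)
    then show "(\<Sum>(i, j)\<in>N. 2 * \<alpha> i + \<alpha> j) = 0"
      using pqr by (simp add: ln_m case_prod_beta)
  qed
  moreover have E_0: "E p = 0" if "p \<in> ?I" "p \<notin> N" for p using that unfolding N_def by blast
  ultimately consider "E (0, 2) = 0" "E (1, 0) = 0" "E (2, 1) = 0" | "E (0, 1) = 0" "E (1, 2) = 0" "E (2, 0) = 0"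
  proof (elim disjE, goal_cases)
    case 1
    have "E (0, 2) = 0" "E (1, 0) = 0" "E (2, 1) = 0" by (rule E_0; simp add: 1(4))+
    then show ?thesis by (rule 1(1))
  next
    case 2
    have "E (0, 1) = 0" "E (1, 2) = 0" "E (2, 0) = 0" by (rule E_0; simp add: 2(4))+
    then show ?thesis by (rule 2(2))
  qed
  then show ?thesis
  proof cases
    case 1
    have "E ` ?I \<subseteq> span {E (0, 1), E (1, 2), E (2, 0)}"
      using 1 by (auto simp: span_zero intro: span_base)
    then have "L\<^sub>2 \<subseteq> span {E (0, 1), E (1, 2), E (2, 0)}"
      using L2 span_minimal[OF _ subspace_span] by blast
    then show ?thesis
      using that[of u v w] gen W mixed 1 unfolding E_eq
      by (simp add: skew[of v u v] skew[of w v w] skew[of u w u])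
  next
    case 2
    have "E ` ?I \<subseteq> span {E (1, 0), E (0, 2), E (2, 1)}"
      using 2 by (auto simp: span_zero intro: span_base)
    then have L2': "L\<^sub>2 \<subseteq> span {E (1, 0), E (0, 2), E (2, 1)}"
      using L2 span_minimal[OF _ subspace_span] by blast
    \<comment> \<open>Exchanging \<open>u\<close> and \<open>v\<close> carries the second triangle
      to the first; the brackets change at most by a sign.\<close>
    let ?W' = "{bracket v u, bracket u w, bracket w v}"
    have "?W \<union> L\<^sub>2 \<subseteq> span (?W' \<union> L\<^sub>2)"
      using bracket_skew[of u v] bracket_skew[of v w] bracket_skew[of w u]
      by (auto intro!: span_neg intro: span_base)
    then have W': "L\<^sub>1 \<subseteq> span (?W' \<union> L\<^sub>2)"
      using W span_minimal[OF _ subspace_span] by blast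
    have "span ({v, u, w} \<union> L\<^sub>1) = UNIV" using gen by (simp add: insert_commute)
    then show ?thesis
      using that[of v u w] W' L2' mixed 2 unfolding E_eq
      by (simp add: skew[of u v u] skew[of v w v] skew[of w u w] skew[of u w v] skew[of v u w] skew[of w v u])
  qed
qed

end

section \<open>The triangle algebra\<close>

no_notation Matrix.vec_index (infixl "$" 100)

lemma UNIV_9: "(UNIV :: 9 set) = {0, 1, 2, 3, 4, 5, 6, 7, 8}"
proof -
  have "card {0, 1, 2, 3, 4, 5, 6, 7, 8 :: 9} = CARD(9)" by simp
  then show ?thesis using card_subset_eq[of "UNIV :: 9 set" "{0, 1, 2, 3, 4, 5, 6, 7, 8}"] by simp
qed

lemma forall_9: "(\<forall>i :: 9. P i) \<longleftrightarrow> P 0 \<and> P 1 \<and> P 2 \<and> P 3 \<and> P 4 \<and> P 5 \<and> P 6 \<and> P 7 \<and> P 8"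
proof -
  have "(\<forall>i :: 9. P i) \<longleftrightarrow> (\<forall>i \<in> {0, 1, 2, 3, 4, 5, 6, 7, 8 :: 9}. P i)" unfolding UNIV_9[symmetric] by simp
  then show ?thesis by simp
qed

lemma vector_9_eq_iff:
  fixes p q :: "'a ^ 9"
  shows "p = q \<longleftrightarrow> p $ 0 = q $ 0 \<and> p $ 1 = q $ 1 \<and> p $ 2 = q $ 2 \<and> p $ 3 = q $ 3 \<and> p $ 4 = q $ 4
    \<and> p $ 5 = q $ 5 \<and> p $ 6 = q $ 6 \<and> p $ 7 = q $ 7 \<and> p $ 8 = q $ 8"
  unfolding Finite_Cartesian_Product.vec_eq_iff forall_9 ..

text \<open>Coordinates 0-2 are those of generators \<open>x\<^sub>0, x\<^sub>1, x\<^sub>2\<close>, coordinates 3-5 those of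
  \<open>w\<^sub>i = [x\<^sub>i, x\<^sub>i\<^sub>+\<^sub>1]\<close> and coordinates 6-8 those of \<open>u\<^sub>i = [x\<^sub>i, w\<^sub>i]\<close>, indices modulo 3.\<close>

definition model_bracket :: "complex ^ 9 \<Rightarrow> complex ^ 9 \<Rightarrow> complex ^ 9" where
  "model_bracket p q = (\<chi> i.
     if i = 3 then p $ 0 * q $ 1 - p $ 1 * q $ 0
     else if i = 4 then p $ 1 * q $ 2 - p $ 2 * q $ 1
     else if i = 5 then p $ 2 * q $ 0 - p $ 0 * q $ 2
     else if i = 6 then p $ 0 * q $ 3 - p $ 3 * q $ 0
     else if i = 7 then p $ 1 * q $ 4 - p $ 4 * q $ 1
     else if i = 8 then p $ 2 * q $ 5 - p $ 5 * q $ 2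
     else 0)"

lemma model_bracket_nth [simp]:
  "model_bracket p q $ 0 = 0" "model_bracket p q $ 1 = 0" "model_bracket p q $ 2 = 0"
  "model_bracket p q $ 3 = p $ 0 * q $ 1 - p $ 1 * q $ 0"
  "model_bracket p q $ 4 = p $ 1 * q $ 2 - p $ 2 * q $ 1"
  "model_bracket p q $ 5 = p $ 2 * q $ 0 - p $ 0 * q $ 2"
  "model_bracket p q $ 6 = p $ 0 * q $ 3 - p $ 3 * q $ 0"
  "model_bracket p q $ 7 = p $ 1 * q $ 4 - p $ 4 * q $ 1"
  "model_bracket p q $ 8 = p $ 2 * q $ 5 - p $ 5 * q $ 2"
  by (simp_all add: model_bracket_def)

lemma vector_space_vec: "vector_space ((*s) :: 'a::field \<Rightarrow> 'a ^ 'n \<Rightarrow> 'a ^ 'n)"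
  by unfold_locales (auto simp: Finite_Cartesian_Product.vec_eq_iff vector_smult_component algebra_simps)

lemma (in vec_space_mod) independent_list_iff:
  assumes "distinct xs" "independent (set xs)" "(\<Sum>i<length xs. scale (c i) (xs ! i)) = 0" "j < length xs"
  shows "c j = 0"
proof -
  define h where "h v = c (THE i. i < length xs \<and> xs ! i = v)" for v
  have h: "h (xs ! i) = c i" if "i < length xs" for i
  proof -
    have "(THE k. k < length xs \<and> xs ! k = xs ! i) = i"
      using that assms(1) by (intro the_equality) (auto simp: nth_eq_iff_index_eq)
    then show ?thesis by (simp add: h_def)
  qed
  have "(\<Sum>v\<in>set xs. scale (h v) v) = (\<Sum>i<length xs. scale (h (xs ! i)) (xs ! i))"
    by (rule sum_set_nth[OF assms(1)])
  also have "\<dots> = 0" using assms(3) by (simp add: h)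
  finally have "h (xs ! j) = 0"
    using independentD[OF assms(2) finite_set subset_refl] nth_mem[OF assms(4)] by blast
  then show ?thesis using h[OF assms(4)] by simp
qed

text \<open>The standard generators and their brackets span, and there are nine of them in dimension
  9. So they form a basis, and no independence has to be derived from the relations.\<close>

lemma (in anosov_333) lie_isomorphic_model:
  "lie_isomorphic (*s) model_bracket scale bracket"
proof -
  obtain x0 x1 x2 where gen: "span ({x0, x1, x2} \<union> L\<^sub>1) = UNIV"
    and L1: "L\<^sub>1 \<subseteq> span ({bracket x0 x1, bracket x1 x2, bracket x2 x0} \<union> L\<^sub>2)"
    and L2: "L\<^sub>2 \<subseteq> span {bracket x0 (bracket x0 x1), bracket x1 (bracket x1 x2), bracket x2 (bracket x2 x0)}"
    and zero: "bracket x0 (bracket x1 x2) = 0" "bracket x1 (bracket x2 x0) = 0" "bracket x2 (bracket x0 x1) = 0"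
    "bracket x1 (bracket x0 x1) = 0" "bracket x2 (bracket x1 x2) = 0" "bracket x0 (bracket x2 x0) = 0"
    by (rule standard_generators)
  define w0 w1 w2 where w: "w0 = bracket x0 x1" "w1 = bracket x1 x2" "w2 = bracket x2 x0"
  define u0 u1 u2 where u: "u0 = bracket x0 w0" "u1 = bracket x1 w1" "u2 = bracket x2 w2"
  define X where "X p = scale (p $ 0) x0 + scale (p $ 1) x1 + scale (p $ 2) x2" for p :: "complex ^ 9"
  define Y where "Y p = scale (p $ 3) w0 + scale (p $ 4) w1 + scale (p $ 5) w2" for p :: "complex ^ 9"
  define Z where "Z p = scale (p $ 6) u0 + scale (p $ 7) u1 + scale (p $ 8) u2" for p :: "complex ^ 9"
  define f where "f p = X p + (Y p + Z p)" for p
  have f_add: "f (p + q) = f p + f q" for p q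
    by (simp add: f_def X_def Y_def Z_def scale_left_distrib algebra_simps)
  have f_scale: "f (c *s p) = scale c (f p)" for c p
    by (simp add: f_def X_def Y_def Z_def vector_smult_component scale_right_distrib)
  have lin: "Vector_Spaces.linear (*s) scale f"
    unfolding Vector_Spaces.linear_iff using vector_space_vec vector_space_axioms f_add f_scale by blast
  interpret f: Vector_Spaces.linear "(*s)" scale f by (rule lin)

  let ?xs = "[x0, x1, x2, w0, w1, w2, u0, u1, u2]"
  have span_xs: "span (set ?xs) = UNIV"
  proof -
    let ?S = "span (set ?xs)"
    have "L\<^sub>2 \<subseteq> ?S" using L2 span_mono[of "{u0, u1, u2}" "set ?xs"] unfolding w[symmetric] u[symmetric] by auto
    then have "{w0, w1, w2} \<union> L\<^sub>2 \<subseteq> ?S" by (auto intro: span_base)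
    then have "span ({w0, w1, w2} \<union> L\<^sub>2) \<subseteq> ?S" by (rule span_minimal) (rule subspace_span)
    then have "L\<^sub>1 \<subseteq> ?S" using L1 unfolding w[symmetric] by blast
    then have "{x0, x1, x2} \<union> L\<^sub>1 \<subseteq> ?S" by (auto intro: span_base)
    then have "span ({x0, x1, x2} \<union> L\<^sub>1) \<subseteq> ?S" by (rule span_minimal) (rule subspace_span)
    then show ?thesis using gen by auto
  qed
  \<comment> \<open>A spanning list of length 9 in a space of dimension 9 has no repetitions and is
    independent.\<close>
  have card_xs: "card (set ?xs) \<le> 9" using card_length[of ?xs] by simp
  have "dim UNIV \<le> card (set ?xs)" by (rule dim_le_card) (use span_xs in auto)
  then have card9: "card (set ?xs) = 9" using card_xs dims(1) by simp
  have dist: "distinct ?xs" by (rule card_distinct) (use card9 in simp)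
  have ind: "independent (set ?xs)"
    by (rule card_le_dim_spanning[of _ UNIV]) (use span_xs card9 dims(1) in auto)
  have f_nth: "f p = (\<Sum>i<length ?xs. scale ([p $ 0, p $ 1, p $ 2, p $ 3, p $ 4, p $ 5, p $ 6, p $ 7, p $ 8] ! i) (?xs ! i))"
    for p by (simp add: f_def X_def Y_def Z_def lessThan_Suc eval_nat_numeral add_ac)
  have ker: "p = 0" if "f p = 0" for p
  proof -
    let ?c = "\<lambda>i. [p $ 0, p $ 1, p $ 2, p $ 3, p $ 4, p $ 5, p $ 6, p $ 7, p $ 8] ! i"
    have "?c j = 0" if "j < length ?xs" for j
      using independent_list_iff[OF dist ind _ that, of ?c] f_nth[of p] \<open>f p = 0\<close> by simp
    from this[of 0] this[of 1] this[of 2] this[of 3] this[of 4] this[of 5] this[of 6] this[of 7] this[of 8]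
    show ?thesis by (simp add: vector_9_eq_iff)
  qed
  have "inj f"
  proof (rule injI)
    fix p q assume "f p = f q"
    then have "f (p - q) = 0" by (simp add: f.diff)
    then show "p = q" using ker by force
  qed
  moreover have "surj f"
  proof -
    have "set ?xs \<subseteq> range f"
    proof -
      have "f (axis 0 1) = x0" "f (axis 1 1) = x1" "f (axis 2 1) = x2" "f (axis 3 1) = w0" "f (axis 4 1) = w1"
        "f (axis 5 1) = w2" "f (axis 6 1) = u0" "f (axis 7 1) = u1" "f (axis 8 1) = u2"
        by (simp_all add: f_def X_def Y_def Z_def axis_def)
      then show ?thesis by (auto intro: range_eqI[OF sym])
    qed
    then have "span (set ?xs) \<subseteq> range f"
      by (intro span_minimal f.subspace_image f.vs1.subspace_UNIV)
    then show ?thesis using span_xs by auto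
  qed
  moreover have "f (model_bracket p q) = bracket (f p) (f q)" for p q
  proof -
    have w_L1: "w0 \<in> L\<^sub>1" "w1 \<in> L\<^sub>1" "w2 \<in> L\<^sub>1" unfolding w by (rule bracket_L1)+
    have u_L2: "u0 \<in> L\<^sub>2" "u1 \<in> L\<^sub>2" "u2 \<in> L\<^sub>2" unfolding u using w_L1 bracket_L2(1) by blast+
    note sub = subspace_add[OF subspace_lower_central] subspace_scale[OF subspace_lower_central]
    have Y: "Y p \<in> L\<^sub>1" for p unfolding Y_def by (intro sub w_L1)
    have Z: "Z p \<in> L\<^sub>2" for p unfolding Z_def by (intro sub u_L2)
    note expand = bracket_add_left bracket_add_right bracket_scale_left bracket_scale_right
    \<comment> \<open>Only degrees 1 with 1 and 1 with 2 contribute: the parts \<open>Y\<close>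
      commute with each other, and the parts \<open>Z\<close> are central.\<close>
    have "bracket (f p) (f q) = bracket (X p) (X q) + (bracket (X p) (Y q) - bracket (X q) (Y p))"
      unfolding f_def using bracket_L1_L1[OF Y Y] bracket_L3[OF Z] bracket_skew[of "Y p" "X q"]
      by (simp add: bracket_add_left bracket_add_right)
    also have "bracket (X p) (X q) = scale (p $ 0 * q $ 1 - p $ 1 * q $ 0) w0
        + scale (p $ 1 * q $ 2 - p $ 2 * q $ 1) w1 + scale (p $ 2 * q $ 0 - p $ 0 * q $ 2) w2"
      using bracket_skew[of x1 x0] bracket_skew[of x2 x1] bracket_skew[of x0 x2]
      by (simp add: X_def expand bracket_alternating w scale_left_diff_distrib algebra_simps)
    also have XY: "bracket (X p) (Y q) = scale (p $ 0 * q $ 3) u0 + scale (p $ 1 * q $ 4) u1 + scale (p $ 2 * q $ 5) u2" for p q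
      using zero by (simp add: X_def Y_def expand mult.commute u flip: w)
    finally show ?thesis
      unfolding XY by (simp add: f_def X_def Y_def Z_def scale_left_diff_distrib algebra_simps)
  qed
  ultimately show ?thesis
    unfolding lie_isomorphic_def bij_def using lin by blast
qed

text \<open>The two algebras may have different carrier types. Both are compared with the model,
  through the inverse of one isomorphism followed by the other.\<close>

lemma lie_isomorphic_common_source:
  assumes f: "lie_isomorphic s\<^sub>0 b\<^sub>0 s b" and g: "lie_isomorphic s\<^sub>0 b\<^sub>0 s' b'"
  shows "lie_isomorphic s b s' b'"
proof -
  obtain f g where f: "Vector_Spaces.linear s\<^sub>0 s f" "bij f" "\<And>x y. f (b\<^sub>0 x y) = b (f x) (f y)"
    and g: "Vector_Spaces.linear s\<^sub>0 s' g" "bij g" "\<And>x y. g (b\<^sub>0 x y) = b' (g x) (g y)"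
    using assms unfolding lie_isomorphic_def by blast
  let ?i = "inv_into UNIV f"
  let ?h = "\<lambda>x. g (?i x)"
  have ff: "f (?i x) = x" "?i (f y) = y" for x y using f(2) by (simp_all add: bij_def surj_f_inv_f)
  have add: "?i (x + y) = ?i x + ?i y" for x y
  proof -
    have "f (?i x + ?i y) = x + y" using f(1) unfolding Vector_Spaces.linear_iff by (simp add: ff)
    then show ?thesis by (metis ff(2))
  qed
  have sc: "?i (s c x) = s\<^sub>0 c (?i x)" for c x
  proof -
    have "f (s\<^sub>0 c (?i x)) = s c x" using f(1) unfolding Vector_Spaces.linear_iff by (simp add: ff)
    then show ?thesis by (metis ff(2))
  qed
  have br: "?i (b x y) = b\<^sub>0 (?i x) (?i y)" for x y
  proof -
    have "f (b\<^sub>0 (?i x) (?i y)) = b x y" by (simp add: f(3) ff)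
    then show ?thesis by (metis ff(2))
  qed
  have "Vector_Spaces.linear s s' ?h"
    using f(1) g(1) unfolding Vector_Spaces.linear_iff by (simp add: add sc)
  moreover have "bij ?h" using bij_comp[OF bij_imp_bij_inv[OF f(2)] g(2)] by (simp add: comp_def)
  moreover have "?h (b x y) = b' (?h x) (?h y)" for x y by (simp add: br g(3))
  ultimately show ?thesis unfolding lie_isomorphic_def by blast
qed

lemma complex_anosov_333_isomorphic_model:
  assumes "complex_anosov_of_type [3, 3, 3] s b"
  shows "lie_isomorphic (*s) model_bracket s b"
proof -
  interpret lie_algebra s b using assms by (simp add: complex_anosov_of_type_def)
  interpret char_0_lie_algebra s b ..
  have type: "has_type [3, 3, 3]" and "anosov" using assms by (simp_all add: complex_anosov_of_type_def)
  then obtain F \<tau> \<beta> A where F: "rational_form F" "rational.automorphism_on F \<tau>" "rational.hyperbolic_on F \<tau>"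
    "rational.ordered_basis_of F \<beta>" "invertible_mat (A :: int mat)" "rational.matrix_wrt \<beta> \<tau> = map_mat of_int A"
    unfolding anosov_def rational.anosov_on_def rational.unimodular_on_def by blast
  obtain B where "finite_dimensional_vector_space s B" by (rule has_type_333_basis[OF type])
  then interpret finite_dimensional_vector_space s B .
  interpret anosov_333 s b B F \<tau> \<beta> A
    by unfold_locales (use F type in auto)
  show ?thesis by (rule lie_isomorphic_model)
qed

section \<open>The triangle algebra is a Lie algebra of type (3, 3, 3)\<close>

lemma model_lie_algebra: "lie_algebra (*s) model_bracket"
proof -
  interpret vector_space "(*s) :: complex \<Rightarrow> complex ^ 9 \<Rightarrow> complex ^ 9" by (rule vector_space_vec)
  show ?thesis
  proof (intro lie_algebra.intro lie_algebra_axioms.intro vector_space_vec)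
    show "Vector_Spaces.linear (*s) (*s) (\<lambda>x. model_bracket x y)" for y
      unfolding Vector_Spaces.linear_iff
      by (intro conjI vector_space_axioms allI) (simp_all add: vector_9_eq_iff vector_smult_component algebra_simps)
    show "Vector_Spaces.linear (*s) (*s) (model_bracket x)" for x
      unfolding Vector_Spaces.linear_iff
      by (intro conjI vector_space_axioms allI) (simp_all add: vector_9_eq_iff vector_smult_component algebra_simps)
    show "model_bracket x x = 0" for x by (simp add: vector_9_eq_iff)
    show "model_bracket x (model_bracket y z) + model_bracket y (model_bracket z x)
        + model_bracket z (model_bracket x y) = 0" for x y z
      by (simp add: vector_9_eq_iff algebra_simps)
  qed
qed

interpretation model: char_0_lie_algebra "(*s)" model_bracket
  unfolding char_0_lie_algebra_def by (rule model_lie_algebra)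

lemma axis_expand:
  fixes p :: "complex ^ 9"
  shows "p = p $ 0 *s axis 0 1 + p $ 1 *s axis 1 1 + p $ 2 *s axis 2 1 + p $ 3 *s axis 3 1 + p $ 4 *s axis 4 1
    + p $ 5 *s axis 5 1 + p $ 6 *s axis 6 1 + p $ 7 *s axis 7 1 + p $ 8 *s axis 8 1"
  by (simp add: vector_9_eq_iff vector_smult_component axis_def)

lemma model_bracket_axis:
  "model_bracket (axis 0 1) (axis 1 1) = axis 3 1" "model_bracket (axis 1 1) (axis 2 1) = axis 4 1"
  "model_bracket (axis 2 1) (axis 0 1) = axis 5 1" "model_bracket (axis 0 1) (axis 3 1) = axis 6 1"
  "model_bracket (axis 1 1) (axis 4 1) = axis 7 1" "model_bracket (axis 2 1) (axis 5 1) = axis 8 1"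
  by (simp_all add: vector_9_eq_iff axis_def)

text \<open>The coordinate axes from 3 on are themselves brackets of coordinate axes, so the lower
  central series consists of coordinate subspaces.\<close>

lemma model_lower_central:
  "model.lower_central 1 = {p. p $ 0 = 0 \<and> p $ 1 = 0 \<and> p $ 2 = 0}" (is "_ = ?S1")
  "model.lower_central 2 = {p. p $ 0 = 0 \<and> p $ 1 = 0 \<and> p $ 2 = 0 \<and> p $ 3 = 0 \<and> p $ 4 = 0 \<and> p $ 5 = 0}" (is "_ = ?S2")
  "model.lower_central 3 = {0}"
proof -
  note [simp] = vector_smult_component and [simp del] = model.lower_central.simps
  have L_Suc: "model.lower_central (Suc i) = model.span {model_bracket x y | x y. y \<in> model.lower_central i}" for i
    by (simp add: model.lower_central.simps)
  have br: "axis k 1 \<in> model.lower_central (Suc i)"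
    if "model_bracket p q = axis k 1" "q \<in> model.lower_central i" for k p q i
    using model.bracket_in_lower_central[OF that(2), of p] that(1) by simp
  note sub = model.subspace_add[OF model.subspace_lower_central] model.subspace_scale[OF model.subspace_lower_central]
  show L1: "model.lower_central 1 = ?S1"
  proof
    have "model.subspace ?S1" by (rule model.subspaceI) auto
    then show "model.lower_central 1 \<subseteq> ?S1"
      unfolding One_nat_def L_Suc by (intro model.span_minimal) auto
    have ax: "axis 3 1 \<in> model.lower_central 1" "axis 4 1 \<in> model.lower_central 1" "axis 5 1 \<in> model.lower_central 1"
      "axis 6 1 \<in> model.lower_central 1" "axis 7 1 \<in> model.lower_central 1" "axis 8 1 \<in> model.lower_central 1"
      unfolding One_nat_def by (rule br[OF model_bracket_axis(1)] br[OF model_bracket_axis(2)] br[OF model_bracket_axis(3)]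
        br[OF model_bracket_axis(4)] br[OF model_bracket_axis(5)] br[OF model_bracket_axis(6)];
        simp add: model.lower_central.simps(1))+
    show "?S1 \<subseteq> model.lower_central 1"
    proof
      fix p assume "p \<in> ?S1"
      then have "p = p $ 3 *s axis 3 1 + p $ 4 *s axis 4 1 + p $ 5 *s axis 5 1 + p $ 6 *s axis 6 1
          + p $ 7 *s axis 7 1 + p $ 8 *s axis 8 1"
        using axis_expand[of p] by simp
      also have "\<dots> \<in> model.lower_central 1" by (intro sub ax)
      finally show "p \<in> model.lower_central 1" .
    qed
  qed
  show L2: "model.lower_central 2 = ?S2"
  proof
    have "model.subspace ?S2" by (rule model.subspaceI) auto
    then show "model.lower_central 2 \<subseteq> ?S2"
      unfolding numeral_2_eq_2 L_Suc[of "Suc 0"] L1[unfolded One_nat_def] by (intro model.span_minimal) auto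
    have "axis 3 1 \<in> model.lower_central 1" "axis 4 1 \<in> model.lower_central 1" "axis 5 1 \<in> model.lower_central 1"
      unfolding L1 by (simp_all add: axis_def)
    then have ax: "axis 6 1 \<in> model.lower_central 2" "axis 7 1 \<in> model.lower_central 2" "axis 8 1 \<in> model.lower_central 2"
      using br[OF model_bracket_axis(4), of 1] br[OF model_bracket_axis(5), of 1] br[OF model_bracket_axis(6), of 1]
      by (simp_all add: numeral_2_eq_2)
    show "?S2 \<subseteq> model.lower_central 2"
    proof
      fix p assume "p \<in> ?S2"
      then have "p = p $ 6 *s axis 6 1 + p $ 7 *s axis 7 1 + p $ 8 *s axis 8 1"
        using axis_expand[of p] by simp
      also have "\<dots> \<in> model.lower_central 2" by (intro sub ax)
      finally show "p \<in> model.lower_central 2" .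
    qed
  qed
  have "{model_bracket x y | x y. y \<in> model.lower_central 2} \<subseteq> {0}"
    unfolding L2 by (auto simp: vector_9_eq_iff)
  then have "model.lower_central (Suc 2) \<subseteq> {0}"
    unfolding L_Suc by (intro model.span_minimal model.subspace_single_0)
  then show "model.lower_central 3 = {0}"
    using model.subspace_0[OF model.subspace_lower_central, of 3] by (auto simp: eval_nat_numeral)
qed

lemma model_has_type: "model.has_type [3, 3, 3]"
proof -
  note [simp] = vector_smult_component axis_def and [simp del] = model.lower_central.simps
  \<comment> \<open>All three quotients have the classes of three coordinate axes as a basis, so one
    criterion covers them.\<close>
  have q: "model.quotient_has_dim V W 3"
    if B: "axis i 1 \<in> V" "axis j 1 \<in> V" "axis k 1 \<in> V" and ne: "i \<noteq> j" "j \<noteq> k" "i \<noteq> k"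
      and ind: "\<And>a b c. a *s axis i 1 + b *s axis j 1 + c *s axis k 1 \<in> W \<Longrightarrow> a = 0 \<and> b = 0 \<and> c = 0"
      and sp: "\<And>v. v \<in> V \<Longrightarrow> v - (v $ i *s axis i 1 + v $ j *s axis j 1 + v $ k *s axis k 1) \<in> W"
    for V W and i j k :: 9
  proof -
    let ?B = "{axis i 1, axis j 1, axis k (1 :: complex)}"
    have neq: "axis i 1 \<noteq> axis j (1 :: complex)" "axis j 1 \<noteq> axis k (1 :: complex)" "axis i 1 \<noteq> axis k (1 :: complex)"
      using ne by (simp_all add: axis_eq_axis del: axis_def)
    have s: "(\<Sum>b\<in>?B. c b *s b) = c (axis i 1) *s axis i 1 + c (axis j 1) *s axis j 1 + c (axis k 1) *s axis k 1"
      for c :: "complex ^ 9 \<Rightarrow> complex"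
      using neq by (simp add: add.assoc del: axis_def)
    show ?thesis
      unfolding model.quotient_has_dim_def
    proof (intro exI[of _ ?B] conjI ballI allI impI)
      show "?B \<subseteq> V" using B by simp
      show "card ?B = 3" using neq by simp
      show "c b = 0" if "(\<Sum>b\<in>?B. c b *s b) \<in> W" "b \<in> ?B" for c b
        using ind[of "c (axis i 1)" "c (axis j 1)" "c (axis k 1)"] that unfolding s by auto
      show "\<exists>c. v - (\<Sum>b\<in>?B. c b *s b) \<in> W" if "v \<in> V" for v
      proof -
        define c where "c b = (if b = axis i 1 then v $ i else if b = axis j 1 then v $ j else v $ k)" for b :: "complex ^ 9"
        have "c (axis i 1) = v $ i" "c (axis j 1) = v $ j" "c (axis k 1) = v $ k"
          unfolding c_def using neq neq[symmetric] by (simp_all only: if_True if_False refl)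
        then show ?thesis unfolding s using sp[OF that] by (intro exI[of _ c]) (simp only:)
      qed
    qed simp
  qed
  have "model.quotient_has_dim (model.lower_central 0) (model.lower_central 1) 3"
    by (rule q[of 0 _ 1 2]) (simp_all add: model_lower_central(1)[unfolded One_nat_def] model.lower_central.simps(1))
  moreover have "model.quotient_has_dim (model.lower_central 1) (model.lower_central 2) 3"
    by (rule q[of 3 _ 4 5]) (simp_all add: model_lower_central(1)[unfolded One_nat_def] model_lower_central(2))
  moreover have "model.quotient_has_dim (model.lower_central 2) (model.lower_central 3) 3"
    by (rule q[of 6 _ 7 8]) (auto simp add: model_lower_central(2,3) vector_9_eq_iff)
  moreover have "axis 6 1 \<in> model.lower_central 2" "axis 6 1 \<noteq> (0 :: complex ^ 9)"
    by (simp_all add: model_lower_central(2) vector_9_eq_iff)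
  then have "model.lower_central 2 \<noteq> {0}" by blast
  moreover note model_lower_central(3)
  moreover have "(\<forall>i<length [3, 3, 3 :: nat]. P i) \<longleftrightarrow> P 0 \<and> P 1 \<and> P 2" for P
    by (auto simp: less_Suc_eq eval_nat_numeral)
  ultimately show ?thesis
    unfolding model.has_type_def by (simp add: eval_nat_numeral)
qed

section \<open>A rational form from a cyclic cubic field\<close>

lemma (in vec_space_mod) representation_list:
  assumes xs: "distinct xs" "independent (set xs)" and j: "j < length xs"
  shows "representation (set xs) (\<Sum>i<length xs. scale (c i) (xs ! i)) (xs ! j) = c j"
proof -
  have "representation (set xs) (\<Sum>i<length xs. scale (c i) (xs ! i)) (xs ! j)
      = (\<Sum>i<length xs. c i * representation (set xs) (xs ! i) (xs ! j))"
  proof -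
    have in_span: "scale (c i) (xs ! i) \<in> span (set xs)" "xs ! i \<in> span (set xs)" if "i \<in> {..<length xs}" for i
      using that by (auto intro!: span_scale intro: span_base)
    have "representation (set xs) (\<Sum>i<length xs. scale (c i) (xs ! i))
        = (\<lambda>b. \<Sum>i<length xs. representation (set xs) (scale (c i) (xs ! i)) b)"
      by (rule representation_sum[OF xs(2)]) (rule in_span(1))
    moreover have "(\<Sum>i<length xs. representation (set xs) (scale (c i) (xs ! i)) (xs ! j))
        = (\<Sum>i<length xs. c i * representation (set xs) (xs ! i) (xs ! j))"
      by (intro sum.cong refl) (simp only: representation_scale[OF xs(2) in_span(2)])
    ultimately show ?thesis by simp
  qed
  also have "\<dots> = (\<Sum>i<length xs. if i = j then c i else 0)"
    using xs(1) j by (intro sum.cong refl) (auto simp: representation_basis[OF xs(2)] nth_eq_iff_index_eq)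
  also have "\<dots> = c j" using j by simp
  finally show ?thesis .
qed

lemma (in char_0_lie_algebra) rational_independent:
  assumes "independent S"
  shows "rational.independent S"
proof
  assume "rational.dependent S"
  then obtain a where "a \<in> S" "a \<in> rational.span (S - {a})" unfolding rational.dependent_def by blast
  then have "a \<in> span (S - {a})" using rational_span_subset by blast
  then show False using assms \<open>a \<in> S\<close> unfolding dependent_def by blast
qed

text \<open>A polynomial of degree at most 2 with three distinct zeros vanishes; divided differences
  isolate its coefficients one after the other.\<close>

lemma quadratic_eq_0:
  fixes x y z :: "'a::field"
  assumes "c0 + c1 * x + c2 * (x * x) = 0" "c0 + c1 * y + c2 * (y * y) = 0" "c0 + c1 * z + c2 * (z * z) = 0"
    and ne: "x \<noteq> y" "y \<noteq> z" "x \<noteq> z"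
  shows "c0 = 0 \<and> c1 = 0 \<and> c2 = 0"
proof -
  have d: "(x - t) * (c1 + c2 * (x + t)) = (c0 + c1 * x + c2 * (x * x)) - (c0 + c1 * t + c2 * (t * t))" for t
    by (simp add: algebra_simps)
  have e: "c1 + c2 * (x + y) = 0" "c1 + c2 * (x + z) = 0"
    using d[of y] d[of z] ne unfolding assms(1-3) by simp_all
  have "c2 * (y - z) = (c1 + c2 * (x + y)) - (c1 + c2 * (x + z))" by (simp add: algebra_simps)
  then have "c2 = 0" using ne unfolding e by simp
  then show ?thesis using e assms(1) by simp
qed

text \<open>Newton interpolation, with the first and second divided differences \<open>d\<close> and
  \<open>e\<close>.\<close>

lemma quadratic_interpolation:
  fixes x y z :: "'a::field"
  assumes ne: "x \<noteq> y" "y \<noteq> z" "x \<noteq> z"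
  shows "\<exists>c0 c1 c2. a = c0 + c1 * x + c2 * (x * x) \<and> b = c0 + c1 * y + c2 * (y * y) \<and> c = c0 + c1 * z + c2 * (z * z)"
proof -
  define d where "d = (b - a) / (y - x)"
  define e where "e = ((c - a) / (z - x) - d) / (z - y)"
  have b: "b = a + d * (y - x)" using ne by (simp add: d_def)
  have "(e * (z - y) + d) * (z - x) = c - a" using ne by (simp add: e_def)
  then have c: "c = a + (e * (z - y) + d) * (z - x)" by simp
  \<comment> \<open>The coefficients come from expanding
    \<open>a + d * (t - x) + e * (t - x) * (t - y)\<close> in powers of \<open>t\<close>.\<close>
  show ?thesis
    by (rule exI[of _ "a - d * x + e * x * y"], rule exI[of _ "d - e * (x + y)"], rule exI[of _ e])
      (subst b, subst c, simp add: algebra_simps)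
qed

text \<open>\<open>r0, r1, r2\<close> are \<open>2 cos (2 \<pi> k / 7)\<close> for \<open>k = 1, 2, 3\<close>, cyclically permuted by the Galois
  action \<open>r \<mapsto> r\<^sup>2 - 2\<close>.\<close>

lemma cubic_unit_conjugates:
  obtains r0 r1 r2 :: real where
    "r0 * r0 * r0 = 1 + 2 * r0 - r0 * r0" "r1 * r1 * r1 = 1 + 2 * r1 - r1 * r1" "r2 * r2 * r2 = 1 + 2 * r2 - r2 * r2"
    "r1 = r0 * r0 - 2" "r2 = r1 * r1 - 2" "r0 = r2 * r2 - 2"
    "6/5 < r0" "r0 < 13/10" "- 3/5 < r1" "r1 < - 3/10" "- 2 < r2" "r2 < - 8/5"
proof -
  \<comment> \<open>This is the minimal polynomial of 2 cos(2 pi / 7). It is negative at 6/5 and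
    positive at 13/10.\<close>
  let ?f = "\<lambda>t :: real. t * t * t + t * t - 2 * t - 1"
  have "\<exists>t. 6/5 \<le> t \<and> t \<le> 13/10 \<and> ?f t = 0"
    by (rule IVT') (auto intro!: continuous_intros)
  then obtain r where r: "6/5 \<le> r" "r \<le> 13/10" "?f r = 0" by blast
  have c0: "r * r * r = 1 + 2 * r - r * r" using r(3) by simp
  have "?f (6/5) \<noteq> 0" "?f (13/10) \<noteq> 0" by simp_all
  then have ne: "r \<noteq> 6/5" "r \<noteq> 13/10" using r(3) by (metis (no_types))+
  define s where "s = r * r - 2"
  define t where "t = s * s - 2"
  \<comment> \<open>Doubling the angle sends 2 cos t to its square minus 2 and permutes the roots.
    Algebraically, \<open>f (x^2 - 2) = - f x * f (- x)\<close>.\<close>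
  have "(x * x - 2) * (x * x - 2) * (x * x - 2) - (1 + 2 * (x * x - 2) - (x * x - 2) * (x * x - 2))
      = (x * x * x - (1 + 2 * x - x * x)) * (x * x * x - x * x - 2 * x + 1)" for x :: real
    by (simp add: algebra_simps)
  then have cube: "(x * x - 2) * (x * x - 2) * (x * x - 2) = 1 + 2 * (x * x - 2) - (x * x - 2) * (x * x - 2)"
    if "x * x * x = 1 + 2 * x - x * x" for x :: real using that by (metis eq_iff_diff_eq_0 mult_zero_left)
  have c1: "s * s * s = 1 + 2 * s - s * s" unfolding s_def by (rule cube[OF c0])
  have c2: "t * t * t = 1 + 2 * t - t * t" unfolding t_def by (rule cube[OF c1])
  have "s * s - 2 - (1 - r - r * r) = (r * r * r - (1 + 2 * r - r * r)) * (r - 1)"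
    unfolding s_def by (simp add: algebra_simps)
  then have t: "t = 1 - r - r * r" using c0 by (simp add: t_def)
  \<comment> \<open>The third application of the map returns to \<open>r\<close>, so the roots form
    a cycle of length 3.\<close>
  have "(1 - r - r * r) * (1 - r - r * r) - 2 - r = (r * r * r - (1 + 2 * r - r * r)) * (r + 1)"
    by (simp add: algebra_simps)
  then have t0: "r = t * t - 2" unfolding t using c0 by simp
  \<comment> \<open>The bounds separate the three conjugates and later keep the eigenvalues of the
    automorphism away from 1 and -1.\<close>
  have b0: "6/5 < r" "r < 13/10" using r ne by auto
  have "6/5 * (6/5) < r * r" "r * r < 13/10 * (13/10)" using b0 by (intro mult_strict_mono; simp)+
  then have b1: "- 14/25 \<le> s" "s \<le> - 31/100" unfolding s_def by simp_all
  have "31/100 * (31/100) \<le> - s * - s" "- s * - s \<le> 14/25 * (14/25)" using b1 by (intro mult_mono; simp)+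
  then have b2: "- 2 < t" "t < - 8/5" unfolding t_def by simp_all
  show ?thesis
    by (rule that[OF c0 c1 c2 s_def t_def t0 b0 _ _ b2]) (use b1 in simp_all)
qed

section \<open>The cyclic cubic field in its three embeddings\<close>

locale cubic_unit =
  fixes r0 r1 r2 :: real
  assumes cubic: "r0 * r0 * r0 = 1 + 2 * r0 - r0 * r0" "r1 * r1 * r1 = 1 + 2 * r1 - r1 * r1"
    "r2 * r2 * r2 = 1 + 2 * r2 - r2 * r2"
    and galois: "r1 = r0 * r0 - 2" "r2 = r1 * r1 - 2" "r0 = r2 * r2 - 2"
    and bounds: "6/5 < r0" "r0 < 13/10" "- 3/5 < r1" "r1 < - 3/10" "- 2 < r2" "r2 < - 8/5"
begin

abbreviation "l0 \<equiv> complex_of_real r0"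
abbreviation "l1 \<equiv> complex_of_real r1"
abbreviation "l2 \<equiv> complex_of_real r2"

lemma cubic_l: "l0 * l0 * l0 = 1 + 2 * l0 - l0 * l0" "l1 * l1 * l1 = 1 + 2 * l1 - l1 * l1"
  "l2 * l2 * l2 = 1 + 2 * l2 - l2 * l2"
  using arg_cong[OF cubic(1), of complex_of_real] arg_cong[OF cubic(2), of complex_of_real]
    arg_cong[OF cubic(3), of complex_of_real] by simp_all

lemma galois_l: "l1 = l0 * l0 - 2" "l2 = l1 * l1 - 2" "l0 = l2 * l2 - 2"
  using arg_cong[OF galois(1), of complex_of_real] arg_cong[OF galois(2), of complex_of_real]
    arg_cong[OF galois(3), of complex_of_real] by simp_all

lemma distinct_l: "l0 \<noteq> l1" "l1 \<noteq> l2" "l0 \<noteq> l2" using bounds by auto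

text \<open>The image of the cubic field \<open>\<rat>(r0)\<close> under its three embeddings.\<close>

definition K :: "complex \<Rightarrow> complex \<Rightarrow> complex \<Rightarrow> bool" where
  "K a b c \<longleftrightarrow> (\<exists>q0 q1 q2. q0 \<in> \<rat> \<and> q1 \<in> \<rat> \<and> q2 \<in> \<rat> \<and> a = q0 + q1 * l0 + q2 * (l0 * l0)
     \<and> b = q0 + q1 * l1 + q2 * (l1 * l1) \<and> c = q0 + q1 * l2 + q2 * (l2 * l2))"

lemma K_I: "q0 \<in> \<rat> \<Longrightarrow> q1 \<in> \<rat> \<Longrightarrow> q2 \<in> \<rat> \<Longrightarrow> K (q0 + q1 * l0 + q2 * (l0 * l0)) (q0 + q1 * l1 + q2 * (l1 * l1))
    (q0 + q1 * l2 + q2 * (l2 * l2))"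
  unfolding K_def by blast

lemma K_E:
  assumes "K a b c"
  obtains q0 q1 q2 where "q0 \<in> \<rat>" "q1 \<in> \<rat>" "q2 \<in> \<rat>" "a = q0 + q1 * l0 + q2 * (l0 * l0)"
    "b = q0 + q1 * l1 + q2 * (l1 * l1)" "c = q0 + q1 * l2 + q2 * (l2 * l2)"
  using assms unfolding K_def by blast

lemma K_add: assumes "K a b c" "K a' b' c'" shows "K (a + a') (b + b') (c + c')"
proof -
  obtain p q r where 1: "p \<in> \<rat>" "q \<in> \<rat>" "r \<in> \<rat>" "a = p + q * l0 + r * (l0 * l0)"
    "b = p + q * l1 + r * (l1 * l1)" "c = p + q * l2 + r * (l2 * l2)" using K_E[OF assms(1)] .
  obtain p' q' r' where 2: "p' \<in> \<rat>" "q' \<in> \<rat>" "r' \<in> \<rat>" "a' = p' + q' * l0 + r' * (l0 * l0)"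
    "b' = p' + q' * l1 + r' * (l1 * l1)" "c' = p' + q' * l2 + r' * (l2 * l2)" using K_E[OF assms(2)] .
  have "K (p + p' + (q + q') * l0 + (r + r') * (l0 * l0)) (p + p' + (q + q') * l1 + (r + r') * (l1 * l1))
      (p + p' + (q + q') * l2 + (r + r') * (l2 * l2))"
    by (intro K_I Rats_add 1(1-3) 2(1-3))
  then show ?thesis unfolding 1 2 by (simp add: algebra_simps)
qed

lemma K_scale: assumes "K a b c" "s \<in> \<rat>" shows "K (s * a) (s * b) (s * c)"
proof -
  obtain p q r where 1: "p \<in> \<rat>" "q \<in> \<rat>" "r \<in> \<rat>" "a = p + q * l0 + r * (l0 * l0)"
    "b = p + q * l1 + r * (l1 * l1)" "c = p + q * l2 + r * (l2 * l2)" using K_E[OF assms(1)] .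
  have "K (s * p + (s * q) * l0 + (s * r) * (l0 * l0)) (s * p + (s * q) * l1 + (s * r) * (l1 * l1))
      (s * p + (s * q) * l2 + (s * r) * (l2 * l2))"
    by (intro K_I Rats_mult 1(1-3) assms(2))
  then show ?thesis unfolding 1 by (simp add: algebra_simps)
qed

lemma K_diff: assumes "K a b c" "K a' b' c'" shows "K (a - a') (b - b') (c - c')"
  using K_add[OF assms(1) K_scale[OF assms(2), of "-1"]] by simp

lemma K_mult: assumes "K a b c" "K a' b' c'" shows "K (a * a') (b * b') (c * c')"
proof -
  obtain p q r where 1: "p \<in> \<rat>" "q \<in> \<rat>" "r \<in> \<rat>" "a = p + q * l0 + r * (l0 * l0)"
    "b = p + q * l1 + r * (l1 * l1)" "c = p + q * l2 + r * (l2 * l2)" using K_E[OF assms(1)] .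
  obtain p' q' r' where 2: "p' \<in> \<rat>" "q' \<in> \<rat>" "r' \<in> \<rat>" "a' = p' + q' * l0 + r' * (l0 * l0)"
    "b' = p' + q' * l1 + r' * (l1 * l1)" "c' = p' + q' * l2 + r' * (l2 * l2)" using K_E[OF assms(2)] .
  \<comment> \<open>These are the coefficients of the product after reduction by x^3 = 1 + 2x - x^2
    and x^4 = 3x^2 - x - 1.\<close>
  define s0 s1 s2 where s: "s0 = p * p' + (q * r' + r * q') - r * r'"
    "s1 = p * q' + q * p' + (q * r' + r * q') + (q * r' + r * q') - r * r'"
    "s2 = p * r' + q * q' + r * p' - (q * r' + r * q') + (r * r' + r * r' + r * r')"
  have m: "(p + q * x + r * (x * x)) * (p' + q' * x + r' * (x * x)) = s0 + s1 * x + s2 * (x * x)"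
    if "x * x * x = 1 + 2 * x - x * x" for x
  proof -
    have "(p + q * x + r * (x * x)) * (p' + q' * x + r' * (x * x)) = s0 + s1 * x + s2 * (x * x)
        + (x * x * x - (1 + 2 * x - x * x)) * (q * r' + r * q' + r * r' * (x - 1))"
      unfolding s by (simp add: algebra_simps)
    then show ?thesis by (simp add: that)
  qed
  have "s0 \<in> \<rat>" "s1 \<in> \<rat>" "s2 \<in> \<rat>" unfolding s by (intro Rats_add Rats_diff Rats_mult 1(1-3) 2(1-3))+
  then show ?thesis unfolding 1 2 m[OF cubic_l(1)] m[OF cubic_l(2)] m[OF cubic_l(3)] by (rule K_I)
qed

text \<open>A triple in \<open>K\<close> lists the conjugates of one field element, so shifting it
  amounts to applying \<sigma>. The field is normal, hence the result again belongs to
  \<open>K\<close>; this is why brackets mixing neighbouring coordinates preserve the rational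
  form.\<close>

lemma K_shift: assumes "K a b c" shows "K b c a"
proof -
  obtain p q r where 1: "p \<in> \<rat>" "q \<in> \<rat>" "r \<in> \<rat>" "a = p + q * l0 + r * (l0 * l0)"
    "b = p + q * l1 + r * (l1 * l1)" "c = p + q * l2 + r * (l2 * l2)" using K_E[OF assms(1)] .
  \<comment> \<open>Obtained by inserting y = x^2 - 2 and reducing: y^2 = 3 - x - x^2.\<close>
  define s0 s1 s2 where s: "s0 = p - (q + q) + (r + r + r)" "s1 = - r" "s2 = q - r"
  have m: "p + q * y + r * (y * y) = s0 + s1 * x + s2 * (x * x)"
    if "x * x * x = 1 + 2 * x - x * x" "y = x * x - 2" for x y
  proof -
    have "p + q * y + r * (y * y) = s0 + s1 * x + s2 * (x * x)
        + (x * x * x - (1 + 2 * x - x * x)) * (r * (x - 1))"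
      unfolding s that(2) by (simp add: algebra_simps)
    then show ?thesis by (simp add: that(1))
  qed
  have "s0 \<in> \<rat>" "s1 \<in> \<rat>" "s2 \<in> \<rat>" unfolding s using 1(1-3) by simp_all
  then show ?thesis
    unfolding 1 m[OF cubic_l(1) galois_l(1)] m[OF cubic_l(2) galois_l(2)] m[OF cubic_l(3) galois_l(3)] by (rule K_I)
qed

definition F :: "(complex ^ 9) set" where
  "F = {p. K (p $ 0) (p $ 1) (p $ 2) \<and> K (p $ 3) (p $ 4) (p $ 5) \<and> K (p $ 6) (p $ 7) (p $ 8)}"

lemma bracket_F: assumes "p \<in> F" "q \<in> F" shows "model_bracket p q \<in> F"
proof -
  have K0: "K 0 0 0" using K_I[of 0 0 0] by simp
  have p: "K (p $ 0) (p $ 1) (p $ 2)" "K (p $ 3) (p $ 4) (p $ 5)"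
    and q: "K (q $ 0) (q $ 1) (q $ 2)" "K (q $ 3) (q $ 4) (q $ 5)"
    using assms unfolding F_def by auto
  have "K (p $ 0 * q $ 1 - p $ 1 * q $ 0) (p $ 1 * q $ 2 - p $ 2 * q $ 1) (p $ 2 * q $ 0 - p $ 0 * q $ 2)"
    by (intro K_diff K_mult p(1) q(1) K_shift[OF p(1)] K_shift[OF q(1)])
  moreover have "K (p $ 0 * q $ 3 - p $ 3 * q $ 0) (p $ 1 * q $ 4 - p $ 4 * q $ 1) (p $ 2 * q $ 5 - p $ 5 * q $ 2)"
    using p q by (intro K_diff K_mult)
  ultimately show ?thesis using K0 by (simp add: F_def)
qed

lemma subspace_F: "model.rational.subspace F"
proof (rule model.rational.subspaceI)
  show "0 \<in> F" using K_I[of 0 0 0] by (simp add: F_def)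
  show "p + q \<in> F" if "p \<in> F" "q \<in> F" for p q using that by (auto simp: F_def intro: K_add)
  show "model.rational_scale c p \<in> F" if "p \<in> F" for c p
    using that by (auto simp: F_def model.rational_scale_def vector_smult_component intro: K_scale)
qed

section \<open>A basis of the rational form\<close>

definition vx :: "complex \<Rightarrow> complex \<Rightarrow> complex \<Rightarrow> complex ^ 9" where
  "vx a b c = a *s axis 0 1 + b *s axis 1 1 + c *s axis 2 1"
definition vw :: "complex \<Rightarrow> complex \<Rightarrow> complex \<Rightarrow> complex ^ 9" where
  "vw a b c = a *s axis 3 1 + b *s axis 4 1 + c *s axis 5 1"
definition vu :: "complex \<Rightarrow> complex \<Rightarrow> complex \<Rightarrow> complex ^ 9" where
  "vu a b c = a *s axis 6 1 + b *s axis 7 1 + c *s axis 8 1"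

lemmas v_defs = vx_def vw_def vu_def

lemma v_nth [simp]:
  "vx a b c $ 0 = a" "vx a b c $ 1 = b" "vx a b c $ 2 = c" "vx a b c $ 3 = 0" "vx a b c $ 4 = 0"
  "vx a b c $ 5 = 0" "vx a b c $ 6 = 0" "vx a b c $ 7 = 0" "vx a b c $ 8 = 0"
  "vw a b c $ 0 = 0" "vw a b c $ 1 = 0" "vw a b c $ 2 = 0" "vw a b c $ 3 = a" "vw a b c $ 4 = b"
  "vw a b c $ 5 = c" "vw a b c $ 6 = 0" "vw a b c $ 7 = 0" "vw a b c $ 8 = 0"
  "vu a b c $ 0 = 0" "vu a b c $ 1 = 0" "vu a b c $ 2 = 0" "vu a b c $ 3 = 0" "vu a b c $ 4 = 0"
  "vu a b c $ 5 = 0" "vu a b c $ 6 = a" "vu a b c $ 7 = b" "vu a b c $ 8 = c"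
  by (simp_all add: v_defs vector_smult_component axis_def)

text \<open>Each degree contributes the power basis 1, r, r^2 of the ring Z[r], on which a unit of
  this ring acts by an invertible integral matrix.\<close>

definition \<beta> :: "(complex ^ 9) list" where
  "\<beta> = [vx 1 1 1, vx l0 l1 l2, vx (l0 * l0) (l1 * l1) (l2 * l2),
        vw 1 1 1, vw l0 l1 l2, vw (l0 * l0) (l1 * l1) (l2 * l2),
        vu 1 1 1, vu l0 l1 l2, vu (l0 * l0) (l1 * l1) (l2 * l2)]"

lemma length_\<beta> [simp]: "length \<beta> = 9" by (simp add: \<beta>_def)

lemma sum_\<beta>: "(\<Sum>i<9. c i *s \<beta> ! i) = c 0 *s \<beta> ! 0 + c 1 *s \<beta> ! 1 + c 2 *s \<beta> ! 2
    + c 3 *s \<beta> ! 3 + c 4 *s \<beta> ! 4 + c 5 *s \<beta> ! 5 + c 6 *s \<beta> ! 6 + c 7 *s \<beta> ! 7 + c 8 *s \<beta> ! 8"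
  by (simp add: eval_nat_numeral lessThan_Suc add_ac)

lemma \<beta>_nth: "\<beta> ! 0 = vx 1 1 1" "\<beta> ! 1 = vx l0 l1 l2" "\<beta> ! 2 = vx (l0 * l0) (l1 * l1) (l2 * l2)"
  "\<beta> ! 3 = vw 1 1 1" "\<beta> ! 4 = vw l0 l1 l2" "\<beta> ! 5 = vw (l0 * l0) (l1 * l1) (l2 * l2)"
  "\<beta> ! 6 = vu 1 1 1" "\<beta> ! 7 = vu l0 l1 l2" "\<beta> ! 8 = vu (l0 * l0) (l1 * l1) (l2 * l2)"
  by (simp_all add: \<beta>_def)

lemma sum_\<beta>_eq_iff: "p = (\<Sum>i<9. c i *s \<beta> ! i) \<longleftrightarrow>
    p $ 0 = c 0 + c 1 * l0 + c 2 * (l0 * l0) \<and> p $ 1 = c 0 + c 1 * l1 + c 2 * (l1 * l1)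
    \<and> p $ 2 = c 0 + c 1 * l2 + c 2 * (l2 * l2) \<and> p $ 3 = c 3 + c 4 * l0 + c 5 * (l0 * l0)
    \<and> p $ 4 = c 3 + c 4 * l1 + c 5 * (l1 * l1) \<and> p $ 5 = c 3 + c 4 * l2 + c 5 * (l2 * l2)
    \<and> p $ 6 = c 6 + c 7 * l0 + c 8 * (l0 * l0) \<and> p $ 7 = c 6 + c 7 * l1 + c 8 * (l1 * l1)
    \<and> p $ 8 = c 6 + c 7 * l2 + c 8 * (l2 * l2)"
  unfolding sum_\<beta> \<beta>_nth vector_9_eq_iff by (simp add: vector_smult_component)

lemma all_less_9: "(\<forall>i<9. P i) \<longleftrightarrow> P 0 \<and> P 1 \<and> P 2 \<and> P 3 \<and> P 4 \<and> P 5 \<and> P 6 \<and> P 7 \<and> P (8 :: nat)"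
proof (intro iffI allI impI)
  fix i :: nat assume P: "P 0 \<and> P 1 \<and> P 2 \<and> P 3 \<and> P 4 \<and> P 5 \<and> P 6 \<and> P 7 \<and> P (8 :: nat)" and "i < 9"
  then have "i = 0 \<or> i = 1 \<or> i = 2 \<or> i = 3 \<or> i = 4 \<or> i = 5 \<or> i = 6 \<or> i = 7 \<or> i = 8" by presburger
  then show "P i" using P by (elim disjE) simp_all
qed simp

end

context cubic_unit
begin

lemma indep_mod_\<beta>: "model.indep_mod {0} {..<9} ((!) \<beta>)"
  unfolding model.indep_mod_def
proof (intro allI impI)
  fix c :: "nat \<Rightarrow> complex" assume "(\<Sum>i<9. c i *s \<beta> ! i) \<in> {0}"
  then have "0 = (\<Sum>i<9. c i *s \<beta> ! i)" by simp
  then have z: "c 0 + c 1 * l0 + c 2 * (l0 * l0) = 0" "c 0 + c 1 * l1 + c 2 * (l1 * l1) = 0"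
    "c 0 + c 1 * l2 + c 2 * (l2 * l2) = 0" "c 3 + c 4 * l0 + c 5 * (l0 * l0) = 0"
    "c 3 + c 4 * l1 + c 5 * (l1 * l1) = 0" "c 3 + c 4 * l2 + c 5 * (l2 * l2) = 0"
    "c 6 + c 7 * l0 + c 8 * (l0 * l0) = 0" "c 6 + c 7 * l1 + c 8 * (l1 * l1) = 0"
    "c 6 + c 7 * l2 + c 8 * (l2 * l2) = 0"
    unfolding sum_\<beta>_eq_iff by simp_all
  have "\<forall>i<9. c i = 0"
    unfolding all_less_9
    using quadratic_eq_0[OF z(1-3) distinct_l] quadratic_eq_0[OF z(4-6) distinct_l]
      quadratic_eq_0[OF z(7-9) distinct_l] by simp
  then show "\<forall>i\<in>{..<9}. c i = 0" by simp
qed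

lemma distinct_\<beta>: "distinct \<beta>" and independent_\<beta>: "model.independent (set \<beta>)"
proof -
  have "inj_on ((!) \<beta>) {..<9}"
    by (rule model.indep_mod_inj_on[OF model.subspace_single_0 indep_mod_\<beta>]) simp
  then show "distinct \<beta>" by (auto simp: distinct_conv_nth inj_on_def)
  have "set \<beta> = (!) \<beta> ` {..<9}" by (simp add: set_conv_nth image_def lessThan_def) blast
  then show "model.independent (set \<beta>)"
    using model.indep_mod_union_basis(1)[OF model.subspace_single_0 _ indep_mod_\<beta>, of "{}"]
    by (simp add: model.independent_empty)
qed

lemma in_span_\<beta>: "i < 9 \<Longrightarrow> \<beta> ! i \<in> model.span (set \<beta>)" "i < 9 \<Longrightarrow> \<beta> ! i \<in> model.rational.span (set \<beta>)"
  by (simp_all add: model.span_base model.rational.span_base)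

text \<open>The conjugates are three distinct points, so any three complex coordinates are values of
  a polynomial of degree at most 2. Interpolation in each degree gives the coefficients.\<close>

lemma span_\<beta>: "model.span (set \<beta>) = UNIV"
proof (intro UNIV_eq_I[symmetric] )
  fix p :: "complex ^ 9"
  obtain c0 c1 c2 where c012: "p $ 0 = c0 + c1 * l0 + c2 * (l0 * l0)"
    "p $ 1 = c0 + c1 * l1 + c2 * (l1 * l1)" "p $ 2 = c0 + c1 * l2 + c2 * (l2 * l2)"
    using quadratic_interpolation[OF distinct_l, of "p $ 0" "p $ 1" "p $ 2"] by blast
  obtain c3 c4 c5 where c345: "p $ 3 = c3 + c4 * l0 + c5 * (l0 * l0)"
    "p $ 4 = c3 + c4 * l1 + c5 * (l1 * l1)" "p $ 5 = c3 + c4 * l2 + c5 * (l2 * l2)"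
    using quadratic_interpolation[OF distinct_l, of "p $ 3" "p $ 4" "p $ 5"] by blast
  obtain c6 c7 c8 where c678: "p $ 6 = c6 + c7 * l0 + c8 * (l0 * l0)"
    "p $ 7 = c6 + c7 * l1 + c8 * (l1 * l1)" "p $ 8 = c6 + c7 * l2 + c8 * (l2 * l2)"
    using quadratic_interpolation[OF distinct_l, of "p $ 6" "p $ 7" "p $ 8"] by blast
  note c = c012 c345 c678
  have "p = (\<Sum>i<9. [c0, c1, c2, c3, c4, c5, c6, c7, c8] ! i *s \<beta> ! i)"
    unfolding sum_\<beta>_eq_iff using c by simp
  also have "\<dots> \<in> model.span (set \<beta>)"
    by (intro model.span_sum model.span_scale in_span_\<beta>) simp
  finally show "p \<in> model.span (set \<beta>)" .
qed

lemma rational_span_\<beta>: "model.rational.span (set \<beta>) = F"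
proof
  have "K 1 1 1" using K_I[of 1 0 0] by simp
  moreover have "K l0 l1 l2" using K_I[of 0 1 0] by simp
  moreover have "K (l0 * l0) (l1 * l1) (l2 * l2)" using K_I[of 0 0 1] by simp
  moreover have "K 0 0 0" using K_I[of 0 0 0] by simp
  ultimately have "set \<beta> \<subseteq> F" by (simp add: \<beta>_def F_def)
  then show "model.rational.span (set \<beta>) \<subseteq> F" by (rule model.rational.span_minimal) (rule subspace_F)
  show "F \<subseteq> model.rational.span (set \<beta>)"
  proof
    fix p assume "p \<in> F"
    then have p: "K (p $ 0) (p $ 1) (p $ 2)" "K (p $ 3) (p $ 4) (p $ 5)" "K (p $ 6) (p $ 7) (p $ 8)"
      by (simp_all add: F_def)
    obtain c0 c1 c2 where c012: "c0 \<in> \<rat>" "c1 \<in> \<rat>" "c2 \<in> \<rat>" "p $ 0 = c0 + c1 * l0 + c2 * (l0 * l0)"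
      "p $ 1 = c0 + c1 * l1 + c2 * (l1 * l1)" "p $ 2 = c0 + c1 * l2 + c2 * (l2 * l2)" using K_E[OF p(1)] .
    obtain c3 c4 c5 where c345: "c3 \<in> \<rat>" "c4 \<in> \<rat>" "c5 \<in> \<rat>" "p $ 3 = c3 + c4 * l0 + c5 * (l0 * l0)"
      "p $ 4 = c3 + c4 * l1 + c5 * (l1 * l1)" "p $ 5 = c3 + c4 * l2 + c5 * (l2 * l2)" using K_E[OF p(2)] .
    obtain c6 c7 c8 where c678: "c6 \<in> \<rat>" "c7 \<in> \<rat>" "c8 \<in> \<rat>" "p $ 6 = c6 + c7 * l0 + c8 * (l0 * l0)"
      "p $ 7 = c6 + c7 * l1 + c8 * (l1 * l1)" "p $ 8 = c6 + c7 * l2 + c8 * (l2 * l2)" using K_E[OF p(3)] .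
    note rat = c012(1-3) c345(1-3) c678(1-3) and c = c012(4-6) c345(4-6) c678(4-6)
    let ?c = "[c0, c1, c2, c3, c4, c5, c6, c7, c8]"
    have "\<forall>i<9. ?c ! i \<in> \<rat>" unfolding all_less_9 using rat by simp
    then have "\<forall>i. \<exists>q. i < 9 \<longrightarrow> ?c ! i = of_rat q" by (auto simp: Rats_def)
    then obtain q where q: "i < 9 \<Longrightarrow> ?c ! i = of_rat (q i)" for i by metis
    have "p = (\<Sum>i<9. ?c ! i *s \<beta> ! i)" unfolding sum_\<beta>_eq_iff using c by simp
    also have "\<dots> = (\<Sum>i<9. model.rational_scale (q i) (\<beta> ! i))"
      by (intro sum.cong refl) (simp add: q model.rational_scale_def del: nth_Cons')
    also have "\<dots> \<in> model.rational.span (set \<beta>)"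
      by (intro model.rational.span_sum model.rational.span_scale in_span_\<beta>) simp
    finally show "p \<in> model.rational.span (set \<beta>)" .
  qed
qed

lemma rational_independent_\<beta>: "model.rational.independent (set \<beta>)"
  by (rule model.rational_independent[OF independent_\<beta>])

lemma rational_form_F: "model.rational_form F"
  unfolding model.rational_form_def model.rational.subalgebra_def model.rational.basis_of_def model.basis_of_def
  using subspace_F bracket_F rational_independent_\<beta> rational_span_\<beta> independent_\<beta> span_\<beta> by blast

end

section \<open>The hyperbolic unimodular automorphism\<close>

context cubic_unit
begin

text \<open>The weights are \<open>r\<close>, \<open>r \<sigma>(r) = 1 - r\<^sup>2\<close> and \<open>r\<^sup>2 \<sigma>(r) = r\<^sup>2 - r - 1\<close>, where
  \<open>\<sigma>(r) = r\<^sup>2 - 2\<close>, at the three conjugates.\<close>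

definition weight :: "complex ^ 9" where
  "weight = vx l0 l1 l2 + (vw (1 - l0 * l0) (1 - l1 * l1) (1 - l2 * l2)
     + vu (l0 * l0 - l0 - 1) (l1 * l1 - l1 - 1) (l2 * l2 - l2 - 1))"

text \<open>The unit r has inverse r^2 + r - 2 by its cubic equation. As r has norm 1, the inverse
  of r \<sigma>(r) is the third conjugate 1 - r - r^2; dividing this by r gives r^2 - 3.\<close>

definition inverse_weight :: "complex ^ 9" where
  "inverse_weight = vx (l0 * l0 + l0 - 2) (l1 * l1 + l1 - 2) (l2 * l2 + l2 - 2)
     + (vw (1 - l0 - l0 * l0) (1 - l1 - l1 * l1) (1 - l2 - l2 * l2)
     + vu (l0 * l0 - 3) (l1 * l1 - 3) (l2 * l2 - 3))"

definition \<tau> :: "complex ^ 9 \<Rightarrow> complex ^ 9" where "\<tau> p = (\<chi> i. weight $ i * p $ i)"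
definition \<tau>' :: "complex ^ 9 \<Rightarrow> complex ^ 9" where "\<tau>' p = (\<chi> i. inverse_weight $ i * p $ i)"

lemma weight_inverse: "weight $ i * inverse_weight $ i = 1"
proof -
  have x: "x * (x * x + x - 2) = 1" "(1 - x * x) * (1 - x - x * x) = 1" "(x * x - x - 1) * (x * x - 3) = 1"
    if c: "x * x * x = 1 + 2 * x - x * x" for x :: complex
  proof -
    have "x * (x * x + x - 2) = 1 + (x * x * x - (1 + 2 * x - x * x))"
      "(1 - x * x) * (1 - x - x * x) = 1 + (x * x * x - (1 + 2 * x - x * x)) * x"
      "(x * x - x - 1) * (x * x - 3) = 1 + (x * x * x - (1 + 2 * x - x * x)) * (x - 2)"
      by (simp_all add: algebra_simps)
    then show "x * (x * x + x - 2) = 1" "(1 - x * x) * (1 - x - x * x) = 1" "(x * x - x - 1) * (x * x - 3) = 1"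
      by (simp_all add: c)
  qed
  have "\<forall>i. weight $ i * inverse_weight $ i = 1"
    unfolding forall_9 using x[OF cubic_l(1)] x[OF cubic_l(2)] x[OF cubic_l(3)]
    by (simp add: weight_def inverse_weight_def)
  then show ?thesis by blast
qed

lemma \<tau>_inverse: "\<tau>' (\<tau> p) = p" "\<tau> (\<tau>' p) = p"
proof -
  have "inverse_weight $ i * (weight $ i * p $ i) = p $ i" "weight $ i * (inverse_weight $ i * p $ i) = p $ i" for i
  proof -
    have "inverse_weight $ i * (weight $ i * p $ i) = (weight $ i * inverse_weight $ i) * p $ i"
      "weight $ i * (inverse_weight $ i * p $ i) = (weight $ i * inverse_weight $ i) * p $ i"
      by (simp_all only: mult_ac)
    then show "inverse_weight $ i * (weight $ i * p $ i) = p $ i" "weight $ i * (inverse_weight $ i * p $ i) = p $ i"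
      unfolding weight_inverse by simp_all
  qed
  then show "\<tau>' (\<tau> p) = p" "\<tau> (\<tau>' p) = p"
    by (simp_all add: \<tau>_def \<tau>'_def Finite_Cartesian_Product.vec_eq_iff)
qed

lemma \<tau>_F: assumes "p \<in> F" shows "\<tau> p \<in> F" "\<tau>' p \<in> F"
proof -
  have q: "K (q0 + q1 * l0 + q2 * (l0 * l0)) (q0 + q1 * l1 + q2 * (l1 * l1)) (q0 + q1 * l2 + q2 * (l2 * l2))"
    if "q0 \<in> \<rat>" "q1 \<in> \<rat>" "q2 \<in> \<rat>" for q0 q1 q2 using K_I[OF that] .
  have "K l0 l1 l2" "K (1 - l0 * l0) (1 - l1 * l1) (1 - l2 * l2)"
    "K (l0 * l0 - l0 - 1) (l1 * l1 - l1 - 1) (l2 * l2 - l2 - 1)"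
    "K (l0 * l0 + l0 - 2) (l1 * l1 + l1 - 2) (l2 * l2 + l2 - 2)"
    "K (1 - l0 - l0 * l0) (1 - l1 - l1 * l1) (1 - l2 - l2 * l2)"
    "K (l0 * l0 - 3) (l1 * l1 - 3) (l2 * l2 - 3)"
    using q[of 0 1 0] q[of 1 0 "-1"] q[of "-1" "-1" 1] q[of "-2" 1 1] q[of 1 "-1" "-1"] q[of "-3" 0 1]
    by (simp_all add: algebra_simps)
  then show "\<tau> p \<in> F" "\<tau>' p \<in> F"
    using assms by (auto simp: F_def \<tau>_def \<tau>'_def weight_def inverse_weight_def intro: K_mult)
qed

lemma \<tau>_add: "\<tau> (p + q) = \<tau> p + \<tau> q"
  by (simp add: \<tau>_def Finite_Cartesian_Product.vec_eq_iff algebra_simps)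

lemma \<tau>_scale: "\<tau> (c *s p) = c *s \<tau> p"
  by (simp add: \<tau>_def Finite_Cartesian_Product.vec_eq_iff vector_smult_component algebra_simps)

text \<open>A diagonal map respects the brackets because the weight of each bracket of generators is
  the product of their weights. The reductions \<open>x\<close> express this with r \<sigma>(r) = 1
  - r^2 and r (1 - r^2) = r^2 - r - 1.\<close>

lemma \<tau>_bracket: "\<tau> (model_bracket p q) = model_bracket (\<tau> p) (\<tau> q)"
proof -
  have x: "x * y = 1 - x * x" "x * (1 - x * x) = x * x - x - 1"
    if c: "x * x * x = 1 + 2 * x - x * x" and y: "y = x * x - 2" for x y :: complex
  proof -
    have "x * y = 1 - x * x + (x * x * x - (1 + 2 * x - x * x))"
      "x * (1 - x * x) = x * x - x - 1 - (x * x * x - (1 + 2 * x - x * x))"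
      unfolding y by (simp_all add: algebra_simps)
    then show "x * y = 1 - x * x" "x * (1 - x * x) = x * x - x - 1" by (simp_all add: c)
  qed
  have m: "(a * b) * (s * t - u * v) = (a * s) * (b * t) - (b * u) * (a * v)" for a b s t u v :: complex
    by (simp add: algebra_simps)
  note x0 = x[OF cubic_l(1) galois_l(1)] and x1 = x[OF cubic_l(2) galois_l(2)] and x2 = x[OF cubic_l(3) galois_l(3)]
  show ?thesis
    unfolding vector_9_eq_iff
    by (simp add: \<tau>_def weight_def m flip: x0 x1 x2)
qed

lemma automorphism_\<tau>: "model.rational.automorphism_on F \<tau>"
  unfolding model.rational.automorphism_on_def
proof (intro conjI allI ballI)
  show "bij_betw \<tau> F F"
    by (rule bij_betw_byWitness[where f' = \<tau>']) (use \<tau>_inverse \<tau>_F in auto)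
qed (simp_all add: \<tau>_add \<tau>_bracket model.rational_scale_def \<tau>_scale)

text \<open>The columns are the coordinates of the images of \<open>\<beta>\<close> under \<open>\<tau>\<close> and under its inverse.\<close>

definition A_cols :: "int list list" where
  "A_cols = [[0, 1, 0, 0, 0, 0, 0, 0, 0], [0, 0, 1, 0, 0, 0, 0, 0, 0], [1, 2, -1, 0, 0, 0, 0, 0, 0],
    [0, 0, 0, 1, 0, -1, 0, 0, 0], [0, 0, 0, -1, -1, 1, 0, 0, 0], [0, 0, 0, 1, 1, -2, 0, 0, 0],
    [0, 0, 0, 0, 0, 0, -1, -1, 1], [0, 0, 0, 0, 0, 0, 1, 1, -2], [0, 0, 0, 0, 0, 0, -2, -3, 3]]"

definition B_cols :: "int list list" where
  "B_cols = [[-2, 1, 1, 0, 0, 0, 0, 0, 0], [1, 0, 0, 0, 0, 0, 0, 0, 0], [0, 1, 0, 0, 0, 0, 0, 0, 0],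
    [0, 0, 0, 1, -1, -1, 0, 0, 0], [0, 0, 0, -1, -1, 0, 0, 0, 0], [0, 0, 0, 0, -1, -1, 0, 0, 0],
    [0, 0, 0, 0, 0, 0, -3, 0, 1], [0, 0, 0, 0, 0, 0, 1, -1, -1], [0, 0, 0, 0, 0, 0, -1, -1, 0]]"

definition A :: "int mat" where "A = Matrix.mat 9 9 (\<lambda>(i, j). A_cols ! j ! i)"
definition B :: "int mat" where "B = Matrix.mat 9 9 (\<lambda>(i, j). B_cols ! j ! i)"

lemma A_B: "A * B = 1\<^sub>m 9" "B * A = 1\<^sub>m 9"
proof -
  have s: "(\<Sum>k = 0..<9. f k) = f 0 + f 1 + f 2 + f 3 + f 4 + f 5 + f 6 + f 7 + f 8" for f :: "nat \<Rightarrow> int"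
    by (simp add: eval_nat_numeral)
  have "\<forall>i<9. \<forall>j<9. (\<Sum>k = 0..<9. A_cols ! k ! i * B_cols ! j ! k) = (if i = j then 1 else 0)"
    unfolding s all_less_9 A_cols_def B_cols_def by simp
  then show "A * B = 1\<^sub>m 9"
    by (intro eq_matI) (auto simp: A_def B_def scalar_prod_def)
  have "\<forall>i<9. \<forall>j<9. (\<Sum>k = 0..<9. B_cols ! k ! i * A_cols ! j ! k) = (if i = j then 1 else 0)"
    unfolding s all_less_9 A_cols_def B_cols_def by simp
  then show "B * A = 1\<^sub>m 9"
    by (intro eq_matI) (auto simp: A_def B_def scalar_prod_def)
qed

lemma \<tau>_\<beta>: "j < 9 \<Longrightarrow> \<tau> (\<beta> ! j) = (\<Sum>i<9. of_int (A_cols ! j ! i) *s \<beta> ! i)"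
proof -
  \<comment> \<open>Each product of a weight with a power of x is reduced by the cubic equation; the
    resulting coefficients are the columns of the integral matrix.\<close>
  have x: "x * (x * x) = 1 + 2 * x - x * x" "(1 - x * x) * x = x * x - x - 1"
    "(1 - x * x) * (x * x) = 1 + x - 2 * (x * x)" "(x * x - x - 1) * x = 1 + x - 2 * (x * x)"
    "(x * x - x - 1) * (x * x) = 3 * (x * x) - 3 * x - 2"
    if c: "x * x * x = 1 + 2 * x - x * x" for x :: complex
  proof -
    have "x * (x * x) = 1 + 2 * x - x * x + (x * x * x - (1 + 2 * x - x * x))"
      "(1 - x * x) * x = x * x - x - 1 - (x * x * x - (1 + 2 * x - x * x))"
      "(1 - x * x) * (x * x) = 1 + x - 2 * (x * x) - (x * x * x - (1 + 2 * x - x * x)) * (x - 1)"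
      "(x * x - x - 1) * x = 1 + x - 2 * (x * x) + (x * x * x - (1 + 2 * x - x * x))"
      "(x * x - x - 1) * (x * x) = 3 * (x * x) - 3 * x - 2 + (x * x * x - (1 + 2 * x - x * x)) * (x - 2)"
      by (simp_all add: algebra_simps)
    then show "x * (x * x) = 1 + 2 * x - x * x" "(1 - x * x) * x = x * x - x - 1"
      "(1 - x * x) * (x * x) = 1 + x - 2 * (x * x)" "(x * x - x - 1) * x = 1 + x - 2 * (x * x)"
      "(x * x - x - 1) * (x * x) = 3 * (x * x) - 3 * x - 2"
      by (simp_all add: c)
  qed
  have "\<forall>j<9. \<tau> (\<beta> ! j) = (\<Sum>i<9. of_int (A_cols ! j ! i) *s \<beta> ! i)"
    unfolding all_less_9 sum_\<beta>_eq_iff \<beta>_nth A_cols_def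
    by (simp add: \<tau>_def weight_def x[OF cubic_l(1)] x[OF cubic_l(2)] x[OF cubic_l(3)])
  then show "j < 9 \<Longrightarrow> \<tau> (\<beta> ! j) = (\<Sum>i<9. of_int (A_cols ! j ! i) *s \<beta> ! i)" by blast
qed

lemma ordered_basis_\<beta>: "model.rational.ordered_basis_of F \<beta>"
  unfolding model.rational.ordered_basis_of_def model.rational.basis_of_def
  using distinct_\<beta> rational_independent_\<beta> rational_span_\<beta> by blast

lemma unimodular_\<tau>: "model.rational.unimodular_on F \<tau>"
proof -
  have "model.rational.matrix_wrt \<beta> \<tau> = map_mat of_int A"
  proof (rule eq_matI)
    fix i j assume "i < dim_row (map_mat of_int A :: rat mat)" "j < dim_col (map_mat of_int A :: rat mat)"
    then have ij: "i < 9" "j < 9" by (simp_all add: A_def)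
    have "\<tau> (\<beta> ! j) = (\<Sum>k<length \<beta>. model.rational_scale (of_int (A_cols ! j ! k)) (\<beta> ! k))"
      using \<tau>_\<beta>[OF ij(2)] by (simp add: model.rational_scale_def)
    then show "model.rational.matrix_wrt \<beta> \<tau> $$ (i, j) = map_mat of_int A $$ (i, j)"
      using ij model.rational.representation_list[OF distinct_\<beta> rational_independent_\<beta>, of i
          "\<lambda>k. of_int (A_cols ! j ! k)"]
      by (simp add: model.rational.matrix_wrt_def A_def)
  qed (simp_all add: model.rational.matrix_wrt_def A_def)
  moreover have "invertible_mat A"
    using A_B unfolding invertible_mat_def inverts_mat_def by (auto simp: A_def B_def intro!: exI[of _ B])
  ultimately show ?thesis
    unfolding model.rational.unimodular_on_def using ordered_basis_\<beta> by blast
qed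

text \<open>All weights are real, so only the values 1 and -1 have to be avoided, and the bounds on
  the conjugates suffice.\<close>

lemma weight_not_unit: "cmod (weight $ i) \<noteq> 1"
proof -
  have sq: "36/25 < r0 * r0" "r0 * r0 < 169/100" "9/100 < r1 * r1" "r1 * r1 < 9/25"
    "64/25 < r2 * r2" "r2 * r2 < 4"
  proof -
    \<comment> \<open>\<open>r1\<close> and \<open>r2\<close> are negative; squaring their negatives
      keeps the factors positive, as monotonicity of multiplication requires.\<close>
    have "6/5 * (6/5) < r0 * r0" "r0 * r0 < 13/10 * (13/10)" "3/10 * (3/10) < - r1 * - r1"
      "- r1 * - r1 < 3/5 * (3/5)" "8/5 * (8/5) < - r2 * - r2" "- r2 * - r2 < 2 * 2"
      using bounds by (intro mult_strict_mono; simp)+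
    then show "36/25 < r0 * r0" "r0 * r0 < 169/100" "9/100 < r1 * r1" "r1 * r1 < 9/25"
      "64/25 < r2 * r2" "r2 * r2 < 4" by simp_all
  qed
  have W: "weight $ 0 = of_real r0" "weight $ 1 = of_real r1" "weight $ 2 = of_real r2"
    "weight $ 3 = of_real (1 - r0 * r0)" "weight $ 4 = of_real (1 - r1 * r1)" "weight $ 5 = of_real (1 - r2 * r2)"
    "weight $ 6 = of_real (r0 * r0 - r0 - 1)" "weight $ 7 = of_real (r1 * r1 - r1 - 1)"
    "weight $ 8 = of_real (r2 * r2 - r2 - 1)"
    by (simp_all add: weight_def)
  have w: "cmod (complex_of_real r) \<noteq> 1" if "r \<noteq> 1" "r \<noteq> -1" for r using that by (auto simp: abs_if)
  have "\<forall>i. cmod (weight $ i) \<noteq> 1"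
    unfolding forall_9 W by (intro conjI w) (use bounds sq in linarith)+
  then show ?thesis by blast
qed

text \<open>The eigenvalue may come from an arbitrary rational basis \<gamma>. Since \<gamma> is
  independent over the complex numbers too, an eigenvector of the matrix yields a nonzero vector
  \<open>v\<close> with \<open>\<tau> v = z *s v\<close>, and \<tau> is diagonal in the
  coordinates.\<close>

lemma hyperbolic_\<tau>: "model.rational.hyperbolic_on F \<tau>"
proof -
  interpret V: finite_dimensional_vector_space "(*s) :: complex \<Rightarrow> complex ^ 9 \<Rightarrow> complex ^ 9" "set \<beta>"
    by unfold_locales (simp_all add: independent_\<beta> span_\<beta>)
  interpret fd: fd_rational_form "(*s)" model_bracket "set \<beta>" F
    by unfold_locales (rule rational_form_F)
  have "cmod z \<noteq> 1" if z: "model.rational.complex_eigenvalue_on F \<tau> z" for z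
  proof -
    obtain \<gamma> where \<gamma>: "model.rational.ordered_basis_of F \<gamma>"
      and ev: "eigenvalue (map_mat of_rat (model.rational.matrix_wrt \<gamma> \<tau>)) z"
      using z unfolding model.rational.complex_eigenvalue_on_def by blast
    have d: "distinct \<gamma>" "model.rational.independent (set \<gamma>)" "model.rational.span (set \<gamma>) = F"
      using \<gamma> unfolding model.rational.ordered_basis_of_def model.rational.basis_of_def by auto
    let ?n = "length \<gamma>"
    let ?M = "map_mat of_rat (model.rational.matrix_wrt \<gamma> \<tau>) :: complex mat"
    have M: "?M \<in> carrier_mat ?n ?n" by (simp add: model.rational.matrix_wrt_def)
    have \<gamma>_F: "\<gamma> ! j \<in> F" if "j < ?n" for j
      using that d(3) model.rational.span_superset nth_mem by blast
    have ind: "model.independent (set \<gamma>)"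
      by (rule fd.independent_if_rational[OF _ d(2)]) (use d(3) model.rational.span_superset in blast)
    have \<tau>_\<gamma>: "\<tau> (\<gamma> ! j) = (\<Sum>i<?n. ?M $$ (i, j) *s \<gamma> ! i)" if j: "j < ?n" for j
    proof -
      have "\<tau> (\<gamma> ! j) \<in> model.rational.span (set \<gamma>)" using \<tau>_F(1)[OF \<gamma>_F[OF j]] d(3) by simp
      then have "(\<Sum>b\<in>set \<gamma>. model.rational_scale (model.rational.representation (set \<gamma>) (\<tau> (\<gamma> ! j)) b) b) = \<tau> (\<gamma> ! j)"
        by (intro model.rational.sum_representation_eq d(2)) auto
      then have "(\<Sum>i<?n. model.rational_scale (model.rational.representation (set \<gamma>) (\<tau> (\<gamma> ! j)) (\<gamma> ! i)) (\<gamma> ! i)) = \<tau> (\<gamma> ! j)"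
        by (simp only: sum_set_nth[OF d(1)])
      moreover have "(\<Sum>i<?n. ?M $$ (i, j) *s \<gamma> ! i)
          = (\<Sum>i<?n. model.rational_scale (model.rational.representation (set \<gamma>) (\<tau> (\<gamma> ! j)) (\<gamma> ! i)) (\<gamma> ! i))"
        using j by (intro sum.cong refl) (simp add: model.rational.matrix_wrt_def model.rational_scale_def)
      ultimately show ?thesis by (rule trans[symmetric, rotated])
    qed
    obtain c where c: "c \<in> carrier_vec ?n" "c \<noteq> 0\<^sub>v ?n" "?M *\<^sub>v c = z \<cdot>\<^sub>v c"
      using ev M unfolding eigenvalue_def eigenvector_def by auto
    define v where "v = (\<Sum>j<?n. vec_index c j *s \<gamma> ! j)"
    have "v \<noteq> 0"
    proof
      assume "v = 0"
      then have "vec_index c j = 0" if "j < ?n" for j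
        using model.independent_list_iff[OF d(1) ind _ that, of "vec_index c"] by (simp add: v_def)
      then have "c = 0\<^sub>v ?n" using c(1) by (intro eq_vecI) auto
      then show False using c(2) by simp
    qed
    \<comment> \<open>Comparing a nonzero coordinate on both sides of the eigenvector equation will
      identify \<open>z\<close> with a weight.\<close>
    then obtain k where k: "v $ k \<noteq> 0" by (auto simp: Finite_Cartesian_Product.vec_eq_iff)
    have \<tau>_sum: "\<tau> (\<Sum>j\<in>J. f j *s g j) = (\<Sum>j\<in>J. f j *s \<tau> (g j))" if "finite J" for J :: "nat set" and f g
    proof -
      have \<tau>_0: "\<tau> 0 = 0" using \<tau>_scale[of 0 0] by simp
      show ?thesis using that by (induction J rule: finite_induct) (simp_all add: \<tau>_0 \<tau>_add \<tau>_scale)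
    qed
    have "\<tau> v = (\<Sum>j<?n. vec_index c j *s (\<Sum>i<?n. ?M $$ (i, j) *s \<gamma> ! i))"
      unfolding v_def \<tau>_sum[OF finite_lessThan] by (intro sum.cong refl) (simp add: \<tau>_\<gamma>)
    also have "\<dots> = (\<Sum>j<?n. \<Sum>i<?n. (?M $$ (i, j) * vec_index c j) *s \<gamma> ! i)"
      by (simp only: model.scale_sum_right model.scale_scale mult.commute)
    also have "\<dots> = (\<Sum>i<?n. (\<Sum>j<?n. ?M $$ (i, j) * vec_index c j) *s \<gamma> ! i)"
      unfolding model.scale_sum_left by (rule sum.swap)
    also have "\<dots> = (\<Sum>i<?n. (z * vec_index c i) *s \<gamma> ! i)"
    proof (intro sum.cong refl)
      fix i assume "i \<in> {..<?n}"
      then have i: "i < ?n" by simp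
      have "(\<Sum>j<?n. ?M $$ (i, j) * vec_index c j) = vec_index (?M *\<^sub>v c) i"
        using i M c(1) by (auto simp: scalar_prod_def atLeast0LessThan intro!: sum.cong)
      also have "\<dots> = z * vec_index c i" using c(1) i unfolding c(3) by simp
      finally show "(\<Sum>j<?n. ?M $$ (i, j) * vec_index c j) *s \<gamma> ! i = (z * vec_index c i) *s \<gamma> ! i" by simp
    qed
    also have "\<dots> = z *s v" by (simp add: v_def model.scale_sum_right)
    finally have "\<tau> v = z *s v" .
    then have "\<tau> v $ k = (z *s v) $ k" by (rule arg_cong)
    then have "weight $ k * v $ k = z * v $ k" by (simp add: \<tau>_def vector_smult_component)
    then have "z = weight $ k" using k by simp
    then show ?thesis using weight_not_unit by simp
  qed
  then show ?thesis unfolding model.rational.hyperbolic_on_def by blast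
qed

lemma model_anosov: "complex_anosov_of_type [3, 3, 3] (*s) model_bracket"
  unfolding complex_anosov_of_type_def model.anosov_def model.rational.anosov_on_def
  by (intro conjI exI[of _ F] exI[of _ \<tau>] model_lie_algebra rational_form_F automorphism_\<tau> hyperbolic_\<tau>
      unimodular_\<tau> model_has_type)

end

lemma complex_anosov_333_model: "complex_anosov_of_type [3, 3, 3] (*s) model_bracket"
proof -
  have "\<exists>r0 r1 r2. cubic_unit r0 r1 r2"
  proof (rule cubic_unit_conjugates, goal_cases)
    case (1 r0 r1 r2)
    then have "cubic_unit r0 r1 r2" by (rule cubic_unit.intro)
    then show ?case by blast
  qed
  then show ?thesis using cubic_unit.model_anosov by blast
qed

theorem proposition3p3:
  shows "(\<exists>b :: complex ^ 9 \<Rightarrow> complex ^ 9 \<Rightarrow> complex ^ 9.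
            complex_anosov_of_type [3, 3, 3] vector_scalar_mult b)
       \<and> (\<forall>(s :: complex \<Rightarrow> 'v::ab_group_add \<Rightarrow> 'v) b (s' :: complex \<Rightarrow> 'w::ab_group_add \<Rightarrow> 'w) b'.
            complex_anosov_of_type [3, 3, 3] s b \<and> complex_anosov_of_type [3, 3, 3] s' b'
            \<longrightarrow> lie_isomorphic s b s' b')"
proof (intro conjI allI impI)
  show "\<exists>b :: complex ^ 9 \<Rightarrow> complex ^ 9 \<Rightarrow> complex ^ 9. complex_anosov_of_type [3, 3, 3] (*s) b"
    using complex_anosov_333_model by blast
next
  fix s :: "complex \<Rightarrow> 'v::ab_group_add \<Rightarrow> 'v" and b and s' :: "complex \<Rightarrow> 'w::ab_group_add \<Rightarrow> 'w" and b'
  assume "complex_anosov_of_type [3, 3, 3] s b \<and> complex_anosov_of_type [3, 3, 3] s' b'"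
  then show "lie_isomorphic s b s' b'"
    by (elim conjE) (rule lie_isomorphic_common_source; rule complex_anosov_333_isomorphic_model)
qed

end
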